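(* Let $\varphi,f:\mathbb{R}^n\to\mathbb{R}\cup\{+\infty\}$ be proper lower semicontinuous functions, $F=f+\varphi$, and suppose that $f$ is accessed through a stochastic one-sided model with constants $p\in(1,2]$, $\nu\in(0,1]$, $\tau,\eta,L_1,L_2$ as described in the context. Fix $\bar\rho>2(2\tau+\eta)$ and a sequence $\{\beta_t\}\subset(\tilde\rho,+\infty)$, where $\tilde\rho=\bar\rho$ if $p\in(1,2)$ and $\tilde\rho=2\bar\rho+\tau$ if $p=2$. Let $\{x_t\}$ be generated by the stochastic model-based method described in the context. Then for every $T\ge0$, $$\begin{aligned}\mathbb{E}\Big[\sum_{t=0}^T\mathcal{A}(\beta_t-\eta)^{-1}d\big(0,\partial M_F^{1/\bar\rho}(x_t)\big)^2\Big]\le\;&2\bar\rho\big(M_F^{1/\bar\rho}(x_0)-\min F\big)\\&+\bar\rho^2\mathcal{B}\sum_{t=0}^T\Big((\beta_t-\tilde\rho)^{-\frac{2}{2-p}}+L_1^2(\beta_t-\tilde\rho)^{-2}+(\beta_t-\tilde\rho)^{-\frac{p}{2-p}}+L_1^p(\beta_t-\tilde\rho)^{-p}\\&\qquad\qquad+L_2^{\frac{2}{2-\nu}}(\beta_t-\tilde\rho)^{-\frac{2}{2-\nu}}+L_2^{\frac{p}{2-\nu}}(\beta_t-\tilde\rho)^{-\frac{p}{2-\nu}}\Big),\end{aligned}$$ where $$\mathcal{A}=\min\{A,B\},\qquad \mathcal{B}=\max\Big\{G\,A\,B^{\frac{p}{2-p}}+C,\;G\,B^{\frac{p}{2-p}}+\tfrac2p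 C^{p/2},\;2D,\;E,\;\tfrac2pE^{p/2}\Big\},$$ with $A=\bar\rho-\eta$, $B=\frac{2(\bar\rho-\tau)}{p}$, and - if $p\in(1,2)$: $C=(2-p)p^{-1}3^{\frac{p}{2-p}}(\bar\rho+\tau)^{\frac{2}{2-p}}$, $D=12$, $E=(2-\nu)2^{\frac{2}{2-\nu}}(3\nu)^{\frac{\nu}{2-\nu}}$, $G=1$; - if $p=2$: $C=0$, $D=8$, $E=(2-\nu)2^{\frac{2}{2-\nu}}(2\nu)^{\frac{\nu}{2-\nu}}$, $G=0$. When $p=2$, all terms containing an exponent with denominator $2-p$ (namely $(\beta_t-\tilde\rho)^{-2/(2-p)}$, $(\beta_t-\tilde\rho)^{-p/(2-p)}$ and $G\,B^{p/(2-p)}$) are understood to be $0$.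
   Context: $\mathbb{R}^n$ is Euclidean space with norm $\|\cdot\|$ and inner product $\langle\cdot,\cdot\rangle$. A function $q$ is $\eta$-weakly convex if $q+\frac\eta2\|\cdot\|^2$ is convex. Subdifferentials: the Fréchet subdifferential of $q$ at $x\in\mathrm{dom}\, q$ is $\widehat\partial q(x)=\{v:\liminf_{y\to x,\,y\ne x}\frac{q(y)-q(x)-\langle v,y-x\rangle}{\|y-x\|}\ge0\}$. The limiting subdifferential $\partial q(x)$ is the set of $v$ for which there exist $x_k\to x$ with $q(x_k)\to q(x)$ and $v_k\in\widehat\partial q(x_k)$ with $v_k\to v$. For a set $S$, $d(0,S)=\inf\{\|v\|:v\in S\}$. Generalized Moreau--Yosida regularization (with kernel $h(t)=t^p/p+t^2/2$): for $r>0$, $M_F^r(x)=\inf_{y\in\mathbb{R}^n}\{F(y)+\frac1r(\frac1p\|x-y\|^p+\frac12\|x-y\|^2)\}$. Stochastic one-sided model: $(\Omega,\mathcal{F},\pi)$ is a probability space, $\mathbb{R}^n$ carries its Borel $\sigma$-algebra, and there are positive reals $p\in(1,2]$, $\nu\in(0,1]$, $\tau,\eta,L_1,L_2$ such that: (i) one can draw i.i.d. realizations $\xi_0,\xi_1,\dots$ from $\pi$; (ii) there are an open set $U\supset\mathrm{dom}\,\varphi$ on which $f$ is finite and a measurable function $(x,y,\xi)\mapsto f_x(y,\xi)$ on $U\times U\times\Omega$ with $\mathbb{E}_\xi[f_x(x,\xi)]=f(x)$ for all $x\in U$ and $\mathbb{E}_\xi[f_x(y,\xi)-f(y)]\le\frac\tau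 p\|x-y\|^p$ for all $x,y\in U$; (iii) for all $x\in U$ and a.e. $\xi\sim\pi$, the function $f_x(\cdot,\xi)+\varphi(\cdot)$ (equal to $+\infty$ outside $\mathrm{dom}\,\varphi$) is $\eta$-weakly convex; (iv) there are measurable $\mathcal{L}_1,\mathcal{L}_2:\Omega\to\mathbb{R}_+$ with $(\mathbb{E}_\xi[\mathcal{L}_1(\xi)^2])^{1/2}\le L_1$, $(\mathbb{E}_\xi[\mathcal{L}_2(\xi)^{\nu+1}])^{1/(\nu+1)}\le L_2$, and for all $x,y\in U$ and a.e. $\xi\sim\pi$, $f_x(x,\xi)-f_x(y,\xi)\le\mathcal{L}_1(\xi)\|x-y\|+\mathcal{L}_2(\xi)\|x-y\|^\nu$. Stochastic model-based method: given $x_0\in\mathrm{dom}\,\varphi$, for $t=0,1,\dots,T$ draw $\xi_t\sim\pi$ (i.i.d.) and let $x_{t+1}$ be the minimizer over $x$ of $\varphi(x)+f_{x_t}(x,\xi_t)+\frac{\beta_t}{2}\|x-x_t\|^2$. Expectations are over all randomness. $\min F$ denotes the minimum value of $F$ over $\mathbb{R}^n$, assumed to exist. *)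

theory Defs
  imports "HOL-Probability.Probability"
begin

section \<open>Extended-valued functions\<close>

definition dom_e :: "('a \<Rightarrow> ereal) \<Rightarrow> 'a set" where
  "dom_e q = {x. q x < \<infinity>}"

definition proper :: "('a \<Rightarrow> ereal) \<Rightarrow> bool" where
  "proper q \<longleftrightarrow> (\<forall>x. q x \<noteq> -\<infinity>) \<and> dom_e q \<noteq> {}"

definition lower_semicontinuous :: "('a::topological_space \<Rightarrow> ereal) \<Rightarrow> bool" where
  "lower_semicontinuous q \<longleftrightarrow> (\<forall>x. q x \<le> Liminf (at x) q)"

text \<open>Only used for functions that never take the value \<open>-\<infinity>\<close>, so that no \<open>\<infinity> - \<infinity>\<close> arises
  on the right-hand side; the products are harmless since \<open>0 * \<infinity> = 0\<close>.\<close>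

definition convex_ereal :: "('a::real_vector \<Rightarrow> ereal) \<Rightarrow> bool" where
  "convex_ereal q \<longleftrightarrow>
     (\<forall>x y u v. 0 \<le> u \<longrightarrow> 0 \<le> v \<longrightarrow> u + v = 1 \<longrightarrow>
        q (u *\<^sub>R x + v *\<^sub>R y) \<le> ereal u * q x + ereal v * q y)"

definition weakly_convex :: "real \<Rightarrow> ('a::real_normed_vector \<Rightarrow> ereal) \<Rightarrow> bool" where
  "weakly_convex \<eta> q \<longleftrightarrow> convex_ereal (\<lambda>x. q x + ereal (\<eta> / 2 * (norm x)\<^sup>2))"

section \<open>Subdifferentials\<close>

text \<open>Both subdifferentials are empty outside the domain.\<close>

definition frechet_subdiff :: "('a::real_inner \<Rightarrow> ereal) \<Rightarrow> 'a \<Rightarrow> 'a set" where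
  "frechet_subdiff q x =
     {v. x \<in> dom_e q \<and>
         0 \<le> Liminf (at x) (\<lambda>y. (q y - q x - ereal (v \<bullet> (y - x))) / ereal (norm (y - x)))}"

definition limiting_subdiff :: "('a::real_inner \<Rightarrow> ereal) \<Rightarrow> 'a \<Rightarrow> 'a set" where
  "limiting_subdiff q x =
     {v. x \<in> dom_e q \<and>
         (\<exists>xs vs. xs \<longlonglongrightarrow> x \<and> (\<lambda>k. q (xs k)) \<longlonglongrightarrow> q x \<and>
            (\<forall>k. vs k \<in> frechet_subdiff q (xs k)) \<and> vs \<longlonglongrightarrow> v)}"

text \<open>The distance from the origin takes values in \<^typ>\<open>ennreal\<close> so that it is \<open>\<infinity>\<close> on the
  empty set, whereas \<^const>\<open>infdist\<close> would give \<open>0\<close> there.\<close>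

definition dist_zero :: "'a::real_normed_vector set \<Rightarrow> ennreal" where
  "dist_zero S = (INF v\<in>S. ennreal (norm v))"

section \<open>Generalized Moreau--Yosida regularization\<close>

definition moreau :: "real \<Rightarrow> ('a::real_normed_vector \<Rightarrow> ereal) \<Rightarrow> real \<Rightarrow> 'a \<Rightarrow> ereal" where
  "moreau p F r x =
     (INF y. F y + ereal (1 / r * (1 / p * norm (x - y) powr p + 1 / 2 * (norm (x - y))\<^sup>2)))"

section \<open>Stochastic one-sided model\<close>

text \<open>\<open>fm x y s\<close> stands for \<open>f\<^sub>x(y, s)\<close>; its values for \<open>x\<close> or \<open>y\<close> outside \<open>U\<close> play no role
  (\<open>\<phi>\<close> is \<open>\<infinity>\<close> off \<open>U\<close>, hence so is \<open>f\<^sub>x(\<cdot>, s) + \<phi>\<close>). Every finite expectation is accompanied by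
  integrability, because the Bochner integral of a non-integrable function is \<open>0\<close>.\<close>

definition stochastic_one_sided_model ::
    "'w measure \<Rightarrow> ('a::euclidean_space \<Rightarrow> ereal) \<Rightarrow> ('a \<Rightarrow> ereal) \<Rightarrow> 'a set \<Rightarrow>
     ('a \<Rightarrow> 'a \<Rightarrow> 'w \<Rightarrow> real) \<Rightarrow> real \<Rightarrow> real \<Rightarrow> real \<Rightarrow> real \<Rightarrow> real \<Rightarrow> real \<Rightarrow> bool" where
  "stochastic_one_sided_model \<pi> f \<phi> U fm p \<nu> \<tau> \<eta> L1 L2 \<longleftrightarrow>
     prob_space \<pi> \<and>
     1 < p \<and> p \<le> 2 \<and> 0 < \<nu> \<and> \<nu> \<le> 1 \<and> 0 < \<tau> \<and> 0 < \<eta> \<and> 0 < L1 \<and> 0 < L2 \<and>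
     open U \<and> dom_e \<phi> \<subseteq> U \<and> (\<forall>x\<in>U. \<bar>f x\<bar> \<noteq> \<infinity>) \<and>
     (\<lambda>(x, y, s). fm x y s)
        \<in> borel_measurable (restrict_space borel U \<Otimes>\<^sub>M (restrict_space borel U \<Otimes>\<^sub>M \<pi>)) \<and>
     (\<forall>x\<in>U. integrable \<pi> (fm x x) \<and> ereal (\<integral>s. fm x x s \<partial>\<pi>) = f x) \<and>
     (\<forall>x\<in>U. \<forall>y\<in>U. integrable \<pi> (fm x y) \<and>
        (\<integral>s. fm x y s - real_of_ereal (f y) \<partial>\<pi>) \<le> \<tau> / p * norm (x - y) powr p) \<and>
     (\<forall>x\<in>U. AE s in \<pi>. weakly_convex \<eta> (\<lambda>y. ereal (fm x y s) + \<phi> y)) \<and>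
     (\<exists>l1 l2. l1 \<in> borel_measurable \<pi> \<and> l2 \<in> borel_measurable \<pi> \<and>
        (\<forall>s\<in>space \<pi>. 0 \<le> l1 s \<and> 0 \<le> l2 s) \<and>
        integrable \<pi> (\<lambda>s. (l1 s)\<^sup>2) \<and> sqrt (\<integral>s. (l1 s)\<^sup>2 \<partial>\<pi>) \<le> L1 \<and>
        integrable \<pi> (\<lambda>s. l2 s powr (\<nu> + 1)) \<and>
        (\<integral>s. l2 s powr (\<nu> + 1) \<partial>\<pi>) powr (1 / (\<nu> + 1)) \<le> L2 \<and>
        (\<forall>x\<in>U. \<forall>y\<in>U. AE s in \<pi>.
           fm x x s - fm x y s \<le> l1 s * norm (x - y) + l2 s * norm (x - y) powr \<nu>))"

section \<open>Stochastic model-based method\<close>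

definition iid_draws :: "'m measure \<Rightarrow> 'w measure \<Rightarrow> (nat \<Rightarrow> 'm \<Rightarrow> 'w) \<Rightarrow> bool" where
  "iid_draws P \<pi> \<xi> \<longleftrightarrow>
     prob_space P \<and> prob_space.indep_vars P (\<lambda>_. \<pi>) \<xi> UNIV \<and> (\<forall>t. distr P \<pi> (\<xi> t) = \<pi>)"

text \<open>\<open>P\<close> is the sample space carrying the draws and the iterates. That the iterate \<open>x t\<close> is
  produced from the earlier draws \<open>\<xi> 0, \<dots>, \<xi> (t - 1)\<close> alone is expressed by the map \<open>X\<close>. The
  minimization is required almost surely, as the model is only controlled for almost every draw.\<close>

definition model_based_method ::
    "'m measure \<Rightarrow> 'w measure \<Rightarrow> (nat \<Rightarrow> 'm \<Rightarrow> 'w) \<Rightarrow> ('a::euclidean_space \<Rightarrow> ereal) \<Rightarrow>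
     ('a \<Rightarrow> 'a \<Rightarrow> 'w \<Rightarrow> real) \<Rightarrow> (nat \<Rightarrow> real) \<Rightarrow> 'a \<Rightarrow> nat \<Rightarrow> (nat \<Rightarrow> 'm \<Rightarrow> 'a) \<Rightarrow> bool" where
  "model_based_method P \<pi> \<xi> \<phi> fm \<beta> x0 T x \<longleftrightarrow>
     iid_draws P \<pi> \<xi> \<and> x0 \<in> dom_e \<phi> \<and> (\<forall>\<omega>\<in>space P. x 0 \<omega> = x0) \<and>
     (\<forall>t\<le>Suc T. x t \<in> borel_measurable P \<and>
        (\<exists>X\<in>borel_measurable (Pi\<^sub>M {..<t} (\<lambda>_. \<pi>)).
           AE \<omega> in P. x t \<omega> = X (\<lambda>i\<in>{..<t}. \<xi> i \<omega>))) \<and>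
     (\<forall>t\<le>T. AE \<omega> in P.
        is_arg_min
          (\<lambda>z. \<phi> z + ereal (fm (x t \<omega>) z (\<xi> t \<omega>)) + ereal (\<beta> t / 2 * (norm (z - x t \<omega>))\<^sup>2))
          (\<lambda>_. True) (x (Suc t) \<omega>))"

section \<open>Constants of the complexity bound\<close>

text \<open>The power \<open>b\<^bsup>e / (2 - p)\<^esup>\<close>, read as \<open>0\<close> when \<open>p = 2\<close>.\<close>

definition pow2p :: "real \<Rightarrow> real \<Rightarrow> real \<Rightarrow> real" where
  "pow2p p b e = (if p = 2 then 0 else b powr (e / (2 - p)))"

definition rho_tilde :: "real \<Rightarrow> real \<Rightarrow> real \<Rightarrow> real" where
  "rho_tilde p \<rho> \<tau> = (if p = 2 then 2 * \<rho> + \<tau> else \<rho>)"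

definition const_A :: "real \<Rightarrow> real \<Rightarrow> real" where
  "const_A \<rho> \<eta> = \<rho> - \<eta>"

definition const_B :: "real \<Rightarrow> real \<Rightarrow> real \<Rightarrow> real" where
  "const_B p \<rho> \<tau> = 2 * (\<rho> - \<tau>) / p"

definition const_C :: "real \<Rightarrow> real \<Rightarrow> real \<Rightarrow> real" where
  "const_C p \<rho> \<tau> =
     (if p = 2 then 0
      else (2 - p) / p * 3 powr (p / (2 - p)) * (\<rho> + \<tau>) powr (2 / (2 - p)))"

definition const_D :: "real \<Rightarrow> real" where
  "const_D p = (if p = 2 then 8 else 12)"

definition const_E :: "real \<Rightarrow> real \<Rightarrow> real" where
  "const_E p \<nu> =
     (2 - \<nu>) * 2 powr (2 / (2 - \<nu>)) * ((if p = 2 then 2 else 3) * \<nu>) powr (\<nu> / (2 - \<nu>))"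

definition const_G :: "real \<Rightarrow> real" where
  "const_G p = (if p = 2 then 0 else 1)"

definition calA :: "real \<Rightarrow> real \<Rightarrow> real \<Rightarrow> real \<Rightarrow> real" where
  "calA p \<rho> \<tau> \<eta> = min (const_A \<rho> \<eta>) (const_B p \<rho> \<tau>)"

definition calB :: "real \<Rightarrow> real \<Rightarrow> real \<Rightarrow> real \<Rightarrow> real \<Rightarrow> real" where
  "calB p \<nu> \<rho> \<tau> \<eta> =
     Max {const_G p * const_A \<rho> \<eta> * pow2p p (const_B p \<rho> \<tau>) p + const_C p \<rho> \<tau>,
          const_G p * pow2p p (const_B p \<rho> \<tau>) p + 2 / p * const_C p \<rho> \<tau> powr (p / 2),
          2 * const_D p,
          const_E p \<nu>,
          2 / p * const_E p \<nu> powr (p / 2)}"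

end

theory Submission
  imports Defs
begin

text \<open>The envelope \<open>M\<close> decreases in expectation along the iterates. Let \<open>z\<close> be a proximal
  point of the current iterate \<open>x\<close>. Strong convexity of the stochastic subproblem, tested at \<open>z\<close>,
  bounds the expected squared distance from \<open>z\<close> to the next iterate; the Lipschitz and Hoelder
  moduli of the model enter only through terms that Young's inequality absorbs into the proximal
  term. Evaluating \<open>M\<close> at the next iterate with \<open>z\<close> as competitor gives a decrease proportional to
  \<open>(\<parallel>x - z\<parallel>\<^bsup>p-1\<^esup> + \<parallel>x - z\<parallel>)\<^sup>2\<close>, and some limiting subgradient of \<open>M\<close> at \<open>x\<close> has norm at most
  \<open>\<rho> (\<parallel>x - z\<parallel>\<^bsup>p-1\<^esup> + \<parallel>x - z\<parallel>)\<close>. Neither \<open>z\<close> nor the distance to the subdifferential need depend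
  measurably on \<open>x\<close>: the subproblem is tested only at a countable set of points whose values of \<open>F\<close>
  are dense in the graph of \<open>F\<close>, and the distance is dominated by the measurable expected decrease.\<close>

section \<open>Scalar inequalities\<close>

text \<open>At a proximal point \<open>z\<close> at distance d from x, F z equals M x minus \<rho>/p
  d^p + \<rho>/2 d^2. Inserted into the growth estimate of the subproblem this leaves (\<beta> -
  \<eta>) d^2 - A d^2 - B d^p, which fixes A and B. Put b = \<beta> - \<open>rho_tilde\<close>.
  Young's inequality may spend b/2 times the squared step, in equal shares, and its remainders
  produce C, D and E. Each modulus is counted twice: once for the model, and once because the
  envelope sees \<open>f\<close> at the next iterate while the model is centred at x. The p-th
  moment is recovered from a squared distance by the concave power t^(p/2). Its tangent at d^2 turns
  the decrease A d^2 + B d^p into A d^p + B d^(2p-2); both together dominate the square of d^(p-1) +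
  d with coefficient min A B. The tangent argument breaks down if the decrease, divided by \<beta> -
  \<eta>, exceeds d^2. For p < 2 this makes d^(2-p) at most B/b, and the terms with G pay for it;
  for p = 2 the larger \<open>rho_tilde\<close> excludes it.\<close>

lemma powr_mult_le_affine:
  fixes x y \<theta> :: real
  assumes "0 \<le> x" "0 \<le> y" "0 \<le> \<theta>" "\<theta> \<le> 1"
  shows "x powr \<theta> * y powr (1 - \<theta>) \<le> \<theta> * x + (1 - \<theta>) * y"
\<comment> \<open>Because \<open>0 powr 0 = 0\<close>, the left side vanishes as soon as
  \<open>x\<close> or \<open>y\<close> is zero, whatever the exponents.\<close>
proof (cases "x = 0 \<or> y = 0")
  case False
  then show ?thesis
    using Youngs_inequality_0[of \<theta> "1 - \<theta>" x y] assms by simp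
qed (use assms in auto)

text \<open>For positive c the remainder is the maximum of c d^a - k d^2 over d: Young's inequality
  with its best constant for a prescribed share \<open>k\<close> of the quadratic.\<close>

lemma young_square:
  fixes c d k a :: real
  assumes "0 \<le> c" "0 \<le> d" "0 < k" "0 < a" "a < 2"
  shows "c * d powr a \<le> k * d\<^sup>2 + (2 - a) / 2 * c powr (2 / (2 - a)) * (a / (2 * k)) powr (a / (2 - a))"
proof (cases "c = 0 \<or> d = 0")
  case False
  with assms have c: "0 < c" and d: "0 < d" by auto
  \<comment> \<open>The arguments of the mean inequality are tuned so that the first one contributes
    exactly k d^2 and the geometric mean is c d^a.\<close>
  define x where "x = 2 * k * d\<^sup>2 / a"
  define y where "y = c powr (2 / (2 - a)) * (a / (2 * k)) powr (a / (2 - a))"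
  have "x powr (a/2) = (2 * k / a) powr (a/2) * d powr a"
  proof -
    have "x = (2 * k / a) * d powr 2" using d by (simp add: x_def)
    thus ?thesis using assms d by (simp only: powr_mult powr_powr) simp
  qed
  moreover have "y powr (1 - a/2) = c * (a / (2 * k)) powr (a/2)"
  proof -
    have "y powr (1 - a/2) = c powr (2 / (2 - a) * (1 - a/2)) * (a / (2 * k)) powr (a / (2 - a) * (1 - a/2))"
      using assms c unfolding y_def by (simp add: powr_mult powr_powr)
    moreover have "2 / (2 - a) * (1 - a/2) = 1" "a / (2 - a) * (1 - a/2) = a/2"
      using assms by (auto simp: field_simps)
    ultimately show ?thesis using c by (simp only: powr_one)
  qed
  ultimately have "x powr (a/2) * y powr (1 - a/2)
      = ((2 * k / a) powr (a/2) * (a / (2 * k)) powr (a/2)) * (c * d powr a)"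
    by (simp only: mult_ac)
  also have "(2 * k / a) powr (a/2) * (a / (2 * k)) powr (a/2) = 1"
    using assms by (simp flip: powr_mult)
  finally have "c * d powr a = x powr (a/2) * y powr (1 - a/2)" by simp
  also have "\<dots> \<le> a/2 * x + (1 - a/2) * y"
    by (rule powr_mult_le_affine) (use assms in \<open>auto simp: x_def y_def\<close>)
  also have "a/2 * x = k * d\<^sup>2" using assms by (simp add: x_def)
  also have "(1 - a/2) * y = (2 - a) / 2 * c powr (2 / (2 - a)) * (a / (2 * k)) powr (a / (2 - a))"
    by (simp add: y_def field_simps)
  finally show ?thesis .
qed (use assms in auto)

text \<open>Concavity in tangent form: the weighted mean inequality multiplied by y^(\<theta>-1). No
  derivative is taken, so \<open>x\<close> may be zero.\<close>

lemma powr_tangent: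
  fixes x y \<theta> :: real
  assumes "0 \<le> x" "0 < y" "0 \<le> \<theta>" "\<theta> \<le> 1"
  shows "x powr \<theta> \<le> y powr \<theta> + \<theta> * y powr (\<theta> - 1) * (x - y)"
proof -
  have "x powr \<theta> = (x powr \<theta> * y powr (1 - \<theta>)) * y powr (\<theta> - 1)"
    using assms by (simp add: mult.assoc flip: powr_add)
  also have "\<dots> \<le> (\<theta> * x + (1 - \<theta>) * y) * y powr (\<theta> - 1)"
    using powr_mult_le_affine[of x y \<theta>] assms by (intro mult_right_mono) auto
  also have "\<dots> = y * y powr (\<theta> - 1) + \<theta> * y powr (\<theta> - 1) * (x - y)"
    by (simp add: algebra_simps)
  also have "y * y powr (\<theta> - 1) = y powr \<theta>"
    using assms by (simp add: powr_mult_base)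
  finally show ?thesis .
qed

text \<open>The weighted mean inequality for x^p and y^p with weight 1/p places a convex power above
  its tangents.\<close>

lemma powr_tangent_ge:
  fixes x y p :: real
  assumes "0 \<le> x" "0 < y" "1 \<le> p"
  shows "y powr p + p * y powr (p - 1) * (x - y) \<le> x powr p"
proof -
  have "y powr p + p * y powr (p - 1) * (x - y) = p * x * y powr (p - 1) - (p - 1) * y powr p"
    using powr_mult_base[of y "p - 1"] assms by (simp add: algebra_simps)
  moreover have "x * y powr (p - 1) \<le> 1/p * x powr p + (1 - 1/p) * y powr p"
    using powr_mult_le_affine[of "x powr p" "y powr p" "1/p"] assms
    by (simp add: powr_powr algebra_simps)
  hence "p * x * y powr (p - 1) \<le> x powr p + (p - 1) * y powr p"
    using assms by (simp add: field_simps)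
  ultimately show ?thesis by simp
qed

text \<open>One factor a + b is split off the power; what remains has exponent \<theta> - 1 \<le> 0
  and grows when its base shrinks to \<open>a\<close> or to \<open>b\<close>.\<close>

lemma powr_add_subadditive:
  fixes a b \<theta> :: real
  assumes "0 \<le> a" "0 \<le> b" "0 \<le> \<theta>" "\<theta> \<le> 1"
  shows "(a + b) powr \<theta> \<le> a powr \<theta> + b powr \<theta>"
proof (cases "a = 0 \<or> b = 0")
  case False
  with assms have ab: "0 < a" "0 < b" by auto
  have "a * (a + b) powr (\<theta> - 1) \<le> a * a powr (\<theta> - 1)"
    using ab assms by (intro mult_left_mono powr_mono2') auto
  moreover have "b * (a + b) powr (\<theta> - 1) \<le> b * b powr (\<theta> - 1)"
    using ab assms by (intro mult_left_mono powr_mono2') auto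
  moreover have "(a + b) powr \<theta> = a * (a + b) powr (\<theta> - 1) + b * (a + b) powr (\<theta> - 1)"
    using powr_mult_base[of "a + b" "\<theta> - 1"] ab by (simp add: algebra_simps)
  ultimately show ?thesis
    using powr_mult_base[of a "\<theta> - 1"] powr_mult_base[of b "\<theta> - 1"] ab by simp
qed (use assms in auto)

text \<open>The tangent at the midpoint, evaluated at \<open>a\<close> and at \<open>b\<close>, has
  linear parts that cancel in the sum.\<close>

lemma powr_add_le_convex:
  fixes a b q :: real
  assumes "0 \<le> a" "0 \<le> b" "1 \<le> q"
  shows "(a + b) powr q \<le> 2 powr (q - 1) * (a powr q + b powr q)"
proof (cases "a + b = 0")
  case False
  with assms have m: "0 < (a + b) / 2" by simp
  have "2 * ((a + b) / 2) powr q \<le> a powr q + b powr q"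
  proof -
    define w where "w = (a + b) / 2"
    define K where "K = q * w powr (q - 1)"
    have "w powr q + K * (a - w) \<le> a powr q" "w powr q + K * (b - w) \<le> b powr q"
      using powr_tangent_ge[of a w q] powr_tangent_ge[of b w q] assms m by (auto simp: w_def K_def)
    moreover have "K * (a - w) + K * (b - w) = 0"
      unfolding distrib_left[symmetric] by (simp add: w_def)
    ultimately show ?thesis by (simp only: w_def)
  qed
  moreover have "((a + b) / 2) powr q = (a + b) powr q / 2 powr q"
    using m by (simp add: powr_divide)
  moreover have "2 powr q = 2 * 2 powr (q - 1)"
    using powr_mult_base[of 2 "q - 1"] by simp
  ultimately show ?thesis by (simp add: field_simps)
qed (use assms in auto)

text \<open>Jensen's inequality for a concave power, obtained by integrating the tangent at the
  mean. It passes from higher to lower moments, both for the moduli and for the distance to the next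
  iterate.\<close>

lemma (in prob_space) powr_moment_le:
  fixes u :: "'a \<Rightarrow> real"
  assumes u: "integrable M u" "AE s in M. 0 \<le> u s" "expectation u \<le> c" and \<theta>: "0 < \<theta>" "\<theta> \<le> 1"
  shows "integrable M (\<lambda>s. u s powr \<theta>)" "expectation (\<lambda>s. u s powr \<theta>) \<le> c powr \<theta>"
proof -
  have [measurable]: "u \<in> borel_measurable M" using u(1) by auto
  show int: "integrable M (\<lambda>s. u s powr \<theta>)"
  proof (rule Bochner_Integration.integrable_bound[where f = "\<lambda>s. \<theta> * u s + (1 - \<theta>)"])
    show "AE s in M. norm (u s powr \<theta>) \<le> norm (\<theta> * u s + (1 - \<theta>))"
      using u(2)
    proof eventually_elim
      case (elim s)
      then show ?case using powr_mult_le_affine[of "u s" 1 \<theta>] \<theta> by simp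
    qed
  qed (use u in auto)
  have c0: "0 \<le> expectation u" using u(2) by (rule integral_nonneg_AE)
  show "expectation (\<lambda>s. u s powr \<theta>) \<le> c powr \<theta>"
  \<comment> \<open>The tangent needs a positive base point; a nonnegative function with mean zero
    vanishes almost everywhere.\<close>
  proof (cases "expectation u = 0")
    case True
    hence "AE s in M. u s = 0" using u integral_nonneg_eq_0_iff_AE by blast
    hence "expectation (\<lambda>s. u s powr \<theta>) = expectation (\<lambda>s. 0)"
      by (intro integral_cong_AE) auto
    then show ?thesis by simp
  next
    case False
    define e where "e = expectation u"
    have e: "0 < e" using False c0 by (simp add: e_def)
    have "expectation (\<lambda>s. u s powr \<theta>)
        \<le> expectation (\<lambda>s. e powr \<theta> + \<theta> * e powr (\<theta> - 1) * (u s - e))"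
    proof (rule integral_mono_AE)
      show "AE s in M. u s powr \<theta> \<le> e powr \<theta> + \<theta> * e powr (\<theta> - 1) * (u s - e)"
        using u(2)
      proof eventually_elim
        case (elim s)
        then show ?case using powr_tangent[of "u s" e \<theta>] \<theta> e by simp
      qed
    qed (use int u in auto)
    also have "\<dots> = e powr \<theta>" using u(1) by (simp add: e_def prob_space)
    also have "\<dots> \<le> c powr \<theta>" using u(3) \<theta> e by (intro powr_mono2) (auto simp: e_def)
    finally show ?thesis .
  qed
qed

section \<open>Lower semicontinuous functions\<close>

text \<open>The bound at the point itself is trivial, so the punctured filter can be replaced by
  \<open>nhds\<close>. In this form the condition composes with every convergent sequence, also one
  that hits its limit.\<close>

lemma lower_semicontinuous_iff:
  fixes q :: "'a::metric_space \<Rightarrow> ereal"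
  shows "lower_semicontinuous q \<longleftrightarrow> (\<forall>x c. ereal c < q x \<longrightarrow> (\<forall>\<^sub>F y in nhds x. ereal c < q y))"
    (is "_ = ?R")
proof
  assume q: "lower_semicontinuous q"
  show ?R
  proof (intro allI impI)
    fix x c assume c: "ereal c < q x"
    have "q x \<le> Liminf (at x) q" using q by (simp add: lower_semicontinuous_def)
    hence "\<forall>\<^sub>F y in at x. ereal c < q y" using c by (simp add: le_Liminf_iff)
    thus "\<forall>\<^sub>F y in nhds x. ereal c < q y"
      unfolding eventually_at_filter by (rule eventually_mono) (use c in auto)
  qed
next
  assume R: ?R
  show "lower_semicontinuous q"
    unfolding lower_semicontinuous_def le_Liminf_iff
  proof (intro allI impI)
    fix x y assume "y < q x"
    then obtain c where c: "y < ereal c" "ereal c < q x" using ereal_dense2 by blast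
    have "\<forall>\<^sub>F z in nhds x. ereal c < q z" using R c(2) by blast
    hence "\<forall>\<^sub>F z in at x. ereal c < q z" unfolding eventually_at_filter by (rule eventually_mono) simp
    thus "\<forall>\<^sub>F z in at x. y < q z" by (rule eventually_mono) (use c in auto)
  qed
qed

lemma lower_semicontinuousD:
  fixes q :: "'a::metric_space \<Rightarrow> ereal"
  assumes "lower_semicontinuous q" "ereal c < q x"
  shows "\<forall>\<^sub>F y in nhds x. ereal c < q y"
  using assms by (simp add: lower_semicontinuous_iff)

lemma lower_semicontinuous_seq_le:
  fixes q :: "'a::metric_space \<Rightarrow> ereal"
  assumes q: "lower_semicontinuous q" and X: "X \<longlonglongrightarrow> x"
    and le: "\<And>n. q (X n) \<le> c n" and c: "c \<longlonglongrightarrow> C"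
  shows "q x \<le> C"
proof (rule ccontr)
  assume "\<not> q x \<le> C"
  then obtain e where e: "C < ereal e" "ereal e < q x" by (meson ereal_dense2 not_le)
  have "\<forall>\<^sub>F n in sequentially. ereal e < q (X n)"
    using lower_semicontinuousD[OF q e(2)] X by (rule eventually_compose_filterlim)
  moreover have "\<forall>\<^sub>F n in sequentially. c n < ereal e" using c e(1) by (rule order_tendstoD)
  ultimately have "\<forall>\<^sub>F n in sequentially. False"
  proof eventually_elim
    case (elim n)
    thus False using le[of n] by (meson leD less_trans)
  qed
  thus False by simp
qed

text \<open>Compactness is asked only of a set containing the sublevel set of one competitor
  \<open>w\<close>: a limit of a minimizing sequence in \<open>K\<close> beats \<open>w\<close>, and
  \<open>w\<close> beats everything outside \<open>K\<close>.\<close>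

lemma lower_semicontinuous_attains_Inf:
  fixes q :: "'a::metric_space \<Rightarrow> ereal"
  assumes q: "lower_semicontinuous q" and K: "compact K"
    and sub: "\<And>y. q y \<le> q w \<Longrightarrow> y \<in> K"
  shows "\<exists>x. \<forall>y. q x \<le> q y"
proof -
  have wK: "w \<in> K" using sub by auto
  hence "q ` K \<noteq> {}" by auto
  from Inf_as_limit[OF this]
  obtain u where u: "\<forall>n. u n \<in> q ` K" "u \<longlonglongrightarrow> Inf (q ` K)" by blast
  from u(1) have "\<forall>n. \<exists>y. y \<in> K \<and> u n = q y" by blast
  then obtain X where X: "\<And>n. X n \<in> K" "\<And>n. u n = q (X n)" by metis
  obtain x r where x: "x \<in> K" "strict_mono r" "(X \<circ> r) \<longlonglongrightarrow> x"
    using K X(1) unfolding compact_def by meson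
  have "(\<lambda>n. q (X (r n))) \<longlonglongrightarrow> Inf (q ` K)"
    using LIMSEQ_subseq_LIMSEQ[OF u(2) x(2)] by (simp add: o_def X(2))
  hence le: "q x \<le> Inf (q ` K)"
    using lower_semicontinuous_seq_le[OF q x(3), of "\<lambda>n. q (X (r n))"] by (auto simp: o_def)
  have "q x \<le> q y" for y
  proof (cases "y \<in> K")
    case True
    then show ?thesis using le by (meson INF_lower order_trans)
  next
    case False
    hence "q w \<le> q y" using sub by (meson linear)
    moreover have "q x \<le> q w" using le wK by (meson INF_lower order_trans)
    ultimately show ?thesis by simp
  qed
  thus ?thesis by blast
qed

lemma lower_semicontinuous_add:
  fixes f g :: "'a::metric_space \<Rightarrow> ereal"
  assumes f: "lower_semicontinuous f" and g: "lower_semicontinuous g"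
    and fin: "\<And>x. f x \<noteq> -\<infinity>" "\<And>x. g x \<noteq> -\<infinity>"
  shows "lower_semicontinuous (\<lambda>x. f x + g x)"
  unfolding lower_semicontinuous_iff
proof (intro allI impI)
  fix x c assume c: "ereal c < f x + g x"
  have "\<exists>a b. ereal a < f x \<and> ereal b < g x \<and> c = a + b"
  proof (cases "f x"; cases "g x")
    fix a b assume ab: "f x = ereal a" "g x = ereal b"
    \<comment> \<open>Each summand gives up half of the excess a + b - c.\<close>
    show ?thesis
      by (rule exI[of _ "a - (a + b - c) / 2"], rule exI[of _ "b - (a + b - c) / 2"])
         (use c ab in auto)
  next
    fix a assume "f x = ereal a" "g x = \<infinity>"
    thus ?thesis by (intro exI[of _ "a - 1"] exI[of _ "c - (a - 1)"]) auto
  next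
    fix b assume "f x = \<infinity>" "g x = ereal b"
    thus ?thesis by (intro exI[of _ "c - (b - 1)"] exI[of _ "b - 1"]) auto
  next
    assume "f x = \<infinity>" "g x = \<infinity>"
    thus ?thesis by (intro exI[of _ c] exI[of _ 0]) auto
  qed (use fin in auto)
  then obtain a b where ab: "ereal a < f x" "ereal b < g x" "c = a + b" by blast
  show "\<forall>\<^sub>F y in nhds x. ereal c < f y + g y"
    using lower_semicontinuousD[OF f ab(1)] lower_semicontinuousD[OF g ab(2)]
      proof eventually_elim
    case (elim y)
    thus ?case using ereal_add_strict_mono2[of "ereal a" "f y" "ereal b" "g y"] ab(3) by simp
  qed
qed

lemma lower_semicontinuous_compose:
  fixes q :: "'a::metric_space \<Rightarrow> ereal" and h :: "'b::metric_space \<Rightarrow> 'a"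
  assumes q: "lower_semicontinuous q" and h: "continuous_on UNIV h"
  shows "lower_semicontinuous (\<lambda>x. q (h x))"
  unfolding lower_semicontinuous_iff
proof (intro allI impI)
  fix x c assume "ereal c < q (h x)"
  from lower_semicontinuousD[OF q this] show "\<forall>\<^sub>F y in nhds x. ereal c < q (h y)"
    by (rule eventually_compose_filterlim)
       (use h in \<open>simp add: continuous_on_eq_continuous_at isCont_def flip: tendsto_at_iff_tendsto_nhds\<close>)
qed

lemma lower_semicontinuous_continuous:
  fixes h :: "'a::metric_space \<Rightarrow> real"
  assumes h: "continuous_on UNIV h"
  shows "lower_semicontinuous (\<lambda>x. ereal (h x))"
proof -
  have "(h \<longlongrightarrow> h x) (nhds x)" for x
    using h by (simp add: continuous_on_eq_continuous_at isCont_def flip: tendsto_at_iff_tendsto_nhds)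
  hence "\<forall>\<^sub>F y in nhds x. c < h y" if "c < h x" for x c
    using that by (rule order_tendstoD)
  thus ?thesis
    unfolding lower_semicontinuous_iff less_ereal.simps by blast
qed

lemma lower_semicontinuous_borel_measurable:
  fixes q :: "'a::metric_space \<Rightarrow> ereal"
  assumes q: "lower_semicontinuous q"
  shows "q \<in> borel_measurable borel"
proof (rule borel_measurableI_greater)
  fix c
  have "open {x. c < q x}"
  proof (subst open_subopen, safe)
    fix x assume "c < q x"
    then obtain e where e: "c < ereal e" "ereal e < q x" using ereal_dense2 by blast
    then obtain S where "open S" "x \<in> S" "\<forall>y\<in>S. ereal e < q y"
      using lower_semicontinuousD[OF q e(2)] by (auto simp: eventually_nhds)
    thus "\<exists>T. open T \<and> x \<in> T \<and> T \<subseteq> {x. c < q x}" using e(1) by (intro exI[of _ S]) (auto intro: less_trans)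
  qed
  thus "{x \<in> space borel. c < q x} \<in> sets borel" by simp
qed

section \<open>The generalized Moreau envelope\<close>

definition prox_kernel :: "real \<Rightarrow> real \<Rightarrow> real \<Rightarrow> real" where
  "prox_kernel p \<rho> t = \<rho> / p * t powr p + \<rho> / 2 * t\<^sup>2"

text \<open>The derivative of \<open>prox_kernel\<close> on the positive axis.\<close>

definition prox_kernel' :: "real \<Rightarrow> real \<Rightarrow> real \<Rightarrow> real" where
  "prox_kernel' p \<rho> t = \<rho> * (t powr (p - 1) + t)"

lemma prox_kernel_mono:
  assumes "0 \<le> s" "s \<le> t" "0 < \<rho>" "0 < p"
  shows "prox_kernel p \<rho> s \<le> prox_kernel p \<rho> t"
  unfolding prox_kernel_def
  using assms by (intro add_mono mult_left_mono powr_mono2 power_mono) auto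

lemma prox_kernel_nonneg: "0 < \<rho> \<Longrightarrow> 0 < p \<Longrightarrow> 0 \<le> prox_kernel p \<rho> t"
  by (simp add: prox_kernel_def)

lemma continuous_on_prox_kernel [continuous_intros]:
  fixes g :: "'a::topological_space \<Rightarrow> real"
  assumes "continuous_on S g" "1 < p" "\<And>x. x \<in> S \<Longrightarrow> 0 \<le> g x"
  shows "continuous_on S (\<lambda>x. prox_kernel p \<rho> (g x))"
  unfolding prox_kernel_def using assms by (intro continuous_intros continuous_on_powr') auto

lemma tendsto_prox_kernel:
  assumes "(g \<longlongrightarrow> l) net" "1 < p" "\<And>x. 0 \<le> g x"
  shows "((\<lambda>x. prox_kernel p \<rho> (g x)) \<longlongrightarrow> prox_kernel p \<rho> l) net"
  unfolding prox_kernel_def using assms by (intro tendsto_intros tendsto_powr') auto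

lemma tendsto_prox_kernel':
  assumes "(g \<longlongrightarrow> l) net" "1 < p" "\<And>x. 0 \<le> g x"
  shows "((\<lambda>x. prox_kernel' p \<rho> (g x)) \<longlongrightarrow> prox_kernel' p \<rho> l) net"
  unfolding prox_kernel'_def using assms by (intro tendsto_intros tendsto_powr') auto

text \<open>By convexity the increment is at most \<open>e\<close> times the slope at the right end
  t + e, a positive point even for t = 0.\<close>

lemma prox_kernel_diff_le:
  assumes "0 \<le> t" "0 < e" "1 < p" "0 < \<rho>"
  shows "prox_kernel p \<rho> (t + e) - prox_kernel p \<rho> t \<le> e * prox_kernel' p \<rho> (t + e)"
proof -
  have "(t + e) powr p - p * (t + e) powr (p - 1) * e \<le> t powr p"
    using powr_tangent_ge[of t "t + e" p] assms by simp
  hence "\<rho> / p * ((t + e) powr p - t powr p) \<le> \<rho> / p * (p * (t + e) powr (p - 1) * e)"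
    using assms by (intro mult_left_mono) auto
  also have "\<dots> = e * \<rho> * (t + e) powr (p - 1)" using assms by simp
  finally have 1: "\<rho> / p * (t + e) powr p - \<rho> / p * t powr p \<le> e * \<rho> * (t + e) powr (p - 1)"
    by (simp only: right_diff_distrib)
  have "\<rho> / 2 * (t + e)\<^sup>2 - \<rho> / 2 * t\<^sup>2 = e * \<rho> * (t + e) - \<rho> / 2 * e\<^sup>2"
    by (simp add: power2_eq_square algebra_simps)
  also have "\<dots> \<le> e * \<rho> * (t + e)" using assms by simp
  finally show ?thesis using 1 unfolding prox_kernel_def prox_kernel'_def distrib_left mult.assoc[symmetric] by linarith
qed

locale envelope =
  fixes F :: "'a::euclidean_space \<Rightarrow> ereal" and m p \<rho> :: real
  assumes lsc: "lower_semicontinuous F" and ge: "\<And>y. ereal m \<le> F y"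
    and dom: "dom_e F \<noteq> {}" and p: "1 < p" and \<rho>: "0 < \<rho>"
begin

abbreviation "env \<equiv> moreau p F (1 / \<rho>)"

lemma env_def: "env x = (INF y. F y + ereal (prox_kernel p \<rho> (norm (x - y))))"
proof -
  have "1 / (1 / \<rho>) * (1 / p * t powr p + 1 / 2 * t\<^sup>2) = prox_kernel p \<rho> t" for t
    by (simp add: prox_kernel_def algebra_simps)
  thus ?thesis by (simp add: moreau_def)
qed

lemma env_le: "env x \<le> F y + ereal (prox_kernel p \<rho> (norm (x - y)))"
  unfolding env_def by (rule INF_lower) simp

lemma env_ge: "ereal m \<le> env x"
  unfolding env_def
proof (rule INF_greatest)
  fix y
  have "ereal m + 0 \<le> F y + ereal (prox_kernel p \<rho> (norm (x - y)))"
    using prox_kernel_nonneg[of \<rho> p] \<rho> p by (intro add_mono ge) simp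
  thus "ereal m \<le> F y + ereal (prox_kernel p \<rho> (norm (x - y)))" by simp
qed

definition "envr x = real_of_ereal (env x)"

lemma F_real: "F y < \<infinity> \<Longrightarrow> F y = ereal (real_of_ereal (F y))"
  using ge[of y] by (cases "F y") auto

lemma env_real: "env x = ereal (envr x)"
proof -
  obtain y where "F y < \<infinity>" using dom by (auto simp: dom_e_def)
  hence "env x < \<infinity>" using env_le[of x y] ge[of y] by (cases "F y") auto
  thus ?thesis using env_ge[of x] unfolding envr_def by (cases "env x") auto
qed

lemma envr_ge: "m \<le> envr x"
  using env_ge[of x] by (simp add: env_real)

lemma envr_le: "F y = ereal b \<Longrightarrow> envr x \<le> b + prox_kernel p \<rho> (norm (x - y))"
  using env_le[of x y] by (simp add: env_real)

text \<open>The envelope is an infimum of functions of x that are continuous or identically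
  infinite. Its strict sublevel sets are therefore open, although the infimum runs over uncountably
  many \<open>y\<close>.\<close>

lemma envr_measurable [measurable]: "envr \<in> borel_measurable borel"
proof -
  have "open {x. env x < c}" for c
  proof -
    have "{x. env x < c} = (\<Union>y. {x. F y + ereal (prox_kernel p \<rho> (norm (x - y))) < c})"
      unfolding env_def by (auto simp: INF_less_iff)
    moreover have "open {x. F y + ereal (prox_kernel p \<rho> (norm (x - y))) < c}" for y
    proof (cases "F y")
      case (real b)
      have "continuous_on UNIV (\<lambda>x. ereal (b + prox_kernel p \<rho> (norm (x - y))))"
        using p by (intro continuous_intros) auto
      hence "open {x. ereal (b + prox_kernel p \<rho> (norm (x - y))) < c}"
        by (intro open_Collect_less continuous_on_const)
      thus ?thesis using real by simp
    qed (use ge[of y] in auto)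
    ultimately show ?thesis by auto
  qed
  hence "env \<in> borel_measurable borel" by (intro borel_measurableI_less) auto
  thus ?thesis unfolding envr_def by measurable
qed

text \<open>A joint minimizer has two roles: \<open>y\<close> is a proximal point of
  \<open>z\<close>, and \<open>z\<close> minimizes the envelope plus a quadratic. The last bound is
  stationarity in \<open>z\<close> with \<open>y\<close> held fixed, where the smooth kernel stands
  in for the envelope.\<close>

lemma joint_minimizer:
  assumes k: "1 \<le> k"
  shows "\<exists>z y. F y + ereal (prox_kernel p \<rho> (norm (z - y))) = env z \<and>
    norm (z - x) \<le> sqrt (2 * (envr x - m) / k) \<and> norm (z - y) \<le> sqrt (2 * (envr x - m) / \<rho>) \<and>
    env z \<le> env x \<and>
    (\<forall>z'. envr z + k/2 * (norm (z - x))\<^sup>2 \<le> envr z' + k/2 * (norm (z' - x))\<^sup>2) \<and>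
    k * norm (z - x) \<le> prox_kernel' p \<rho> (norm (z - y))"
proof -
  define g where "g w = prox_kernel p \<rho> (norm (fst w - snd w)) + k/2 * (norm (fst w - x))\<^sup>2" for w :: "'a \<times> 'a"
  define G where "G w = F (snd w) + ereal (g w)" for w :: "'a \<times> 'a"
  have g0: "0 \<le> g w" for w
    unfolding g_def using prox_kernel_nonneg[of \<rho> p "norm (fst w - snd w)"] \<rho> p k by simp
  have "lower_semicontinuous G"
    unfolding G_def
  proof (rule lower_semicontinuous_add[of "\<lambda>w. F (snd w)" "\<lambda>w. ereal (g w)"])
    show "lower_semicontinuous (\<lambda>w::'a \<times> 'a. F (snd w))"
      by (rule lower_semicontinuous_compose[OF lsc]) (intro continuous_intros)
    show "lower_semicontinuous (\<lambda>w. ereal (g w))"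
      unfolding g_def using p by (intro lower_semicontinuous_continuous continuous_intros) auto
    show "F (snd w) \<noteq> -\<infinity>" for w :: "'a \<times> 'a" using ge[of "snd w"] by auto
  qed simp
  obtain y0 where "F y0 < \<infinity>" using dom by (auto simp: dom_e_def)
  then obtain b where b: "F y0 = ereal b" using F_real by blast
  \<comment> \<open>Since \<open>F\<close> stays above \<open>m\<close>, a value at most
    \<open>c\<close> leaves only c - m for the two quadratic parts. This coercivity gives existence
    now and, with c = \<open>envr x\<close>, the stated distance bounds later.\<close>
  have norm_le: "norm (fst w - x) \<le> sqrt (2 * (c - m) / k) \<and> norm (fst w - snd w) \<le> sqrt (2 * (c - m) / \<rho>)"
    if "G w \<le> ereal c" for w c
  proof -
    have "ereal m + ereal (g w) \<le> G w" unfolding G_def by (intro add_mono ge) simp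
    also note that
    finally have "m + g w \<le> c" by simp
    moreover have "\<rho> / 2 * (norm (fst w - snd w))\<^sup>2 \<le> prox_kernel p \<rho> (norm (fst w - snd w))"
      using \<rho> p by (simp add: prox_kernel_def)
    moreover have "0 \<le> prox_kernel p \<rho> (norm (fst w - snd w))" using prox_kernel_nonneg \<rho> p by simp
    moreover have "0 \<le> k/2 * (norm (fst w - x))\<^sup>2" "0 \<le> \<rho> / 2 * (norm (fst w - snd w))\<^sup>2" using k \<rho> by auto
    ultimately have "k/2 * (norm (fst w - x))\<^sup>2 \<le> c - m" "\<rho> / 2 * (norm (fst w - snd w))\<^sup>2 \<le> c - m"
      by (auto simp: g_def)
    hence "(norm (fst w - x))\<^sup>2 \<le> 2 * (c - m) / k" "(norm (fst w - snd w))\<^sup>2 \<le> 2 * (c - m) / \<rho>"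
      using k \<rho> by (auto simp: field_simps)
    thus ?thesis by (auto intro: real_le_rsqrt)
  qed
  define c0 where "c0 = b + g (x, y0)"
  have "\<exists>w. \<forall>w'. G w \<le> G w'"
  proof (rule lower_semicontinuous_attains_Inf[of G
        "cball x (sqrt (2 * (c0 - m) / k)) \<times> cball x (sqrt (2 * (c0 - m) / k) + sqrt (2 * (c0 - m) / \<rho>))" "(x, y0)"])
    fix w assume "G w \<le> G (x, y0)"
    also have "G (x, y0) = ereal c0" by (simp add: G_def b c0_def)
    finally have n: "norm (fst w - x) \<le> sqrt (2 * (c0 - m) / k)" "norm (fst w - snd w) \<le> sqrt (2 * (c0 - m) / \<rho>)"
      using norm_le by auto
    have "norm (snd w - x) \<le> norm (fst w - x) + norm (fst w - snd w)"
      using norm_triangle_ineq4[of "fst w - x" "fst w - snd w"] by simp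
    thus "w \<in> cball x (sqrt (2 * (c0 - m) / k)) \<times> cball x (sqrt (2 * (c0 - m) / k) + sqrt (2 * (c0 - m) / \<rho>))"
      using n by (cases w) (auto simp: dist_norm norm_minus_commute)
  qed (use \<open>lower_semicontinuous G\<close> in \<open>auto intro!: compact_Times\<close>)
  then obtain z y where zy: "\<And>z' y'. G (z, y) \<le> G (z', y')" by fastforce
  have "G (z, y) \<le> ereal c0" using zy[of x y0] by (simp add: G_def b c0_def)
  hence "F y < \<infinity>" by (cases "F y") (auto simp: G_def)
  then obtain a where a: "F y = ereal a" using F_real by blast
  \<comment> \<open>Taking the infimum over the second variable of the competitor turns joint
    optimality into optimality of \<open>z\<close> for the envelope.\<close>
  have GE: "a + g (z, y) \<le> envr z' + k/2 * (norm (z' - x))\<^sup>2" for z'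
  proof -
    have "ereal (a + g (z, y) - k/2 * (norm (z' - x))\<^sup>2) \<le> env z'"
      unfolding env_def
    proof (rule INF_greatest)
      fix y'
      show "ereal (a + g (z, y) - k/2 * (norm (z' - x))\<^sup>2) \<le> F y' + ereal (prox_kernel p \<rho> (norm (z' - y')))"
        using zy[of z' y'] ge[of y'] by (cases "F y'") (auto simp: G_def a g_def)
    qed
    thus ?thesis by (simp add: env_real)
  qed
  have eq: "envr z = a + prox_kernel p \<rho> (norm (z - y))"
    using GE[of z] envr_le[OF a, of z] by (simp add: g_def)
  have "a + g (z, y) \<le> envr x" using GE[of x] by simp
  hence "G (z, y) \<le> ereal (envr x)" by (simp add: G_def a)
  hence n: "norm (z - x) \<le> sqrt (2 * (envr x - m) / k)" "norm (z - y) \<le> sqrt (2 * (envr x - m) / \<rho>)"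
    using norm_le[of "(z, y)"] by auto
  have opt: "envr z + k/2 * (norm (z - x))\<^sup>2 \<le> envr z' + k/2 * (norm (z' - x))\<^sup>2" for z'
    using GE[of z'] eq by (simp add: g_def)
  have "env z \<le> env x"
  proof -
    have "0 \<le> k/2 * (norm (z - x))\<^sup>2" using k by simp
    thus ?thesis using opt[of x] by (simp add: env_real)
  qed
  moreover have "k * norm (z - x) \<le> prox_kernel' p \<rho> (norm (z - y))"
  proof (cases "z = x")
    case True
    then show ?thesis using \<rho> by (simp add: prox_kernel'_def)
  next
    case False
    define t where "t = norm (z - x)"
    define D where "D = norm (z - y)"
    have t: "0 < t" using False by (simp add: t_def)
    \<comment> \<open>Moving \<open>z\<close> by a fraction \<open>s\<close> towards
      \<open>x\<close> lowers the quadratic at first order by k s t^2, while the kernel grows by at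
      most s t times its slope. Dividing by s t and letting \<open>s\<close> tend to zero gives
      stationarity.\<close>
    have *: "k * t * (1 - s/2) \<le> prox_kernel' p \<rho> (D + s * t)" if s: "0 < s" "s \<le> 1" for s
    proof -
      define z' where "z' = z - s *\<^sub>R (z - x)"
      have "z' - x = (1 - s) *\<^sub>R (z - x)" by (simp add: z'_def algebra_simps)
      hence n1: "norm (z' - x) = (1 - s) * t" using s by (simp add: t_def)
      have e: "z' - y = (z - y) - s *\<^sub>R (z - x)" by (simp add: z'_def)
      have "norm (z' - y) \<le> D + s * t"
        unfolding e using norm_triangle_ineq4[of "z - y" "s *\<^sub>R (z - x)"] s by (simp add: D_def t_def)
      hence k1: "prox_kernel p \<rho> (norm (z' - y)) \<le> prox_kernel p \<rho> (D + s * t)"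
        using \<rho> p by (intro prox_kernel_mono) auto
      have "prox_kernel p \<rho> (D + s * t) - prox_kernel p \<rho> D \<le> (s * t) * prox_kernel' p \<rho> (D + s * t)"
        using s t p \<rho> by (intro prox_kernel_diff_le) (auto simp: D_def)
      moreover have "a + prox_kernel p \<rho> D + k/2 * t\<^sup>2 \<le> a + prox_kernel p \<rho> (norm (z' - y)) + k/2 * ((1 - s) * t)\<^sup>2"
        using opt[of z'] envr_le[OF a, of z'] eq n1 by (simp add: D_def t_def)
      ultimately have "k/2 * t\<^sup>2 - k/2 * ((1 - s) * t)\<^sup>2 \<le> (s * t) * prox_kernel' p \<rho> (D + s * t)"
        using k1 by linarith
      moreover have "k/2 * t\<^sup>2 - k/2 * ((1 - s) * t)\<^sup>2 = (s * t) * (k * t * (1 - s/2))"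
        by (simp add: power2_eq_square algebra_simps)
      ultimately show ?thesis using s t by (simp add: mult_le_cancel_left_pos)
    qed
    have lim: "(\<lambda>n. 1 / real (Suc n)) \<longlonglongrightarrow> 0"
      using LIMSEQ_inverse_real_of_nat by (simp add: inverse_eq_divide)
    have "(\<lambda>n. k * t * (1 - 1 / real (Suc n) / 2)) \<longlonglongrightarrow> k * t * (1 - 0/2)"
      by (intro tendsto_intros lim) auto
    moreover have "(\<lambda>n. prox_kernel' p \<rho> (D + 1 / real (Suc n) * t)) \<longlonglongrightarrow> prox_kernel' p \<rho> (D + 0 * t)"
      using p t by (intro tendsto_prox_kernel' tendsto_intros lim) (auto simp: D_def)
    ultimately have "k * t * (1 - 0/2) \<le> prox_kernel' p \<rho> (D + 0 * t)"
      by (rule LIMSEQ_le) (use *[of "1 / real (Suc _)"] in auto)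
    thus ?thesis by (simp add: t_def D_def)
  qed
  ultimately show ?thesis
    using n opt eq a by (intro exI[of _ z] exI[of _ y]) (simp add: env_real)
qed

text \<open>At the minimizer the negative gradient of the quadratic, k (x - z), supports the
  envelope up to k/2 times the squared distance to \<open>z\<close>, which is of lower order than
  the distance.\<close>

lemma frechet_subgradient:
  assumes opt: "\<And>z'. envr z + k/2 * (norm (z - x))\<^sup>2 \<le> envr z' + k/2 * (norm (z' - x))\<^sup>2" and k: "0 \<le> k"
  shows "k *\<^sub>R (x - z) \<in> frechet_subdiff env z"
proof -
  have "0 \<le> Liminf (at z) (\<lambda>y. (env y - env z - ereal (k *\<^sub>R (x - z) \<bullet> (y - z))) / ereal (norm (y - z)))"
  proof -
    have le: "ereal (- (k/2) * norm (y - z)) \<le> (env y - env z - ereal (k *\<^sub>R (x - z) \<bullet> (y - z))) / ereal (norm (y - z))"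
      if "y \<noteq> z" for y
    proof -
      have "(norm (y - x))\<^sup>2 = (norm (z - x))\<^sup>2 + (norm (y - z))\<^sup>2 - 2 * ((x - z) \<bullet> (y - z))"
        using dot_norm_neg[of "y - z" "x - z"] by (simp add: inner_commute norm_minus_commute)
      hence eq: "k/2 * (norm (y - x))\<^sup>2 = k/2 * (norm (z - x))\<^sup>2 + k/2 * (norm (y - z))\<^sup>2 - k * ((x - z) \<bullet> (y - z))"
        by (simp only:) (simp add: algebra_simps)
      have "- (k/2) * norm (y - z) * norm (y - z) \<le> envr y - envr z - k * ((x - z) \<bullet> (y - z))"
      proof -
        have "- (k/2) * norm (y - z) * norm (y - z) = - (k/2 * (norm (y - z))\<^sup>2)"
          by (simp add: power2_eq_square)
        thus ?thesis using opt[of y] eq by linarith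
      qed
      hence "- (k/2) * norm (y - z) \<le> (envr y - envr z - k * ((x - z) \<bullet> (y - z))) / norm (y - z)"
        using that by (subst pos_le_divide_eq) auto
      thus ?thesis using that by (simp add: env_real)
    qed
    have "((\<lambda>y. ereal (- (k/2) * norm (y - z))) \<longlongrightarrow> ereal (- (k/2) * norm (z - z))) (at z)"
      by (intro tendsto_intros)
    hence "0 = Liminf (at z) (\<lambda>y. ereal (- (k/2) * norm (y - z)))"
      by (subst lim_imp_Liminf) (auto simp: zero_ereal_def)
    also have "\<dots> \<le> Liminf (at z) (\<lambda>y. (env y - env z - ereal (k *\<^sub>R (x - z) \<bullet> (y - z))) / ereal (norm (y - z)))"
      by (rule Liminf_mono) (unfold eventually_at_filter, intro always_eventually allI impI le)
    finally show ?thesis .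
  qed
  moreover have "z \<in> dom_e env" by (simp add: dom_e_def env_real)
  ultimately show ?thesis unfolding frechet_subdiff_def by blast
qed

text \<open>The envelope need not be subdifferentiable at \<open>x\<close> itself. Minimizing
  \<open>F y + prox_kernel \<parallel>z - y\<parallel> + k/2 \<parallel>z - x\<parallel>\<^sup>2\<close> jointly over \<open>z\<close> and \<open>y\<close> gives Frechet subgradients
  at points \<open>z\<close> near \<open>x\<close>, and these converge along a subsequence as \<open>k\<close> grows.\<close>

lemma limiting_subgradient:
  "\<exists>y v. F y + ereal (prox_kernel p \<rho> (norm (x - y))) = env x \<and> v \<in> limiting_subdiff env x \<and>
     norm v \<le> prox_kernel' p \<rho> (norm (x - y))"
proof -
  define R1 where "R1 = sqrt (2 * (envr x - m))"
  define R2 where "R2 = sqrt (2 * (envr x - m) / \<rho>)"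
  have "\<forall>n. \<exists>z y. F y + ereal (prox_kernel p \<rho> (norm (z - y))) = env z \<and>
    norm (z - x) \<le> sqrt (2 * (envr x - m) / real (Suc n)) \<and> norm (z - y) \<le> R2 \<and> env z \<le> env x \<and>
    (\<forall>z'. envr z + real (Suc n) / 2 * (norm (z - x))\<^sup>2 \<le> envr z' + real (Suc n) / 2 * (norm (z' - x))\<^sup>2) \<and>
    real (Suc n) * norm (z - x) \<le> prox_kernel' p \<rho> (norm (z - y))"
    unfolding R2_def by (intro allI joint_minimizer) simp
  then obtain z y where zy: "\<And>n. F (y n) + ereal (prox_kernel p \<rho> (norm (z n - y n))) = env (z n)"
    and zx: "\<And>n. norm (z n - x) \<le> sqrt (2 * (envr x - m) / real (Suc n))"
    and zyR: "\<And>n. norm (z n - y n) \<le> R2"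
    and le: "\<And>n. env (z n) \<le> env x"
    and opt: "\<And>n z'. envr (z n) + real (Suc n) / 2 * (norm (z n - x))\<^sup>2 \<le> envr z' + real (Suc n) / 2 * (norm (z' - x))\<^sup>2"
    and st: "\<And>n. real (Suc n) * norm (z n - x) \<le> prox_kernel' p \<rho> (norm (z n - y n))"
    by metis
  define v where "v n = real (Suc n) *\<^sub>R (x - z n)" for n
  have vF: "v n \<in> frechet_subdiff env (z n)" for n
    unfolding v_def by (rule frechet_subgradient[OF opt]) simp
  have vn: "norm (v n) \<le> prox_kernel' p \<rho> (norm (z n - y n))" for n
    using st[of n] by (simp add: v_def norm_minus_commute)
  have "(\<lambda>n. sqrt (2 * (envr x - m) * (1 / real (Suc n)))) \<longlonglongrightarrow> sqrt (2 * (envr x - m) * 0)"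
    using LIMSEQ_inverse_real_of_nat
    by (intro tendsto_real_sqrt tendsto_mult tendsto_const) (simp add: inverse_eq_divide)
  hence "(\<lambda>n. sqrt (2 * (envr x - m) / real (Suc n))) \<longlonglongrightarrow> 0"
    unfolding times_divide_eq_right mult_1_right mult_zero_right real_sqrt_zero .
  moreover have "\<forall>\<^sub>F n in sequentially. norm (norm (z n - x)) \<le> sqrt (2 * (envr x - m) / real (Suc n))"
    using zx by (intro always_eventually allI) (simp only: real_norm_def abs_norm_cancel)
  ultimately have "(\<lambda>n. norm (z n - x)) \<longlonglongrightarrow> 0"
    by (rule Lim_null_comparison[rotated])
  hence zlim: "z \<longlonglongrightarrow> x" by (subst Lim_null) (rule tendsto_norm_zero_cancel)
  have zR: "norm (z n - x) \<le> R1" for n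
  proof -
    have "2 * (envr x - m) / real (Suc n) \<le> 2 * (envr x - m) / 1"
      using envr_ge[of x] by (intro divide_left_mono) auto
    thus ?thesis using zx[of n] unfolding R1_def by (metis div_by_1 order_trans real_sqrt_le_mono)
  qed
  define K where "K = cball x (R1 + R2) \<times> cball (0::'a) (prox_kernel' p \<rho> R2)"
  have "(y n, v n) \<in> K" for n
  proof -
    have "norm (y n - x) \<le> norm (z n - x) + norm (z n - y n)"
      using norm_triangle_ineq4[of "z n - x" "z n - y n"] by simp
    moreover have "prox_kernel' p \<rho> (norm (z n - y n)) \<le> prox_kernel' p \<rho> R2"
      unfolding prox_kernel'_def using \<rho> p zyR[of n] by (intro mult_left_mono add_mono powr_mono2) auto
    ultimately show ?thesis
      using zR[of n] zyR[of n] vn[of n] by (auto simp: K_def dist_norm norm_minus_commute)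
  qed
  moreover have "compact K" unfolding K_def by (intro compact_Times) auto
  ultimately obtain l r where r: "strict_mono r" "((\<lambda>n. (y n, v n)) \<circ> r) \<longlonglongrightarrow> l"
    unfolding compact_def by meson
  obtain yl vl where l: "l = (yl, vl)" by force
  have ylim: "(\<lambda>n. y (r n)) \<longlonglongrightarrow> yl" and vlim: "(\<lambda>n. v (r n)) \<longlonglongrightarrow> vl"
    using tendsto_fst[OF r(2)] tendsto_snd[OF r(2)] by (simp_all add: o_def l)
  have zrlim: "(\<lambda>n. z (r n)) \<longlonglongrightarrow> x"
    using LIMSEQ_subseq_LIMSEQ[OF zlim r(1)] by (simp add: o_def)
  have dlim: "(\<lambda>n. norm (z (r n) - y (r n))) \<longlonglongrightarrow> norm (x - yl)"
    by (intro tendsto_intros zrlim ylim)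
  have klim: "(\<lambda>n. prox_kernel p \<rho> (norm (z (r n) - y (r n)))) \<longlonglongrightarrow> prox_kernel p \<rho> (norm (x - yl))"
    by (rule tendsto_prox_kernel[OF dlim p]) simp
  have Fy: "F (y n) = ereal (envr (z n) - prox_kernel p \<rho> (norm (z n - y n)))" for n
    using zy[of n] by (cases "F (y n)") (auto simp: env_real)
  \<comment> \<open>The limit \<open>yl\<close> is a proximal point of \<open>x\<close>: one
    inequality is lower semicontinuity of \<open>F\<close>, the other is the definition of the
    envelope.\<close>
  have "F yl \<le> ereal (envr x - prox_kernel p \<rho> (norm (x - yl)))"
  proof (rule lower_semicontinuous_seq_le[OF lsc ylim])
    show "F (y (r n)) \<le> ereal (envr x - prox_kernel p \<rho> (norm (z (r n) - y (r n))))" for n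
      using le[of "r n"] by (simp add: Fy env_real)
    show "(\<lambda>n. ereal (envr x - prox_kernel p \<rho> (norm (z (r n) - y (r n))))) \<longlonglongrightarrow> ereal (envr x - prox_kernel p \<rho> (norm (x - yl)))"
      by (intro tendsto_intros klim)
  qed
  moreover have "ereal (envr x - prox_kernel p \<rho> (norm (x - yl))) \<le> F yl"
    using env_le[of x yl] ge[of yl] by (cases "F yl") (auto simp: env_real)
  ultimately have Fyl: "F yl = ereal (envr x - prox_kernel p \<rho> (norm (x - yl)))" by simp
  \<comment> \<open>The limiting subdifferential also demands convergence of the values. They never
    exceed \<open>envr x\<close>, and they are bounded below through lower semicontinuity of
    \<open>F\<close> at \<open>yl\<close> and convergence of the kernel terms.\<close>
  have "(\<lambda>n. envr (z (r n))) \<longlonglongrightarrow> envr x"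
  proof (rule order_tendstoI)
    fix a assume "a < envr x"
    define e where "e = (envr x - a) / 2"
    have e: "0 < e" using \<open>a < envr x\<close> by (simp add: e_def)
    have "ereal (envr x - prox_kernel p \<rho> (norm (x - yl)) - e) < F yl" using e by (simp add: Fyl)
    from lower_semicontinuousD[OF lsc this]
    have "\<forall>\<^sub>F n in sequentially. ereal (envr x - prox_kernel p \<rho> (norm (x - yl)) - e) < F (y (r n))"
      using ylim by (rule eventually_compose_filterlim)
    moreover have "\<forall>\<^sub>F n in sequentially. prox_kernel p \<rho> (norm (x - yl)) - e < prox_kernel p \<rho> (norm (z (r n) - y (r n)))"
      using klim by (rule order_tendstoD) (use e in auto)
    ultimately show "\<forall>\<^sub>F n in sequentially. a < envr (z (r n))"
      by eventually_elim (simp add: Fy e_def field_simps)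
  next
    fix a assume "envr x < a"
    moreover have "envr (z n) \<le> envr x" for n using le[of n] by (simp add: env_real)
    ultimately show "\<forall>\<^sub>F n in sequentially. envr (z (r n)) < a"
      by (intro always_eventually allI) (meson le_less_trans)
  qed
  hence elim: "(\<lambda>n. env (z (r n))) \<longlonglongrightarrow> env x" by (simp add: env_real)
  have "(\<lambda>n. norm (v (r n))) \<longlonglongrightarrow> norm vl" by (intro tendsto_intros vlim)
  moreover have "(\<lambda>n. prox_kernel' p \<rho> (norm (z (r n) - y (r n)))) \<longlonglongrightarrow> prox_kernel' p \<rho> (norm (x - yl))"
    by (rule tendsto_prox_kernel'[OF dlim p]) simp
  ultimately have "norm vl \<le> prox_kernel' p \<rho> (norm (x - yl))"
    by (rule LIMSEQ_le) (use vn in auto)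
  moreover have "vl \<in> limiting_subdiff env x"
    unfolding limiting_subdiff_def mem_Collect_eq
  proof (intro conjI exI)
    show "x \<in> dom_e env" by (simp add: dom_e_def env_real)
  qed (use vF in \<open>auto intro: zrlim elim vlim\<close>)
  ultimately show ?thesis by (intro exI[of _ yl] exI[of _ vl]) (simp add: Fyl env_real)
qed

end

section \<open>Weakly convex composite models\<close>

locale weakly_convex_sum =
  fixes h :: "'a::euclidean_space \<Rightarrow> real" and \<phi> :: "'a \<Rightarrow> ereal" and \<eta> :: real
  assumes wc: "weakly_convex \<eta> (\<lambda>y. ereal (h y) + \<phi> y)" and fin: "\<And>y. \<phi> y \<noteq> -\<infinity>"
begin

definition "\<psi> y = h y + real_of_ereal (\<phi> y) + \<eta> / 2 * (norm y)\<^sup>2"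

lemma \<phi>_real: "y \<in> dom_e \<phi> \<Longrightarrow> \<phi> y = ereal (real_of_ereal (\<phi> y))"
  using fin[of y] by (cases "\<phi> y") (auto simp: dom_e_def)

text \<open>A finite right side in the convexity inequality forces a finite left side, so convexity
  of the domain comes together with that of \<open>\<psi>\<close>.\<close>

lemma convex_combination:
  assumes y: "y \<in> dom_e \<phi>" "z \<in> dom_e \<phi>" and uv: "0 \<le> u" "0 \<le> v" "u + v = 1"
  shows "u *\<^sub>R y + v *\<^sub>R z \<in> dom_e \<phi>" "\<psi> (u *\<^sub>R y + v *\<^sub>R z) \<le> u * \<psi> y + v * \<psi> z"
proof -
  define w where "w = u *\<^sub>R y + v *\<^sub>R z"
  have eq: "ereal (h y) + \<phi> y + ereal (\<eta> / 2 * (norm y)\<^sup>2) = ereal (\<psi> y)" if "y \<in> dom_e \<phi>" for y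
    using \<phi>_real[OF that] by (cases "\<phi> y") (auto simp: \<psi>_def)
  have "ereal (h w) + \<phi> w + ereal (\<eta> / 2 * (norm w)\<^sup>2) \<le> ereal u * ereal (\<psi> y) + ereal v * ereal (\<psi> z)"
    using wc uv unfolding weakly_convex_def convex_ereal_def w_def eq[OF y(1), symmetric] eq[OF y(2), symmetric]
    by blast
  hence le: "ereal (h w) + \<phi> w + ereal (\<eta> / 2 * (norm w)\<^sup>2) \<le> ereal (u * \<psi> y + v * \<psi> z)" by simp
  hence w: "w \<in> dom_e \<phi>" by (cases "\<phi> w") (auto simp: dom_e_def)
  thus "u *\<^sub>R y + v *\<^sub>R z \<in> dom_e \<phi>" by (simp add: w_def)
  show "\<psi> (u *\<^sub>R y + v *\<^sub>R z) \<le> u * \<psi> y + v * \<psi> z"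
    using le unfolding eq[OF w] by (simp add: w_def)
qed

lemma convex_dom: "convex (dom_e \<phi>)"
  by (rule convexI) (rule convex_combination(1))

lemma convex_on_\<psi>: "convex_on (dom_e \<phi>) \<psi>"
  by (intro convex_on_def[THEN iffD2] conjI convex_dom ballI allI impI convex_combination(2))

text \<open>Lower semicontinuity of \<open>\<phi>\<close> alone says nothing about \<open>h\<close>; the inequality is transferred to \<open>y\<close>
  along points of \<open>Q\<close> near the segment from \<open>y\<close> into a simplex spanning the affine hull of the
  domain, where convexity bounds \<open>\<psi>\<close> from above.\<close>

lemma lower_bound_from_dense:
  assumes lsc: "lower_semicontinuous \<phi>" and Q: "Q \<subseteq> dom_e \<phi>" "dom_e \<phi> \<subseteq> closure Q"
    and c: "continuous_on UNIV c" and le: "\<And>q. q \<in> Q \<Longrightarrow> c q \<le> h q" and y: "y \<in> dom_e \<phi>"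
  shows "c y \<le> h y"
proof -
  define D where "D = dom_e \<phi>"
  obtain B where B: "B \<subseteq> D" "\<not> affine_dependent B" "affine hull D = affine hull B"
    using affine_basis_exists by blast
  define S where "S = convex hull B"
  have finB: "finite B" using B(2) by (rule aff_independent_finite)
  have "B \<noteq> {}" using B(3) y by (auto simp: D_def)
  have SD: "S \<subseteq> D" unfolding S_def D_def by (rule hull_minimal) (use B(1) convex_dom in \<open>auto simp: D_def\<close>)
  have affS: "affine hull S = affine hull D" by (simp add: S_def B(3))
  have "S \<noteq> {}" "convex S" using \<open>B \<noteq> {}\<close> by (auto simp: S_def)
  hence "rel_interior S \<noteq> {}" by (simp add: rel_interior_eq_empty)
  then obtain a where "a \<in> rel_interior S" by blast
  \<comment> \<open>Relative interior is what is available here: the domain may lie in a proper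
    affine subspace.\<close>
  then obtain e where a: "a \<in> S" and e: "0 < e" "ball a e \<inter> affine hull D \<subseteq> S"
    unfolding mem_rel_interior_ball affS by blast
  define K where "K = Max (\<psi> ` B)"
  have K: "\<psi> u \<le> K" if "u \<in> S" for u
  proof -
    have "convex_on (convex hull B) \<psi>"
      using convex_on_subset[OF convex_on_\<psi>, of S] SD \<open>convex S\<close> by (simp add: S_def D_def)
    moreover have "\<forall>u\<in>B. \<psi> u \<le> K" using finB by (simp add: K_def)
    ultimately show ?thesis using that convex_on_convex_hull_bound unfolding S_def by blast
  qed
  have "\<exists>q. q \<in> Q \<and> norm (q - ((1 - s) *\<^sub>R y + s *\<^sub>R a)) \<le> s \<and> \<psi> q \<le> (1 - s) * \<psi> y + s * K"
    if s: "0 < s" "s < 1" for s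
  proof -
    define z where "z = (1 - s) *\<^sub>R y + s *\<^sub>R a"
    have "z \<in> D" unfolding z_def D_def
      by (rule convex_combination(1)) (use y a SD s in \<open>auto simp: D_def\<close>)
    hence "z \<in> closure Q" using Q by (auto simp: D_def)
    moreover have "0 < s * min e 1" using s e by simp
    ultimately obtain q where q: "q \<in> Q" "dist q z < s * min e 1" by (meson closure_approachable)
    \<comment> \<open>Stretching the vector from \<open>y\<close> to \<open>q\<close> by 1/s leads
      to \<open>u\<close>. Since \<open>q\<close> is within s e of (1 - s) y + s a, the point
      \<open>u\<close> is within \<open>e\<close> of \<open>a\<close> and so lies in the simplex,
      where \<open>\<psi>\<close> is at most \<open>K\<close>.\<close>
    define u where "u = (1/s) *\<^sub>R q + (1 - 1/s) *\<^sub>R y"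
    have qu: "q = (1 - s) *\<^sub>R y + s *\<^sub>R u"
      using s by (simp add: u_def algebra_simps)
    have "q \<in> affine hull D" "y \<in> affine hull D"
      using q(1) Q y by (auto simp: D_def intro: hull_inc)
    hence "u \<in> affine hull D" unfolding u_def by (intro mem_affine affine_affine_hull) auto
    moreover have "u \<in> ball a e"
    proof -
      have "q - z = s *\<^sub>R (u - a)" unfolding z_def by (subst qu) (simp add: algebra_simps)
      hence "s * norm (u - a) < s * min e 1" using q(2) s by (simp add: dist_norm)
      hence "norm (u - a) < e" using s by simp
      thus ?thesis by (simp add: dist_norm norm_minus_commute)
    qed
    ultimately have uS: "u \<in> S" using e(2) by blast
    have "\<psi> q \<le> (1 - s) * \<psi> y + s * \<psi> u"
      unfolding qu by (rule convex_combination(2)) (use y uS SD s in \<open>auto simp: D_def\<close>)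
    also have "\<dots> \<le> (1 - s) * \<psi> y + s * K" using K[OF uS] s by simp
    finally have "\<psi> q \<le> (1 - s) * \<psi> y + s * K" .
    moreover have "s * min e 1 \<le> s * 1" using s by (intro mult_left_mono) auto
    hence "norm (q - z) \<le> s" using q(2) by (simp add: dist_norm)
    ultimately show ?thesis using q(1) by (auto simp: z_def)
  qed
  \<comment> \<open>The shift by 2 keeps the step strictly between 0 and 1.\<close>
  from this[of "1 / real (_ + 2)"] have "\<forall>n. \<exists>q. q \<in> Q \<and> norm (q - ((1 - 1 / real (n + 2)) *\<^sub>R y + (1 / real (n + 2)) *\<^sub>R a)) \<le> 1 / real (n + 2)
      \<and> \<psi> q \<le> (1 - 1 / real (n + 2)) * \<psi> y + (1 / real (n + 2)) * K" by (intro allI) auto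
  then obtain q where q: "\<And>n. q n \<in> Q"
    and qn: "\<And>n. norm (q n - ((1 - 1 / real (n + 2)) *\<^sub>R y + (1 / real (n + 2)) *\<^sub>R a)) \<le> 1 / real (n + 2)"
    and q\<psi>: "\<And>n. \<psi> (q n) \<le> (1 - 1 / real (n + 2)) * \<psi> y + (1 / real (n + 2)) * K"
    by metis
  have lim: "(\<lambda>n. 1 / real (n + 2)) \<longlonglongrightarrow> 0"
    using LIMSEQ_ignore_initial_segment[OF lim_1_over_n, of 2] by simp
  have "(\<lambda>n. q n - ((1 - 1 / real (n + 2)) *\<^sub>R y + (1 / real (n + 2)) *\<^sub>R a)) \<longlonglongrightarrow> 0"
    using qn by (intro Lim_null_comparison[OF _ lim] always_eventually allI)
  moreover have "(\<lambda>n. (1 - 1 / real (n + 2)) *\<^sub>R y + (1 / real (n + 2)) *\<^sub>R a) \<longlonglongrightarrow> (1 - 0) *\<^sub>R y + 0 *\<^sub>R a"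
    by (intro tendsto_add tendsto_scaleR tendsto_diff tendsto_const lim)
  ultimately have "(\<lambda>n. (q n - ((1 - 1 / real (n + 2)) *\<^sub>R y + (1 / real (n + 2)) *\<^sub>R a))
      + ((1 - 1 / real (n + 2)) *\<^sub>R y + (1 / real (n + 2)) *\<^sub>R a)) \<longlonglongrightarrow> 0 + ((1 - 0) *\<^sub>R y + 0 *\<^sub>R a)"
    by (rule tendsto_add)
  hence qlim: "q \<longlonglongrightarrow> y" by simp
  \<comment> \<open>The bound on \<open>\<psi>\<close>, solved for \<open>\<phi>\<close> with
    \<open>h\<close> replaced by its continuous minorant \<open>c\<close> on \<open>Q\<close>.
    Nothing discontinuous is left on the right, so lower semicontinuity of \<open>\<phi>\<close>
    alone passes to the limit.\<close>
  define r where "r n = (1 - 1 / real (n + 2)) * \<psi> y + (1 / real (n + 2)) * K - \<eta> / 2 * (norm (q n))\<^sup>2 - c (q n)" for n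
  have "(\<lambda>n. c (q n)) \<longlonglongrightarrow> c y"
    using c qlim by (metis UNIV_I continuous_on_eq_continuous_at isCont_tendsto_compose open_UNIV)
  hence "r \<longlonglongrightarrow> (1 - 0) * \<psi> y + 0 * K - \<eta> / 2 * (norm y)\<^sup>2 - c y"
    unfolding r_def by (intro tendsto_diff tendsto_add tendsto_mult tendsto_const tendsto_power tendsto_norm qlim lim)
  hence rlim: "(\<lambda>n. ereal (r n)) \<longlonglongrightarrow> ereal (\<psi> y - \<eta> / 2 * (norm y)\<^sup>2 - c y)" by simp
  have "\<phi> y \<le> ereal (\<psi> y - \<eta> / 2 * (norm y)\<^sup>2 - c y)"
  proof (rule lower_semicontinuous_seq_le[OF lsc qlim _ rlim])
    fix n
    have "q n \<in> dom_e \<phi>" using q Q by blast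
    moreover have "real_of_ereal (\<phi> (q n)) \<le> r n"
      using q\<psi>[of n] le[OF q, of n] by (simp only: r_def \<psi>_def)
    ultimately show "\<phi> (q n) \<le> ereal (r n)" using \<phi>_real by (metis ereal_less_eq(3))
  qed
  thus ?thesis using \<phi>_real[OF y] by (cases "\<phi> y") (auto simp: \<psi>_def)
qed

text \<open>Comparing the minimizer \<open>z\<close> only with points on the segment to \<open>y\<close> suffices: strong convexity
  of the proximal subproblem gives its quadratic growth around \<open>z\<close>.\<close>

lemma proximal_growth:
  assumes z: "z \<in> dom_e \<phi>" and y: "y \<in> dom_e \<phi>"
    and opt: "\<And>n. h z + real_of_ereal (\<phi> z) + \<beta> / 2 * (norm (z - x))\<^sup>2
      \<le> h (z + (1 / real (n + 2)) *\<^sub>R (y - z)) + real_of_ereal (\<phi> (z + (1 / real (n + 2)) *\<^sub>R (y - z)))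
        + \<beta> / 2 * (norm (z + (1 / real (n + 2)) *\<^sub>R (y - z) - x))\<^sup>2"
  shows "h z + real_of_ereal (\<phi> z) + \<beta> / 2 * (norm (z - x))\<^sup>2 + (\<beta> - \<eta>) / 2 * (norm (y - z))\<^sup>2
    \<le> h y + real_of_ereal (\<phi> y) + \<beta> / 2 * (norm (y - x))\<^sup>2"
proof -
  define b where "b = h z + real_of_ereal (\<phi> z) + \<beta> / 2 * (norm (z - x))\<^sup>2"
  define b' where "b' = h y + real_of_ereal (\<phi> y) + \<beta> / 2 * (norm (y - x))\<^sup>2"
  have sq: "(norm (w + s *\<^sub>R (w' - w)))\<^sup>2 = (1 - s) * (norm w)\<^sup>2 + s * (norm w')\<^sup>2 - s * (1 - s) * (norm (w' - w))\<^sup>2"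
    for w w' :: 'a and s
    by (simp add: power2_norm_eq_inner inner_simps inner_commute algebra_simps)
  \<comment> \<open>The squared norm obeys an exact identity along the segment. The proximal term
    contributes its curvature \<beta>, weak convexity costs \<eta>, and the difference survives
    division by \<open>s\<close>.\<close>
  have step: "(\<beta> - \<eta>) / 2 * (1 - s) * (norm (y - z))\<^sup>2 \<le> b' - b"
    if s: "0 < s" "s < 1" and le: "b \<le> h (z + s *\<^sub>R (y - z)) + real_of_ereal (\<phi> (z + s *\<^sub>R (y - z)))
        + \<beta> / 2 * (norm (z + s *\<^sub>R (y - z) - x))\<^sup>2" for s
  proof -
    define w where "w = z + s *\<^sub>R (y - z)"
    have w: "w = (1 - s) *\<^sub>R z + s *\<^sub>R y" by (simp add: w_def algebra_simps)
    have 1: "\<psi> w \<le> (1 - s) * \<psi> z + s * \<psi> y"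
      unfolding w by (rule convex_combination(2)) (use s y z in auto)
    have 2: "(norm w)\<^sup>2 = (1 - s) * (norm z)\<^sup>2 + s * (norm y)\<^sup>2 - s * (1 - s) * (norm (y - z))\<^sup>2"
      unfolding w_def by (rule sq)
    have "w - x = (z - x) + s *\<^sub>R ((y - x) - (z - x))" by (simp add: w_def)
    hence 3: "(norm (w - x))\<^sup>2 = (1 - s) * (norm (z - x))\<^sup>2 + s * (norm (y - x))\<^sup>2 - s * (1 - s) * (norm (y - z))\<^sup>2"
      by (simp only: sq) simp
    have "h w + real_of_ereal (\<phi> w) \<le> (1 - s) * (h z + real_of_ereal (\<phi> z)) + s * (h y + real_of_ereal (\<phi> y))
        + \<eta> / 2 * (s * (1 - s) * (norm (y - z))\<^sup>2)"
    proof -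
      have "\<eta> / 2 * ((1 - s) * (norm z)\<^sup>2 + s * (norm y)\<^sup>2 - s * (1 - s) * (norm (y - z))\<^sup>2)
          = (1 - s) * (\<eta> / 2 * (norm z)\<^sup>2) + s * (\<eta> / 2 * (norm y)\<^sup>2) - \<eta> / 2 * (s * (1 - s) * (norm (y - z))\<^sup>2)"
        by (simp add: field_simps)
      thus ?thesis using 1 unfolding \<psi>_def 2 distrib_left[where a = s] distrib_left[where a = "1 - s"] by linarith
    qed
    moreover have "b \<le> h w + real_of_ereal (\<phi> w) + \<beta> / 2 * ((1 - s) * (norm (z - x))\<^sup>2
        + s * (norm (y - x))\<^sup>2 - s * (1 - s) * (norm (y - z))\<^sup>2)"
      using le unfolding w_def[symmetric] 3 .
    ultimately have "b \<le> (1 - s) * b + s * b' - (\<beta> - \<eta>) / 2 * (s * (1 - s) * (norm (y - z))\<^sup>2)"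
      by (simp add: b_def b'_def field_simps)
    hence "s * ((\<beta> - \<eta>) / 2 * (1 - s) * (norm (y - z))\<^sup>2) \<le> s * (b' - b)"
      by (simp add: field_simps)
    thus ?thesis using s by simp
  qed
  have lim: "(\<lambda>n. 1 / real (n + 2)) \<longlonglongrightarrow> 0"
    using LIMSEQ_ignore_initial_segment[OF lim_1_over_n, of 2] by simp
  have "(\<lambda>n. (\<beta> - \<eta>) / 2 * (1 - 1 / real (n + 2)) * (norm (y - z))\<^sup>2) \<longlonglongrightarrow> (\<beta> - \<eta>) / 2 * (1 - 0) * (norm (y - z))\<^sup>2"
    by (intro tendsto_mult tendsto_diff tendsto_const lim)
  moreover have "(\<beta> - \<eta>) / 2 * (1 - 1 / real (n + 2)) * (norm (y - z))\<^sup>2 \<le> b' - b" for n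
    by (rule step) (use opt[of n] in \<open>auto simp: b_def\<close>)
  ultimately have "(\<beta> - \<eta>) / 2 * (1 - 0) * (norm (y - z))\<^sup>2 \<le> b' - b"
    by (intro LIMSEQ_le_const2) auto
  thus ?thesis by (simp add: b_def b'_def)
qed

end

section \<open>Absorbing the noise\<close>

text \<open>Twice the bound on the expected remainder left by Young's inequality when b = \<beta> -
  \<open>rho_tilde\<close>.\<close>

definition noise :: "real \<Rightarrow> real \<Rightarrow> real \<Rightarrow> real \<Rightarrow> real \<Rightarrow> real \<Rightarrow> real \<Rightarrow> real" where
  "noise p \<nu> \<rho> \<tau> L1 L2 b = const_C p \<rho> \<tau> * pow2p p b (- p) + const_D p * L1\<^sup>2 / b
     + const_E p \<nu> * L2 powr (2 / (2 - \<nu>)) * b powr (- \<nu> / (2 - \<nu>))"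

text \<open>The powers that arise from \<open>noise\<close> / b and from its power p/2; the two
  \<open>pow2p\<close> terms also pay for steps whose decrease exceeds d^2.\<close>

definition error_terms :: "real \<Rightarrow> real \<Rightarrow> real \<Rightarrow> real \<Rightarrow> real \<Rightarrow> real" where
  "error_terms p \<nu> L1 L2 b = pow2p p b (- 2) + L1\<^sup>2 * b powr (- 2)
     + pow2p p b (- p) + L1 powr p * b powr (- p)
     + L2 powr (2 / (2 - \<nu>)) * b powr (- 2 / (2 - \<nu>)) + L2 powr (p / (2 - \<nu>)) * b powr (- p / (2 - \<nu>))"

text \<open>The number of noise terms among which the proximal quadratic is split; for \<open>p = 2\<close> the
  \<open>p\<close>-th power is itself quadratic and already accounted for in \<^const>\<open>rho_tilde\<close>.\<close>

definition num_terms :: "real \<Rightarrow> real" where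
  "num_terms p = (if p = 2 then 2 else 3)"

text \<open>The \<open>rho_tilde\<close> part of \<beta>/2 d^2 covers \<rho>/2 d^2, and for p = 2
  the p-th power as well, so that exactly b/2 d^2 remains. \<open>num_terms\<close> equal shares of
  it absorb the other terms by \<open>young_square\<close>.\<close>

lemma young_noise:
  assumes p: "1 < p" "p \<le> 2" and \<nu>: "0 < \<nu>" "\<nu> \<le> 1" and \<rho>: "0 < \<rho>" and \<tau>: "0 < \<tau>" and b: "0 < b"
    and d: "0 \<le> d" and c: "0 \<le> c1" "0 \<le> c2" and \<beta>: "\<beta> = b + rho_tilde p \<rho> \<tau>"
  shows "(\<rho> + \<tau>) / p * d powr p + \<rho> / 2 * d\<^sup>2 + c1 * d + c2 * d powr \<nu> - \<beta> / 2 * d\<^sup>2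
    \<le> const_C p \<rho> \<tau> / 2 * pow2p p b (- p) + num_terms p / (2 * b) * c1\<^sup>2
      + (2 - \<nu>) / 2 * c2 powr (2 / (2 - \<nu>)) * (num_terms p * \<nu> / b) powr (\<nu> / (2 - \<nu>))"
proof -
  define \<kappa> where "\<kappa> = num_terms p"
  have \<kappa>: "0 < \<kappa>" by (simp add: \<kappa>_def num_terms_def)
  define k where "k = b / (2 * \<kappa>)"
  have k: "0 < k" using b \<kappa> by (simp add: k_def)
  have "c1 * d powr 1 \<le> k * d\<^sup>2 + (2 - 1) / 2 * c1 powr (2 / (2 - 1)) * (1 / (2 * k)) powr (1 / (2 - 1))"
    using c d k by (intro young_square) auto
  moreover have "(2 - 1) / 2 * c1 powr (2 / (2 - 1)) * (1 / (2 * k)) powr (1 / (2 - 1)) = \<kappa> / (2 * b) * c1\<^sup>2"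
    using c b \<kappa> by (simp add: k_def)
  ultimately have 1: "c1 * d \<le> k * d\<^sup>2 + \<kappa> / (2 * b) * c1\<^sup>2" using d by simp
  have "c2 * d powr \<nu> \<le> k * d\<^sup>2 + (2 - \<nu>) / 2 * c2 powr (2 / (2 - \<nu>)) * (\<nu> / (2 * k)) powr (\<nu> / (2 - \<nu>))"
    using c d k \<nu> by (intro young_square) auto
  moreover have "\<nu> / (2 * k) = \<kappa> * \<nu> / b" using b \<kappa> by (simp add: k_def field_simps)
  ultimately have 2: "c2 * d powr \<nu> \<le> k * d\<^sup>2 + (2 - \<nu>) / 2 * c2 powr (2 / (2 - \<nu>)) * (\<kappa> * \<nu> / b) powr (\<nu> / (2 - \<nu>))"
    by simp
  show ?thesis
  proof (cases "p = 2")
    case True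
    have \<kappa>2: "\<kappa> = 2" using True by (simp add: \<kappa>_def num_terms_def)
    have "(\<rho> + \<tau>) / p * d powr p + \<rho> / 2 * d\<^sup>2 - \<beta> / 2 * d\<^sup>2 = - (2 * (k * d\<^sup>2))"
      using d by (simp add: True \<beta> rho_tilde_def k_def \<kappa>2 field_simps)
    moreover have "const_C p \<rho> \<tau> = 0" by (simp add: True const_C_def)
    ultimately show ?thesis using 1 2 by (simp add: \<kappa>_def[symmetric])
  next
    case False
    hence p2: "p < 2" using p by simp
    have \<kappa>3: "\<kappa> = 3" using False by (simp add: \<kappa>_def num_terms_def)
    define s where "s = (\<rho> + \<tau>) / p"
    have s: "0 < s" using \<rho> \<tau> p by (simp add: s_def)
    have "s * d powr p \<le> k * d\<^sup>2 + (2 - p) / 2 * s powr (2 / (2 - p)) * (p / (2 * k)) powr (p / (2 - p))"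
      using s d k p p2 by (intro young_square) auto
    also have "(p / (2 * k)) = (3 * p) / b" using b by (simp add: k_def \<kappa>3 field_simps)
    also have "s powr (2 / (2 - p)) * (3 * p / b) powr (p / (2 - p))
        = (\<rho> + \<tau>) powr (2 / (2 - p)) * 3 powr (p / (2 - p)) * (p powr (p / (2 - p)) / p powr (2 / (2 - p))) / b powr (p / (2 - p))"
      using \<rho> \<tau> p b unfolding s_def by (simp add: powr_mult powr_divide)
    hence "(2 - p) / 2 * s powr (2 / (2 - p)) * (3 * p / b) powr (p / (2 - p))
        = (2 - p) / 2 * ((\<rho> + \<tau>) powr (2 / (2 - p)) * 3 powr (p / (2 - p)) * (p powr (p / (2 - p)) / p powr (2 / (2 - p))) / b powr (p / (2 - p)))"
      by (simp only: mult.assoc)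
    \<comment> \<open>The two exponents of \<open>p\<close> differ by one, which is the origin of
      the factor 1/p in \<open>const_C\<close>.\<close>
    also have "p powr (p / (2 - p)) / p powr (2 / (2 - p)) = 1 / p"
    proof -
      have "p / (2 - p) - 2 / (2 - p) = -1"
        using p2 by (simp add: diff_divide_distrib[symmetric] divide_eq_minus_1_iff)
      hence "p powr (p / (2 - p)) / p powr (2 / (2 - p)) = p powr (-1)"
        by (simp only: powr_diff[symmetric])
      thus ?thesis using p by (simp add: powr_minus_divide)
    qed
    also have "(2 - p) / 2 * ((\<rho> + \<tau>) powr (2 / (2 - p)) * 3 powr (p / (2 - p)) * (1 / p) / b powr (p / (2 - p)))
        = const_C p \<rho> \<tau> / 2 * pow2p p b (- p)"
      using p2 by (simp add: const_C_def pow2p_def powr_minus_divide mult_ac)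
    finally have 3: "s * d powr p \<le> k * d\<^sup>2 + const_C p \<rho> \<tau> / 2 * pow2p p b (- p)" .
    have "\<rho> / 2 * d\<^sup>2 - \<beta> / 2 * d\<^sup>2 = - (3 * (k * d\<^sup>2))"
      using False by (simp add: \<beta> rho_tilde_def k_def \<kappa>3 field_simps)
    thus ?thesis using 1 2 3 by (simp add: \<kappa>_def[symmetric] s_def[symmetric])
  qed
qed

text \<open>Division by \<open>b\<close> lowers every exponent of \<open>b\<close> by one, for
  instance -\<nu>/(2-\<nu>) to -2/(2-\<nu>). As p/2 \<le> 1, the outer power is subadditive and acts
  on each summand separately.\<close>

lemma noise_error:
  assumes p: "1 < p" "p \<le> 2" and \<nu>: "0 < \<nu>" "\<nu> \<le> 1" and L: "0 < L1" "0 < L2" and \<rho>: "0 < \<rho>" "0 < \<tau>" and b: "0 < b"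
  shows "noise p \<nu> \<rho> \<tau> L1 L2 b / b = const_C p \<rho> \<tau> * pow2p p b (- 2) + const_D p * (L1\<^sup>2 * b powr (- 2))
        + const_E p \<nu> * (L2 powr (2 / (2 - \<nu>)) * b powr (- 2 / (2 - \<nu>)))" (is ?eq)
    and "(noise p \<nu> \<rho> \<tau> L1 L2 b / b) powr (p / 2) \<le> const_C p \<rho> \<tau> powr (p / 2) * pow2p p b (- p)
        + const_D p powr (p / 2) * (L1 powr p * b powr (- p))
        + const_E p \<nu> powr (p / 2) * (L2 powr (p / (2 - \<nu>)) * b powr (- p / (2 - \<nu>)))" (is ?le)
proof -
  have CDE: "0 \<le> const_C p \<rho> \<tau>" "0 \<le> const_D p" "0 \<le> const_E p \<nu>"
    using p \<nu> by (auto simp: const_C_def const_D_def const_E_def)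
  have "pow2p p b (- p) / b = pow2p p b (- 2)"
  proof (cases "p = 2")
    case False
    hence "- p / (2 - p) - 1 = - 2 / (2 - p)" using p by (simp add: field_simps)
    hence "b powr (- p / (2 - p)) / b powr 1 = b powr (- 2 / (2 - p))"
      by (simp only: powr_diff[symmetric])
    thus ?thesis using b False by (simp add: pow2p_def)
  qed (simp add: pow2p_def)
  moreover have "b powr (- \<nu> / (2 - \<nu>)) / b = b powr (- 2 / (2 - \<nu>))"
  proof -
    have "- \<nu> / (2 - \<nu>) - 1 = - 2 / (2 - \<nu>)" using \<nu> by (simp add: field_simps)
    hence "b powr (- \<nu> / (2 - \<nu>)) / b powr 1 = b powr (- 2 / (2 - \<nu>))"
      by (simp only: powr_diff[symmetric])
    thus ?thesis using b by simp
  qed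
  moreover have "1 / b / b = b powr (- 2)"
    using b by (simp add: powr_minus_divide power2_eq_square)
  moreover have "noise p \<nu> \<rho> \<tau> L1 L2 b / b = const_C p \<rho> \<tau> * (pow2p p b (- p) / b) + const_D p * (L1\<^sup>2 * (1 / b / b))
      + const_E p \<nu> * (L2 powr (2 / (2 - \<nu>)) * (b powr (- \<nu> / (2 - \<nu>)) / b))"
    by (simp add: noise_def add_divide_distrib mult.assoc)
  ultimately show eq: ?eq by simp
  define t1 where "t1 = const_C p \<rho> \<tau> * pow2p p b (- 2)"
  define t2 where "t2 = const_D p * (L1\<^sup>2 * b powr (- 2))"
  define t3 where "t3 = const_E p \<nu> * (L2 powr (2 / (2 - \<nu>)) * b powr (- 2 / (2 - \<nu>)))"
  have t: "0 \<le> t1" "0 \<le> t2" "0 \<le> t3"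
    using CDE by (auto simp: t1_def t2_def t3_def pow2p_def)
  have "(t1 + t2 + t3) powr (p/2) \<le> (t1 + t2) powr (p/2) + t3 powr (p/2)"
    using t p by (intro powr_add_subadditive) auto
  also have "(t1 + t2) powr (p/2) \<le> t1 powr (p/2) + t2 powr (p/2)"
    using t p by (intro powr_add_subadditive) auto
  finally have le: "(t1 + t2 + t3) powr (p/2) \<le> t1 powr (p/2) + t2 powr (p/2) + t3 powr (p/2)" by simp
  have 1: "t1 powr (p/2) = const_C p \<rho> \<tau> powr (p / 2) * pow2p p b (- p)"
  proof (cases "p = 2")
    case False
    have "- 2 / (2 - p) * (p/2) = - p / (2 - p)" using False by (simp add: divide_simps)
    hence "(b powr (- 2 / (2 - p))) powr (p/2) = b powr (- p / (2 - p))"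
      by (simp only: powr_powr)
    thus ?thesis using False by (simp add: t1_def pow2p_def powr_mult CDE)
  qed (simp add: t1_def pow2p_def)
  have 2: "t2 powr (p/2) = const_D p powr (p / 2) * (L1 powr p * b powr (- p))"
  proof -
    have "(L1\<^sup>2) powr (p/2) = L1 powr p" using L by (simp add: powr_powr flip: powr_numeral)
    thus ?thesis by (simp add: t2_def powr_mult CDE powr_powr)
  qed
  have 3: "t3 powr (p/2) = const_E p \<nu> powr (p / 2) * (L2 powr (p / (2 - \<nu>)) * b powr (- p / (2 - \<nu>)))"
  proof -
    have "2 / (2 - \<nu>) * (p/2) = p / (2 - \<nu>)" "- 2 / (2 - \<nu>) * (p/2) = - p / (2 - \<nu>)"
      using \<nu> by (auto simp: divide_simps)
    thus ?thesis unfolding t3_def by (simp only: powr_mult powr_powr)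
  qed
  show ?le using le unfolding eq 1 2 3 unfolding t1_def t2_def t3_def .
qed

text \<open>Here \<open>d\<close> is the distance of the current point to its proximal point and \<open>q\<close> bounds the
  expected squared distance of the next point to it.\<close>

lemma descent_algebra:
  assumes p: "1 < p" "p \<le> 2" and \<nu>: "0 < \<nu>" "\<nu> \<le> 1" and L: "0 < L1" "0 < L2"
    and \<tau>: "0 < \<tau>" and \<eta>: "0 < \<eta>" and \<rho>: "\<rho> > 2 * (2 * \<tau> + \<eta>)" and b: "0 < b"
    and \<beta>: "\<beta> = b + rho_tilde p \<rho> \<tau>" and d: "0 \<le> d" and q0: "0 \<le> q"
    and q: "q \<le> d\<^sup>2 - (const_A \<rho> \<eta> * d\<^sup>2 + const_B p \<rho> \<tau> * d powr p) / (\<beta> - \<eta>) + noise p \<nu> \<rho> \<tau> L1 L2 b / (\<beta> - \<eta>)"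
  shows "\<rho> / p * q powr (p / 2) + \<rho> / 2 * q
    \<le> prox_kernel p \<rho> d + \<rho> / 2 * (calB p \<nu> \<rho> \<tau> \<eta> * error_terms p \<nu> L1 L2 b)
      - \<rho> / 2 * (calA p \<rho> \<tau> \<eta> / (\<beta> - \<eta>) * (d powr (p - 1) + d)\<^sup>2)"
proof -
  define A where "A = const_A \<rho> \<eta>"
  define B where "B = const_B p \<rho> \<tau>"
  define c where "c = \<beta> - \<eta>"
  define N where "N = noise p \<nu> \<rho> \<tau> L1 L2 b"
  \<comment> \<open>\<open>S\<close> is the decrease of the squared distance and \<open>X\<close>
    the noise. \<open>G1\<close> and \<open>G2\<close> vanish for p = 2; for p < 2 they cover the
    case that \<open>S\<close> exceeds d^2.\<close>
  define S where "S = (A * d\<^sup>2 + B * d powr p) / c"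
  define X where "X = 2 / p * (N / b) powr (p / 2) + N / b"
  define G1 where "G1 = const_G p * A * pow2p p B p * pow2p p b (- 2)"
  define G2 where "G2 = const_G p * pow2p p B p * pow2p p b (- p)"
  have "0 < 2 * (2 * \<tau> + \<eta>)" using \<tau> \<eta> by simp
  hence \<rho>0: "0 < \<rho>" using \<rho> by (rule less_trans)
  have AB: "0 < A" "0 < B" using \<rho> \<tau> \<eta> p by (auto simp: A_def B_def const_A_def const_B_def)
  have CDE: "0 \<le> const_C p \<rho> \<tau>" "0 \<le> const_D p" "0 \<le> const_E p \<nu>"
    using p \<nu> by (auto simp: const_C_def const_D_def const_E_def)
  have bc: "b \<le> c" using \<rho> \<tau> \<eta> by (auto simp: c_def \<beta> rho_tilde_def)
  have c0: "0 < c" using bc b by simp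
  have N0: "0 \<le> N" using CDE b by (auto simp: N_def noise_def pow2p_def)
  have "N / c \<le> N / b" using N0 b bc by (intro divide_left_mono) auto
  hence qS: "q \<le> d\<^sup>2 - S + N / b" using q by (simp add: A_def B_def c_def N_def S_def)
  have S0: "0 \<le> S" using AB c0 by (simp add: S_def)
  have G0: "0 \<le> G1" "0 \<le> G2" using AB by (auto simp: G1_def G2_def const_G_def pow2p_def)
  have sq: "(d powr (p - 1) + d)\<^sup>2 = d powr (2 * p - 2) + 2 * d powr p + d\<^sup>2"
  proof -
    have "d powr (p - 1) * d powr (p - 1) = d powr (2 * p - 2)" by (simp flip: powr_add)
    moreover have "d * d powr (p - 1) = d powr p" using d by (simp add: powr_mult_base)
    ultimately show ?thesis by (simp add: power2_eq_square algebra_simps)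
  qed
  \<comment> \<open>The square expands into d^(2p-2) + 2 d^p + d^2. The decrease of the squared
    distance supplies one d^p and d^2, that of the p-th power the other d^p and d^(2p-2); the
    smaller of A and B serves all four.\<close>
  have "calA p \<rho> \<tau> \<eta> * (d powr (p - 1) + d)\<^sup>2 \<le> A * d\<^sup>2 + B * d powr p + (A * d powr p + B * d powr (2 * p - 2))"
  proof -
    define w where "w = calA p \<rho> \<tau> \<eta>"
    have m: "w \<le> A" "w \<le> B" by (auto simp: w_def calA_def A_def B_def)
    have "w * d powr (2 * p - 2) \<le> B * d powr (2 * p - 2)" "w * d powr p \<le> A * d powr p"
      "w * d powr p \<le> B * d powr p" "w * d\<^sup>2 \<le> A * d\<^sup>2"
      by (intro mult_right_mono m; simp)+
    moreover have "w * (d powr (2 * p - 2) + 2 * d powr p + d\<^sup>2)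
        = w * d powr (2 * p - 2) + w * d powr p + w * d powr p + w * d\<^sup>2"
      by (simp add: distrib_left)
    ultimately show ?thesis unfolding sq w_def[symmetric] by linarith
  qed
  hence "calA p \<rho> \<tau> \<eta> * (d powr (p - 1) + d)\<^sup>2 / c \<le> (A * d\<^sup>2 + B * d powr p + (A * d powr p + B * d powr (2 * p - 2))) / c"
    using c0 by (intro divide_right_mono) auto
  hence calA_le: "calA p \<rho> \<tau> \<eta> / c * (d powr (p - 1) + d)\<^sup>2 \<le> S + (A * d powr p + B * d powr (2 * p - 2)) / c"
    by (simp add: S_def add_divide_distrib)
  have main: "2 / p * q powr (p/2) + q
      \<le> 2 / p * d powr p + d\<^sup>2 + X + (G1 + G2) - (S + (A * d powr p + B * d powr (2 * p - 2)) / c)"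
  \<comment> \<open>The tangent of t^(p/2) at d^2 can be evaluated at d^2 - S only if this is
    nonnegative, and it needs d^2 > 0.\<close>
  proof (cases "S \<le> d\<^sup>2 \<and> 0 < d")
    case True
    hence S: "S \<le> d\<^sup>2" and d0: "0 < d" by auto
    have "q powr (p/2) \<le> ((d\<^sup>2 - S) + N / b) powr (p/2)"
      using qS q0 p by (intro powr_mono2) auto
    also have "\<dots> \<le> (d\<^sup>2 - S) powr (p/2) + (N / b) powr (p/2)"
      using S N0 b p by (intro powr_add_subadditive) auto
    \<comment> \<open>The slope p/2 d^(p-2) of the tangent multiplies \<open>S\<close>, which lowers
      both exponents in A d^2 + B d^p by 2 - p.\<close>
    also have "(d\<^sup>2 - S) powr (p/2) \<le> (d\<^sup>2) powr (p/2) + p/2 * (d\<^sup>2) powr (p/2 - 1) * ((d\<^sup>2 - S) - d\<^sup>2)"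
      using S d0 p by (intro powr_tangent) auto
    also have "(d\<^sup>2) powr (p/2) = d powr p" using d0 by (simp add: powr_powr flip: powr_numeral)
    also have "(d\<^sup>2) powr (p/2 - 1) = d powr (p - 2)"
      using d0 by (simp add: powr_powr algebra_simps flip: powr_numeral)
    finally have "q powr (p/2) \<le> d powr p - p/2 * (d powr (p - 2) * S) + (N / b) powr (p/2)" by simp
    hence "2/p * q powr (p/2) \<le> 2/p * (d powr p - p/2 * (d powr (p - 2) * S) + (N / b) powr (p/2))"
      using p by (intro mult_left_mono) auto
    also have "\<dots> = 2/p * d powr p - d powr (p - 2) * S + 2/p * (N / b) powr (p/2)"
      using p by (simp add: distrib_left right_diff_distrib)
    also have "d powr (p - 2) * S = (A * d powr p + B * d powr (2 * p - 2)) / c"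
    proof -
      have "d powr (p - 2) * d\<^sup>2 = d powr p"
        using d0 by (simp flip: powr_numeral powr_add)
      moreover have "d powr (p - 2) * d powr p = d powr (2 * p - 2)"
        by (simp add: algebra_simps flip: powr_add)
      moreover have "d powr (p - 2) * S = (A * (d powr (p - 2) * d\<^sup>2) + B * (d powr (p - 2) * d powr p)) / c"
        by (simp add: S_def algebra_simps)
      ultimately show ?thesis by simp
    qed
    finally show ?thesis using qS G0 by (simp add: X_def)
  next
    case F: False
    show ?thesis
    proof (cases "d = 0")
      case True
      have "q \<le> N / b" using qS S0 True by simp
      hence "q powr (p/2) \<le> (N / b) powr (p/2)" using q0 p by (intro powr_mono2) auto
      hence "2/p * q powr (p/2) \<le> 2/p * (N / b) powr (p/2)" using p by (intro mult_left_mono) auto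
      thus ?thesis using \<open>q \<le> N / b\<close> G0 True by (simp add: X_def S_def)
    next
      case False
      hence d0: "0 < d" and S: "d\<^sup>2 < S" using d F by auto
      have cS: "c * d\<^sup>2 < A * d\<^sup>2 + B * d powr p"
        using S c0 by (simp add: S_def pos_less_divide_eq mult.commute)
      \<comment> \<open>For p = 2 a decrease above d^2 would mean c < A + B, but
        \<open>rho_tilde\<close> = 2\<rho> + \<tau> makes c larger than that.\<close>
      have p2: "p < 2"
      proof (rule ccontr)
        assume "\<not> p < 2"
        hence "p = 2" using p by simp
        hence "c * d\<^sup>2 < (A + B) * d\<^sup>2" using cS d0 by (simp add: distrib_right)
        hence "c < A + B" using d0 by simp
        thus False using \<open>p = 2\<close> b \<tau> \<eta> by (simp add: c_def \<beta> rho_tilde_def A_def B_def const_A_def const_B_def)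
      qed
      \<comment> \<open>With \<open>rho_tilde\<close> = \<rho> the A-terms cancel and b d^2 < B d^p
        remains. Hence d^(2-p) \<le> B/b, and every positive power of d is bounded by a power of
        B/b.\<close>
      have "c = b + A" using p2 by (simp add: c_def \<beta> rho_tilde_def A_def const_A_def)
      hence "b * d\<^sup>2 < B * d powr p" using cS by (simp add: distrib_right)
      moreover have "d\<^sup>2 = d powr p * d powr (2 - p)" using d0 by (simp flip: powr_add powr_numeral)
      ultimately have "d powr p * (b * d powr (2 - p)) < d powr p * B" by (simp add: mult_ac)
      hence "b * d powr (2 - p) < B" using d0 by simp
      hence "d powr (2 - p) \<le> B / b" using b by (simp add: field_simps)
      hence powr_le: "d powr ((2 - p) * (r / (2 - p))) \<le> (B / b) powr (r / (2 - p))" if "0 \<le> r" for r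
        unfolding powr_powr[symmetric] using p2 that by (intro powr_mono2) auto
      have 1: "d powr p \<le> (B / b) powr (p / (2 - p))" using powr_le[of p] p p2 by simp
      have 2: "d powr (2 * p - 2) \<le> (B / b) powr ((2 * p - 2) / (2 - p))"
        using powr_le[of "2 * p - 2"] p p2 by simp
      have "q \<le> N / b" using qS S by simp
      hence "q powr (p/2) \<le> (N / b) powr (p/2)" using q0 p by (intro powr_mono2) auto
      hence 3: "2/p * q powr (p/2) \<le> 2/p * (N / b) powr (p/2)" using p by (intro mult_left_mono) auto
      have "A * d powr p / c \<le> A * (B / b) powr (p / (2 - p)) / b"
        using AB 1 b bc by (intro frac_le mult_left_mono) auto
      also have "\<dots> = G1"
      proof -
        have "p / (2 - p) + 1 = 2 / (2 - p)" using p2 by (simp add: field_simps)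
        hence "b powr (p / (2 - p)) * b powr 1 = b powr (2 / (2 - p))" by (simp only: powr_add[symmetric])
        hence "1 / b powr (p / (2 - p)) / b = b powr (- 2 / (2 - p))"
          using b by (simp add: powr_minus_divide)
        moreover have "A * (B / b) powr (p / (2 - p)) / b = A * B powr (p / (2 - p)) * (1 / b powr (p / (2 - p)) / b)"
          using AB b by (simp add: powr_divide)
        ultimately show ?thesis using p2 by (simp add: G1_def const_G_def pow2p_def)
      qed
      finally have 4: "A * d powr p / c \<le> G1" .
      have "B * d powr (2 * p - 2) / c \<le> B * (B / b) powr ((2 * p - 2) / (2 - p)) / b"
        using AB 2 b bc by (intro frac_le mult_left_mono) auto
      also have "\<dots> = (B / b) powr 1 * (B / b) powr ((2 * p - 2) / (2 - p))" using AB b by simp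
      also have "\<dots> = (B / b) powr (1 + (2 * p - 2) / (2 - p))" by (simp only: powr_add)
      also have "1 + (2 * p - 2) / (2 - p) = p / (2 - p)" using p2 by (simp add: field_simps)
      also have "(B / b) powr (p / (2 - p)) = G2"
        using p2 AB b by (simp add: G2_def const_G_def pow2p_def powr_divide powr_minus_divide)
      finally have 5: "B * d powr (2 * p - 2) / c \<le> G2" .
      have "0 \<le> 2/p * d powr p" using p by simp
      thus ?thesis using qS 3 4 5 unfolding X_def add_divide_distrib by linarith
    qed
  qed
  have "X + (G1 + G2) \<le> calB p \<nu> \<rho> \<tau> \<eta> * error_terms p \<nu> L1 L2 b"
  proof -
    define BB where "BB = calB p \<nu> \<rho> \<tau> \<eta>"
    have BB: "const_G p * A * pow2p p B p + const_C p \<rho> \<tau> \<le> BB"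
      "const_G p * pow2p p B p + 2 / p * const_C p \<rho> \<tau> powr (p / 2) \<le> BB"
      "2 * const_D p \<le> BB" "const_E p \<nu> \<le> BB" "2 / p * const_E p \<nu> powr (p / 2) \<le> BB"
      unfolding BB_def calB_def A_def B_def by (intro Max_ge; simp)+
    \<comment> \<open>D is at least 1, so the single entry 2D of the maximum covers both
      coefficients D and 2/p D^(p/2).\<close>
    have D1: "1 \<le> const_D p" by (simp add: const_D_def)
    have "const_D p powr (p / 2) \<le> const_D p powr 1" using D1 p by (intro powr_mono) auto
    hence "2 / p * const_D p powr (p / 2) \<le> 2 * const_D p"
      using p D1 by (intro mult_mono) (auto simp: field_simps)
    hence D4: "2 / p * const_D p powr (p / 2) \<le> BB" using BB(3) by simp
    have D2: "const_D p \<le> BB" using BB(3) D1 by simp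
    define u1 where "u1 = pow2p p b (- 2)"
    define u2 where "u2 = L1\<^sup>2 * b powr (- 2)"
    define u3 where "u3 = pow2p p b (- p)"
    define u4 where "u4 = L1 powr p * b powr (- p)"
    define u5 where "u5 = L2 powr (2 / (2 - \<nu>)) * b powr (- 2 / (2 - \<nu>))"
    define u6 where "u6 = L2 powr (p / (2 - \<nu>)) * b powr (- p / (2 - \<nu>))"
    have u: "0 \<le> u1" "0 \<le> u2" "0 \<le> u3" "0 \<le> u4" "0 \<le> u5" "0 \<le> u6"
      by (auto simp: u1_def u2_def u3_def u4_def u5_def u6_def pow2p_def)
    have Nb: "N / b = const_C p \<rho> \<tau> * u1 + const_D p * u2 + const_E p \<nu> * u5"
      using noise_error(1)[OF p \<nu> L \<rho>0 \<tau> b] by (simp only: N_def u1_def u2_def u5_def)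
    have "(N / b) powr (p / 2) \<le> const_C p \<rho> \<tau> powr (p / 2) * u3 + const_D p powr (p / 2) * u4 + const_E p \<nu> powr (p / 2) * u6"
      using noise_error(2)[OF p \<nu> L \<rho>0 \<tau> b] by (simp only: N_def u3_def u4_def u6_def)
    hence "2 / p * (N / b) powr (p / 2) \<le> 2 / p * (const_C p \<rho> \<tau> powr (p / 2) * u3 + const_D p powr (p / 2) * u4 + const_E p \<nu> powr (p / 2) * u6)"
      using p by (intro mult_left_mono) auto
    also have "\<dots> = (2 / p * const_C p \<rho> \<tau> powr (p / 2)) * u3 + (2 / p * const_D p powr (p / 2)) * u4 + (2 / p * const_E p \<nu> powr (p / 2)) * u6"
      by (simp only: distrib_left mult.assoc)
    finally have "X + (G1 + G2) \<le> (const_G p * A * pow2p p B p + const_C p \<rho> \<tau>) * u1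
        + const_D p * u2 + (const_G p * pow2p p B p + 2 / p * const_C p \<rho> \<tau> powr (p / 2)) * u3
        + (2 / p * const_D p powr (p / 2)) * u4 + const_E p \<nu> * u5 + (2 / p * const_E p \<nu> powr (p / 2)) * u6"
      unfolding X_def Nb G1_def G2_def u1_def[symmetric] u3_def[symmetric] distrib_right by linarith
    also have "\<dots> \<le> BB * u1 + BB * u2 + BB * u3 + BB * u4 + BB * u5 + BB * u6"
      by (intro add_mono mult_right_mono BB D2 D4 u)
    also have "\<dots> = BB * error_terms p \<nu> L1 L2 b"
      unfolding error_terms_def u1_def u2_def u3_def u4_def u5_def u6_def by (simp only: distrib_left)
    finally show ?thesis by (simp add: BB_def)
  qed
  hence "2 / p * q powr (p/2) + q \<le> 2 / p * d powr p + d\<^sup>2 + calB p \<nu> \<rho> \<tau> \<eta> * error_terms p \<nu> L1 L2 b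
      - calA p \<rho> \<tau> \<eta> / c * (d powr (p - 1) + d)\<^sup>2"
    using main calA_le by linarith
  hence "\<rho> / 2 * (2 / p * q powr (p/2) + q) \<le> \<rho> / 2 * (2 / p * d powr p + d\<^sup>2 + calB p \<nu> \<rho> \<tau> \<eta> * error_terms p \<nu> L1 L2 b
      - calA p \<rho> \<tau> \<eta> / c * (d powr (p - 1) + d)\<^sup>2)"
    using \<rho>0 by (intro mult_left_mono) auto
  also have "\<rho> / 2 * (2 / p * q powr (p/2) + q) = \<rho> / p * q powr (p/2) + \<rho> / 2 * q" by (simp add: distrib_left)
  also have "\<rho> / 2 * (2 / p * d powr p + d\<^sup>2 + calB p \<nu> \<rho> \<tau> \<eta> * error_terms p \<nu> L1 L2 b
      - calA p \<rho> \<tau> \<eta> / c * (d powr (p - 1) + d)\<^sup>2)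
    = prox_kernel p \<rho> d + \<rho> / 2 * (calB p \<nu> \<rho> \<tau> \<eta> * error_terms p \<nu> L1 L2 b)
      - \<rho> / 2 * (calA p \<rho> \<tau> \<eta> / c * (d powr (p - 1) + d)\<^sup>2)"
    by (simp add: prox_kernel_def distrib_left right_diff_distrib)
  finally show ?thesis by (simp add: c_def)
qed

section \<open>One step of the method\<close>

locale one_sided_model =
  fixes f \<phi> F :: "'a::euclidean_space \<Rightarrow> ereal" and U :: "'a set" and fm :: "'a \<Rightarrow> 'a \<Rightarrow> 'w \<Rightarrow> real"
    and \<pi> :: "'w measure" and p \<nu> \<tau> \<eta> L1 L2 \<rho> :: real
  assumes proper_\<phi>: "proper \<phi>" and lsc_\<phi>: "lower_semicontinuous \<phi>"
    and proper_f: "proper f" and lsc_f: "lower_semicontinuous f"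
    and F: "F = (\<lambda>y. f y + \<phi> y)"
    and min_exists: "\<exists>z. is_arg_min F (\<lambda>_. True) z"
    and model: "stochastic_one_sided_model \<pi> f \<phi> U fm p \<nu> \<tau> \<eta> L1 L2"
    and rho: "\<rho> > 2 * (2 * \<tau> + \<eta>)"
begin

abbreviation "fr y \<equiv> real_of_ereal (f y)"
abbreviation "\<phi>r y \<equiv> real_of_ereal (\<phi> y)"
abbreviation "D \<equiv> dom_e \<phi>"

lemma model_facts:
  shows prob: "prob_space \<pi>" and p: "1 < p" "p \<le> 2" and \<nu>: "0 < \<nu>" "\<nu> \<le> 1" and \<tau>: "0 < \<tau>" and \<eta>: "0 < \<eta>"
    and L: "0 < L1" "0 < L2" and U: "open U" "D \<subseteq> U" and f_fin: "\<And>y. y \<in> U \<Longrightarrow> \<bar>f y\<bar> \<noteq> \<infinity>"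
    and fm_meas: "(\<lambda>(x, y, s). fm x y s) \<in> borel_measurable (restrict_space borel U \<Otimes>\<^sub>M (restrict_space borel U \<Otimes>\<^sub>M \<pi>))"
    and fm_diag: "\<And>x. x \<in> U \<Longrightarrow> ereal (\<integral>s. fm x x s \<partial>\<pi>) = f x"
    and fm_int: "\<And>x y. x \<in> U \<Longrightarrow> y \<in> U \<Longrightarrow> integrable \<pi> (fm x y)"
    and fm_le: "\<And>x y. x \<in> U \<Longrightarrow> y \<in> U \<Longrightarrow> (\<integral>s. fm x y s - fr y \<partial>\<pi>) \<le> \<tau> / p * norm (x - y) powr p"
    and fm_wc: "\<And>x. x \<in> U \<Longrightarrow> AE s in \<pi>. weakly_convex \<eta> (\<lambda>y. ereal (fm x y s) + \<phi> y)"
proof -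
  note m = model[unfolded stochastic_one_sided_model_def]
  show "prob_space \<pi>" "1 < p" "p \<le> 2" "0 < \<nu>" "\<nu> \<le> 1" "0 < \<tau>" "0 < \<eta>" "0 < L1" "0 < L2" "open U" "D \<subseteq> U"
    "(\<lambda>(x, y, s). fm x y s) \<in> borel_measurable (restrict_space borel U \<Otimes>\<^sub>M (restrict_space borel U \<Otimes>\<^sub>M \<pi>))"
    by (insert m, (elim conjE, assumption)+)
  from m have f: "\<forall>x\<in>U. \<bar>f x\<bar> \<noteq> \<infinity>" by (elim conjE)
  from m have diag: "\<forall>x\<in>U. integrable \<pi> (fm x x) \<and> ereal (\<integral>s. fm x x s \<partial>\<pi>) = f x" by (elim conjE)
  from m have le: "\<forall>x\<in>U. \<forall>y\<in>U. integrable \<pi> (fm x y) \<and>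
        (\<integral>s. fm x y s - fr y \<partial>\<pi>) \<le> \<tau> / p * norm (x - y) powr p" by (elim conjE)
  from m have wc: "\<forall>x\<in>U. AE s in \<pi>. weakly_convex \<eta> (\<lambda>y. ereal (fm x y s) + \<phi> y)" by (elim conjE)
  show "\<bar>f y\<bar> \<noteq> \<infinity>" if "y \<in> U" for y using f that by (rule bspec)
  show "ereal (\<integral>s. fm x x s \<partial>\<pi>) = f x" if "x \<in> U" for x using bspec[OF diag that] by (rule conjunct2)
  show "AE s in \<pi>. weakly_convex \<eta> (\<lambda>y. ereal (fm x y s) + \<phi> y)" if "x \<in> U" for x
    using wc that by (rule bspec)
  fix x y assume xy: "x \<in> U" "y \<in> U"
  note xy' = bspec[OF bspec[OF le xy(1)] xy(2)]
  show "integrable \<pi> (fm x y)" using xy' by (rule conjunct1)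
  show "(\<integral>s. fm x y s - fr y \<partial>\<pi>) \<le> \<tau> / p * norm (x - y) powr p" using xy' by (rule conjunct2)
qed

lemma \<rho>: "0 < \<rho>"
proof -
  have "0 < 2 * (2 * \<tau> + \<eta>)" using \<tau> \<eta> by simp
  thus ?thesis using rho by (rule less_trans)
qed

lemma \<phi>_fin: "\<phi> y \<noteq> -\<infinity>" and f_fin': "f y \<noteq> -\<infinity>"
  using proper_\<phi> proper_f by (auto simp: proper_def)

lemma F_dom:
  assumes "y \<in> D"
  shows "F y = ereal (fr y + \<phi>r y)"
proof -
  have "\<bar>f y\<bar> \<noteq> \<infinity>" using assms U(2) by (intro f_fin) auto
  thus ?thesis
    using assms \<phi>_fin[of y] unfolding F by (cases "\<phi> y"; cases "f y") (auto simp: dom_e_def)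
qed

lemma dom_F: "dom_e F = D"
proof (intro set_eqI iffI)
  fix y assume "y \<in> dom_e F"
  thus "y \<in> D" using f_fin'[of y] by (cases "\<phi> y"; cases "f y") (auto simp: F dom_e_def)
next
  fix y assume "y \<in> D"
  thus "y \<in> dom_e F" using F_dom[of y] by (simp add: dom_e_def)
qed

text \<open>The infimum is attained in the domain and thus finite, so \<open>m\<close> may be a real
  number.\<close>

lemma INF_F: "ereal (real_of_ereal (INF y. F y)) = (INF y. F y)"
proof -
  obtain z where z: "\<And>y. F z \<le> F y" using min_exists by (auto simp: is_arg_min_def not_less)
  have "(INF y. F y) = F z" by (rule antisym) (auto intro: INF_lower INF_greatest z)
  moreover obtain y where "y \<in> D" using proper_\<phi> by (auto simp: proper_def)
  hence "F z < \<infinity>" using z[of y] F_dom[of y] by auto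
  hence "z \<in> D" using dom_F by (auto simp: dom_e_def)
  ultimately show ?thesis using F_dom by simp
qed

definition "m = real_of_ereal (INF y. F y)"

sublocale envelope F m p \<rho>
proof
  show "lower_semicontinuous F"
    unfolding F by (rule lower_semicontinuous_add[OF lsc_f lsc_\<phi> f_fin' \<phi>_fin])
  show "ereal m \<le> F y" for y unfolding m_def INF_F by (rule INF_lower) simp
  show "dom_e F \<noteq> {}" using dom_F proper_\<phi> by (simp add: proper_def)
qed (rule p \<rho>)+

lemma f_real: "y \<in> U \<Longrightarrow> f y = ereal (fr y)"
  using f_fin[of y] by (cases "f y") auto

lemma fm_diag_real: "x \<in> U \<Longrightarrow> (\<integral>s. fm x x s \<partial>\<pi>) = fr x"
  using fm_diag[of x] f_real[of x] by (metis ereal.inject)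

text \<open>\<open>F\<close> may jump inside its domain, so density in the domain would not control
  values. A countable dense subset of the graph, taken in \<open>'a \<times> real\<close>, controls
  point and value at once.\<close>

lemma dense_sequence:
  "\<exists>Q. countable Q \<and> Q \<subseteq> D \<and> (\<forall>y\<in>D. \<exists>q. (\<forall>n. q n \<in> Q) \<and> q \<longlonglongrightarrow> y \<and>
     (\<lambda>n. fr (q n) + \<phi>r (q n)) \<longlonglongrightarrow> fr y + \<phi>r y)"
proof -
  define G where "G = (\<lambda>y. (y, fr y + \<phi>r y)) ` D"
  obtain T where T: "countable T" "T \<subseteq> G" "G \<subseteq> closure T" using separable by blast
  show ?thesis
  proof (intro exI[of _ "fst ` T"] conjI ballI)
    show "countable (fst ` T)" using T by simp
    show "fst ` T \<subseteq> D" using T(2) by (auto simp: G_def)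
    fix y assume "y \<in> D"
    hence "(y, fr y + \<phi>r y) \<in> closure T" using T(3) by (auto simp: G_def)
    then obtain t where t: "\<And>n. t n \<in> T" "t \<longlonglongrightarrow> (y, fr y + \<phi>r y)"
      unfolding closure_sequential by blast
    have "snd (t n) = fr (fst (t n)) + \<phi>r (fst (t n))" for n
      using t(1)[of n] T(2) by (auto simp: G_def)
    thus "\<exists>q. (\<forall>n. q n \<in> fst ` T) \<and> q \<longlonglongrightarrow> y \<and> (\<lambda>n. fr (q n) + \<phi>r (q n)) \<longlonglongrightarrow> fr y + \<phi>r y"
      using t(1) tendsto_fst[OF t(2)] tendsto_snd[OF t(2)]
      by (intro exI[of _ "\<lambda>n. fst (t n)"]) auto
  qed
qed

end

section \<open>Moments of the moduli and the conditional step estimate\<close>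

locale one_sided_model_moduli = one_sided_model +
  fixes l1 l2 :: "'b \<Rightarrow> real"
  assumes l_meas [measurable]: "l1 \<in> borel_measurable \<pi>" "l2 \<in> borel_measurable \<pi>"
    and l_nonneg: "\<And>s. s \<in> space \<pi> \<Longrightarrow> 0 \<le> l1 s" "\<And>s. s \<in> space \<pi> \<Longrightarrow> 0 \<le> l2 s"
    and l1_int: "integrable \<pi> (\<lambda>s. (l1 s)\<^sup>2)" "sqrt (\<integral>s. (l1 s)\<^sup>2 \<partial>\<pi>) \<le> L1"
    and l2_int: "integrable \<pi> (\<lambda>s. l2 s powr (\<nu> + 1))" "(\<integral>s. l2 s powr (\<nu> + 1) \<partial>\<pi>) powr (1 / (\<nu> + 1)) \<le> L2"
    and l_le: "\<And>x y. x \<in> U \<Longrightarrow> y \<in> U \<Longrightarrow>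
      AE s in \<pi>. fm x x s - fm x y s \<le> l1 s * norm (x - y) + l2 s * norm (x - y) powr \<nu>"
begin

sublocale prob_space \<pi> by (rule prob)

lemma l1_sq_le: "expectation (\<lambda>s. (l1 s)\<^sup>2) \<le> L1\<^sup>2"
  using l1_int(2) by (rule sqrt_le_D)

lemma l2_powr_le: "expectation (\<lambda>s. l2 s powr (\<nu> + 1)) \<le> L2 powr (\<nu> + 1)"
proof -
  have 0: "0 \<le> expectation (\<lambda>s. l2 s powr (\<nu> + 1))" by (rule integral_nonneg_AE) simp
  have "((expectation (\<lambda>s. l2 s powr (\<nu> + 1))) powr (1 / (\<nu> + 1))) powr (\<nu> + 1) \<le> L2 powr (\<nu> + 1)"
    using l2_int(2) \<nu> by (intro powr_mono2) auto
  thus ?thesis using 0 \<nu> by (simp add: powr_powr)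
qed

text \<open>Jensen with exponent 1/2 turns the bound on the second moment into the same bound on the
  mean.\<close>

lemma l1_mean: "integrable \<pi> l1" "expectation l1 \<le> L1"
proof -
  have eq: "((l1 s)\<^sup>2) powr (1/2) = l1 s" if "s \<in> space \<pi>" for s
    using l_nonneg(1)[OF that] by (simp add: powr_half_sqrt)
  have "integrable \<pi> (\<lambda>s. ((l1 s)\<^sup>2) powr (1/2))" "expectation (\<lambda>s. ((l1 s)\<^sup>2) powr (1/2)) \<le> (L1\<^sup>2) powr (1/2)"
    using l1_int(1) l1_sq_le by (intro powr_moment_le; simp)+
  moreover have "(L1\<^sup>2) powr (1/2) = L1" using L by (simp add: powr_half_sqrt)
  moreover have "integrable \<pi> (\<lambda>s. ((l1 s)\<^sup>2) powr (1/2)) \<longleftrightarrow> integrable \<pi> l1"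
    by (intro Bochner_Integration.integrable_cong eq refl)
  moreover have "expectation (\<lambda>s. ((l1 s)\<^sup>2) powr (1/2)) = expectation l1"
    by (intro Bochner_Integration.integral_cong eq refl)
  ultimately show "integrable \<pi> l1" "expectation l1 \<le> L1" by auto
qed

lemma l2_mean: "integrable \<pi> l2" "expectation l2 \<le> L2"
proof -
  have eq: "(l2 s powr (\<nu> + 1)) powr (1 / (\<nu> + 1)) = l2 s" if "s \<in> space \<pi>" for s
    using l_nonneg(2)[OF that] \<nu> by (simp add: powr_powr)
  have "integrable \<pi> (\<lambda>s. (l2 s powr (\<nu> + 1)) powr (1 / (\<nu> + 1)))"
    "expectation (\<lambda>s. (l2 s powr (\<nu> + 1)) powr (1 / (\<nu> + 1))) \<le> (L2 powr (\<nu> + 1)) powr (1 / (\<nu> + 1))"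
    using powr_moment_le[OF l2_int(1) _ l2_powr_le, of "1 / (\<nu> + 1)"] \<nu> by auto
  moreover have "(L2 powr (\<nu> + 1)) powr (1 / (\<nu> + 1)) = L2" using L \<nu> by (simp add: powr_powr)
  moreover have "integrable \<pi> (\<lambda>s. (l2 s powr (\<nu> + 1)) powr (1 / (\<nu> + 1))) \<longleftrightarrow> integrable \<pi> l2"
    by (intro Bochner_Integration.integrable_cong eq refl)
  moreover have "expectation (\<lambda>s. (l2 s powr (\<nu> + 1)) powr (1 / (\<nu> + 1))) = expectation l2"
    by (intro Bochner_Integration.integral_cong eq refl)
  ultimately show "integrable \<pi> l2" "expectation l2 \<le> L2" by auto
qed

text \<open>Origin of D: the factor 4 times the number of shares in Young's inequality gives 12, or
  8 for p = 2.\<close>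

lemma add_l1_sq: "integrable \<pi> (\<lambda>s. (L1 + l1 s)\<^sup>2)" "expectation (\<lambda>s. (L1 + l1 s)\<^sup>2) \<le> 4 * L1\<^sup>2"
proof -
  have eq: "(\<lambda>s. (L1 + l1 s)\<^sup>2) = (\<lambda>s. L1\<^sup>2 + 2 * L1 * l1 s + (l1 s)\<^sup>2)"
    by (simp add: power2_sum fun_eq_iff)
  show "integrable \<pi> (\<lambda>s. (L1 + l1 s)\<^sup>2)"
    unfolding eq using l1_mean(1) l1_int(1) by (intro Bochner_Integration.integrable_add Bochner_Integration.integrable_mult_right integrable_const) auto
  have "expectation (\<lambda>s. L1\<^sup>2 + 2 * L1 * l1 s + (l1 s)\<^sup>2) = L1\<^sup>2 + 2 * L1 * expectation l1 + expectation (\<lambda>s. (l1 s)\<^sup>2)"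
    using l1_mean(1) l1_int(1) by (simp add: prob_space)
  also have "\<dots> \<le> L1\<^sup>2 + 2 * L1 * L1 + L1\<^sup>2"
    using l1_mean(2) l1_sq_le L by (intro add_mono mult_left_mono) auto
  also have "\<dots> = 4 * L1\<^sup>2" by (simp add: power2_eq_square)
  finally show "expectation (\<lambda>s. (L1 + l1 s)\<^sup>2) \<le> 4 * L1\<^sup>2" unfolding eq .
qed

text \<open>The moment of order \<nu> + 1 suffices because (2 - \<nu>)(\<nu> + 1) \<ge> 2, that is,
  2/(2 - \<nu>) \<le> \<nu> + 1. Convexity handles the shift by L2 in the higher moment before
  Jensen lowers the exponent; the doubled L2 is the power of 2 in E.\<close>

lemma add_l2_powr:
  "integrable \<pi> (\<lambda>s. (L2 + l2 s) powr (2 / (2 - \<nu>)))"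
  "expectation (\<lambda>s. (L2 + l2 s) powr (2 / (2 - \<nu>))) \<le> (2 * L2) powr (2 / (2 - \<nu>))"
proof -
  define u where "u s = (L2 + l2 s) powr (\<nu> + 1)" for s
  have [measurable]: "u \<in> borel_measurable \<pi>" unfolding u_def by measurable
  have le: "u s \<le> 2 powr \<nu> * (L2 powr (\<nu> + 1) + l2 s powr (\<nu> + 1))" if "s \<in> space \<pi>" for s
    using powr_add_le_convex[of L2 "l2 s" "\<nu> + 1"] l_nonneg(2)[OF that] L \<nu> by (simp add: u_def)
  have int: "integrable \<pi> (\<lambda>s. 2 powr \<nu> * (L2 powr (\<nu> + 1) + l2 s powr (\<nu> + 1)))"
    using l2_int(1) by (intro Bochner_Integration.integrable_mult_right Bochner_Integration.integrable_add integrable_const) auto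
  have u_int: "integrable \<pi> u"
    by (rule Bochner_Integration.integrable_bound[OF int]) (use le in \<open>auto simp: u_def\<close>)
  have "expectation u \<le> expectation (\<lambda>s. 2 powr \<nu> * (L2 powr (\<nu> + 1) + l2 s powr (\<nu> + 1)))"
    by (intro Bochner_Integration.integral_mono u_int int le)
  also have "\<dots> = 2 powr \<nu> * (L2 powr (\<nu> + 1) + expectation (\<lambda>s. l2 s powr (\<nu> + 1)))"
    using l2_int(1) by (simp add: prob_space)
  also have "\<dots> \<le> 2 powr \<nu> * (L2 powr (\<nu> + 1) + L2 powr (\<nu> + 1))"
    using l2_powr_le by (intro mult_left_mono add_left_mono) auto
  also have "\<dots> = (2 * L2) powr (\<nu> + 1)" using L by (simp add: powr_mult powr_add)
  finally have u_le: "expectation u \<le> (2 * L2) powr (\<nu> + 1)" .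
  define \<theta> where "\<theta> = 2 / (2 - \<nu>) / (\<nu> + 1)"
  have mul: "(\<nu> + 1) * \<theta> = 2 / (2 - \<nu>)" using \<nu> by (simp add: \<theta>_def divide_simps)
  have "\<nu> * \<nu> \<le> \<nu> * 1" using \<nu> by (intro mult_left_mono) auto
  hence "2 \<le> (2 - \<nu>) * (\<nu> + 1)" by (simp add: algebra_simps)
  hence \<theta>: "0 < \<theta>" "\<theta> \<le> 1" using \<nu> by (auto simp: \<theta>_def divide_simps)
  have "AE s in \<pi>. 0 \<le> u s" by (simp add: u_def)
  from powr_moment_le[OF u_int this u_le \<theta>]
  have "integrable \<pi> (\<lambda>s. u s powr \<theta>)" "expectation (\<lambda>s. u s powr \<theta>) \<le> ((2 * L2) powr (\<nu> + 1)) powr \<theta>" .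
  thus "integrable \<pi> (\<lambda>s. (L2 + l2 s) powr (2 / (2 - \<nu>)))"
    "expectation (\<lambda>s. (L2 + l2 s) powr (2 / (2 - \<nu>))) \<le> (2 * L2) powr (2 / (2 - \<nu>))"
    unfolding u_def powr_powr mul .
qed

text \<open>The modulus inequality is integrated: the mean of the model centred at u is exactly f u
  at u, and exceeds f v at v by at most the one-sided error.\<close>

lemma f_diff_le:
  assumes "u \<in> U" "v \<in> U"
  shows "fr u - fr v \<le> L1 * norm (u - v) + L2 * norm (u - v) powr \<nu> + \<tau> / p * norm (u - v) powr p"
proof -
  have "expectation (\<lambda>s. fm u u s - fm u v s) \<le> expectation (\<lambda>s. l1 s * norm (u - v) + l2 s * norm (u - v) powr \<nu>)"
    using l_le[OF assms] fm_int assms l1_mean(1) l2_mean(1)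
    by (intro integral_mono_AE Bochner_Integration.integrable_diff Bochner_Integration.integrable_add Bochner_Integration.integrable_mult_left) auto
  also have "expectation (\<lambda>s. fm u u s - fm u v s) = fr u - expectation (fm u v)"
    using fm_int assms by (simp add: fm_diag_real)
  also have "expectation (\<lambda>s. l1 s * norm (u - v) + l2 s * norm (u - v) powr \<nu>)
      = expectation l1 * norm (u - v) + expectation l2 * norm (u - v) powr \<nu>"
    using l1_mean(1) l2_mean(1) by simp
  also have "\<dots> \<le> L1 * norm (u - v) + L2 * norm (u - v) powr \<nu>"
    using l1_mean(2) l2_mean(2) by (intro add_mono mult_right_mono) auto
  finally have "fr u - expectation (fm u v) \<le> L1 * norm (u - v) + L2 * norm (u - v) powr \<nu>" .
  moreover have "expectation (fm u v) - fr v \<le> \<tau> / p * norm (u - v) powr p"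
    using fm_le[OF assms] fm_int[OF assms] by (simp add: prob_space)
  ultimately show ?thesis by linarith
qed

text \<open>The next iterate depends on the draw, so one null set must serve all \<open>y\<close>. A
  countable dense set of points has a common null set, and \<open>lower_bound_from_dense\<close>
  extends the inequality to the whole domain for each remaining draw.\<close>

lemma model_lower_bound:
  assumes x: "x \<in> U"
  shows "AE s in \<pi>. \<forall>y\<in>D. fm x x s - l1 s * norm (x - y) - l2 s * norm (x - y) powr \<nu> \<le> fm x y s"
proof -
  obtain Q where Q: "countable Q" "Q \<subseteq> D" "D \<subseteq> closure Q" using separable by blast
  have "AE s in \<pi>. \<forall>y\<in>Q. fm x x s - fm x y s \<le> l1 s * norm (x - y) + l2 s * norm (x - y) powr \<nu>"
    using Q U x by (subst AE_ball_countable) (auto intro!: l_le)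
  thus ?thesis using fm_wc[OF x]
  proof eventually_elim
    case (elim s)
    interpret weakly_convex_sum "\<lambda>y. fm x y s" \<phi> \<eta>
      by unfold_locales (use elim(2) \<phi>_fin in auto)
    show ?case
    proof
      fix y assume "y \<in> D"
      thus "fm x x s - l1 s * norm (x - y) - l2 s * norm (x - y) powr \<nu> \<le> fm x y s"
      proof (rule lower_bound_from_dense[OF lsc_\<phi> Q(2,3), rotated 2])
        show "continuous_on UNIV (\<lambda>y. fm x x s - l1 s * norm (x - y) - l2 s * norm (x - y) powr \<nu>)"
          using \<nu> by (intro continuous_intros continuous_on_powr') auto
      qed (use elim(1) in \<open>auto simp: algebra_simps\<close>)
    qed
  qed
qed

text \<open>Everything on the left of the growth inequality that depends on \<open>Y s\<close> is
  bounded below by \<open>envr x\<close> and absorbed terms. The right side has only the fixed point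
  \<open>y\<close>, so its expectation is controlled by the accuracy of the model.\<close>

lemma expected_sq_dist:
  assumes x: "x \<in> D" and Y [measurable]: "Y \<in> borel_measurable \<pi>" and YD: "AE s in \<pi>. Y s \<in> D" and y: "y \<in> D"
    and b: "0 < b" and \<beta>: "\<beta> = b + rho_tilde p \<rho> \<tau>" "\<eta> < \<beta>"
    and growth: "AE s in \<pi>. fm x (Y s) s + \<phi>r (Y s) + \<beta> / 2 * (norm (Y s - x))\<^sup>2 + (\<beta> - \<eta>) / 2 * (norm (y - Y s))\<^sup>2
      \<le> fm x y s + \<phi>r y + \<beta> / 2 * (norm (y - x))\<^sup>2"
  shows "integrable \<pi> (\<lambda>s. (norm (y - Y s))\<^sup>2)"
    and "expectation (\<lambda>s. (norm (y - Y s))\<^sup>2) \<le> (2 * (fr y + \<phi>r y + \<tau> / p * norm (x - y) powr p - envr x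
      + \<beta> / 2 * (norm (y - x))\<^sup>2) + noise p \<nu> \<rho> \<tau> L1 L2 b) / (\<beta> - \<eta>)"
proof -
  have xU: "x \<in> U" "y \<in> U" using x y U by auto
  define \<kappa> where "\<kappa> = num_terms p"
  define k1 where "k1 = \<kappa> / (2 * b)"
  define k2 where "k2 = (2 - \<nu>) / 2 * (\<kappa> * \<nu> / b) powr (\<nu> / (2 - \<nu>))"
  define C where "C = const_C p \<rho> \<tau> / 2 * pow2p p b (- p)"
  have k: "0 \<le> k1" "0 \<le> k2" using b \<nu> by (auto simp: k1_def k2_def \<kappa>_def num_terms_def)
  \<comment> \<open>Young's remainder for the moduli L1 + l1 and L2 + l2: the deterministic parts
    compare \<open>f\<close> at \<open>Y s\<close> and \<open>x\<close>, the random parts compare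
    the model at the same points.\<close>
  define R where "R s = C + k1 * (L1 + l1 s)\<^sup>2 + k2 * (L2 + l2 s) powr (2 / (2 - \<nu>))" for s
  have R_int: "integrable \<pi> R"
    unfolding R_def using add_l1_sq(1) add_l2_powr(1) by (intro Bochner_Integration.integrable_add Bochner_Integration.integrable_mult_right integrable_const)
  have R_le: "expectation R \<le> noise p \<nu> \<rho> \<tau> L1 L2 b / 2"
  proof -
    have "expectation R = C + k1 * expectation (\<lambda>s. (L1 + l1 s)\<^sup>2) + k2 * expectation (\<lambda>s. (L2 + l2 s) powr (2 / (2 - \<nu>)))"
      unfolding R_def using add_l1_sq(1) add_l2_powr(1) by (simp add: prob_space)
    also have "\<dots> \<le> C + k1 * (4 * L1\<^sup>2) + k2 * (2 * L2) powr (2 / (2 - \<nu>))"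
      using add_l1_sq(2) add_l2_powr(2) k by (intro add_mono mult_left_mono) auto
    also have "k1 * (4 * L1\<^sup>2) = const_D p * L1\<^sup>2 / b / 2"
      by (simp add: k1_def \<kappa>_def num_terms_def const_D_def)
    also have "k2 * (2 * L2) powr (2 / (2 - \<nu>)) = const_E p \<nu> * L2 powr (2 / (2 - \<nu>)) * b powr (- \<nu> / (2 - \<nu>)) / 2"
      using b \<nu> by (simp add: k2_def \<kappa>_def num_terms_def const_E_def powr_mult powr_divide powr_minus_divide mult_ac)
    finally show ?thesis by (simp add: C_def noise_def add_divide_distrib)
  qed
  \<comment> \<open>The summand \<open>fr x\<close> cancels in expectation against the mean of the
    model on the diagonal.\<close>
  define K where "K = \<phi>r y + \<beta> / 2 * (norm (y - x))\<^sup>2 - envr x + fr x"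
  define V where "V s = K + (fm x y s - fm x x s) + R s" for s
  have V_int: "integrable \<pi> V"
    unfolding V_def using R_int fm_int xU by (intro Bochner_Integration.integrable_add Bochner_Integration.integrable_diff integrable_const) auto
  have V_ge: "AE s in \<pi>. (\<beta> - \<eta>) / 2 * (norm (y - Y s))\<^sup>2 \<le> V s"
    using growth YD model_lower_bound[OF xU(1)] AE_space
  proof eventually_elim
    case (elim s)
    define d where "d = norm (x - Y s)"
    have YU: "Y s \<in> U" using elim(2) U by auto
    have 1: "fm x x s - l1 s * d - l2 s * d powr \<nu> \<le> fm x (Y s) s" using elim by (simp add: d_def)
    \<comment> \<open>\<open>Y s\<close> is a competitor in the envelope at \<open>x\<close>; this
      is the lower bound for \<open>\<phi>\<close> at \<open>Y s\<close>.\<close>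
    have 2: "envr x \<le> fr (Y s) + \<phi>r (Y s) + prox_kernel p \<rho> d"
      unfolding d_def by (rule envr_le[OF F_dom[OF elim(2)]])
    have 3: "fr (Y s) - fr x \<le> L1 * d + L2 * d powr \<nu> + \<tau> / p * d powr p"
      using f_diff_le[OF YU xU(1)] by (simp add: d_def norm_minus_commute)
    have 4: "(\<rho> + \<tau>) / p * d powr p + \<rho> / 2 * d\<^sup>2 + (L1 + l1 s) * d + (L2 + l2 s) * d powr \<nu> - \<beta> / 2 * d\<^sup>2
        \<le> C + k1 * (L1 + l1 s)\<^sup>2 + (2 - \<nu>) / 2 * (L2 + l2 s) powr (2 / (2 - \<nu>)) * (\<kappa> * \<nu> / b) powr (\<nu> / (2 - \<nu>))"
      unfolding C_def k1_def \<kappa>_def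
      by (rule young_noise[OF p \<nu> \<rho> \<tau> b]) (use L l_nonneg elim(4) \<beta> in \<open>auto simp: d_def\<close>)
    have 5: "(2 - \<nu>) / 2 * (L2 + l2 s) powr (2 / (2 - \<nu>)) * (\<kappa> * \<nu> / b) powr (\<nu> / (2 - \<nu>)) = k2 * (L2 + l2 s) powr (2 / (2 - \<nu>))"
      by (simp add: k2_def mult_ac)
    have 6: "prox_kernel p \<rho> d + \<tau> / p * d powr p = (\<rho> + \<tau>) / p * d powr p + \<rho> / 2 * d\<^sup>2"
      by (simp add: prox_kernel_def add_divide_distrib distrib_right)
    have "norm (Y s - x) = d" by (simp add: d_def norm_minus_commute)
    with elim(1) have 7: "fm x (Y s) s + \<phi>r (Y s) + \<beta> / 2 * d\<^sup>2 + (\<beta> - \<eta>) / 2 * (norm (y - Y s))\<^sup>2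
      \<le> fm x y s + \<phi>r y + \<beta> / 2 * (norm (y - x))\<^sup>2" by simp
    show ?case
      using 1 2 3 4 6 7 unfolding 5 V_def K_def R_def distrib_right[of L1 "l1 s"] distrib_right[of L2 "l2 s"] by linarith
  qed
  have "expectation (\<lambda>s. fm x y s - fm x x s) \<le> fr y + \<tau> / p * norm (x - y) powr p - fr x"
    using fm_le[OF xU] fm_int xU by (simp add: prob_space fm_diag_real)
  moreover have "expectation V = K + expectation (\<lambda>s. fm x y s - fm x x s) + expectation R"
    unfolding V_def using R_int fm_int xU by (simp add: prob_space)
  ultimately have V_le: "expectation V \<le> K + (fr y + \<tau> / p * norm (x - y) powr p - fr x) + noise p \<nu> \<rho> \<tau> L1 L2 b / 2"
    using R_le by linarith
  have c: "0 < \<beta> - \<eta>" using \<beta> by simp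
  have le: "AE s in \<pi>. (norm (y - Y s))\<^sup>2 \<le> 2 / (\<beta> - \<eta>) * V s"
    using V_ge by eventually_elim (use c in \<open>simp add: field_simps\<close>)
  have int2: "integrable \<pi> (\<lambda>s. 2 / (\<beta> - \<eta>) * V s)" using V_int by simp
  show int: "integrable \<pi> (\<lambda>s. (norm (y - Y s))\<^sup>2)"
  proof (rule Bochner_Integration.integrable_bound[OF int2])
    have norm_le: "norm a \<le> norm a'" if "0 \<le> a" "a \<le> a'" for a a' :: real using that by simp
    show "AE s in \<pi>. norm ((norm (y - Y s))\<^sup>2) \<le> norm (2 / (\<beta> - \<eta>) * V s)"
      using le by eventually_elim (rule norm_le, simp_all only: zero_le_power2)
  qed simp
  have "expectation (\<lambda>s. (norm (y - Y s))\<^sup>2) \<le> expectation (\<lambda>s. 2 / (\<beta> - \<eta>) * V s)"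
    by (rule integral_mono_AE[OF int int2 le])
  also have "\<dots> = 2 / (\<beta> - \<eta>) * expectation V" by simp
  also have "\<dots> \<le> 2 / (\<beta> - \<eta>) * (K + (fr y + \<tau> / p * norm (x - y) powr p - fr x) + noise p \<nu> \<rho> \<tau> L1 L2 b / 2)"
    using V_le c by (intro mult_left_mono) auto
  also have "\<dots> = (2 * (fr y + \<phi>r y + \<tau> / p * norm (x - y) powr p - envr x
      + \<beta> / 2 * (norm (y - x))\<^sup>2) + noise p \<nu> \<rho> \<tau> L1 L2 b) / (\<beta> - \<eta>)"
  proof -
    have "2 / c * (a + N / 2) = (2 * a + N) / c" for a c N :: real
      by (simp add: distrib_left add_divide_distrib)
    moreover have "K + (fr y + \<tau> / p * norm (x - y) powr p - fr x)
        = fr y + \<phi>r y + \<tau> / p * norm (x - y) powr p - envr x + \<beta> / 2 * (norm (y - x))\<^sup>2"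
      by (simp add: K_def)
    ultimately show ?thesis by simp
  qed
  finally show "expectation (\<lambda>s. (norm (y - Y s))\<^sup>2) \<le> (2 * (fr y + \<phi>r y + \<tau> / p * norm (x - y) powr p - envr x
      + \<beta> / 2 * (norm (y - x))\<^sup>2) + noise p \<nu> \<rho> \<tau> L1 L2 b) / (\<beta> - \<eta>)" .
qed

text \<open>Growth is known only against points of \<open>Q\<close>, each with its own null set. The
  passage to a proximal point is made after integration, along points of \<open>Q\<close> that
  converge together with their values of \<open>F\<close>.\<close>

lemma one_step:
  assumes x: "x \<in> D" and Y [measurable]: "Y \<in> borel_measurable \<pi>" and YD: "AE s in \<pi>. Y s \<in> D"
    and b: "0 < b" and \<beta>: "\<beta> = b + rho_tilde p \<rho> \<tau>" "\<eta> < \<beta>"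
    and Q: "Q \<subseteq> D" "\<And>y. y \<in> D \<Longrightarrow> \<exists>q. (\<forall>n. q n \<in> Q) \<and> q \<longlonglongrightarrow> y \<and> (\<lambda>n. fr (q n) + \<phi>r (q n)) \<longlonglongrightarrow> fr y + \<phi>r y"
    and growth: "\<And>y. y \<in> Q \<Longrightarrow>
      AE s in \<pi>. fm x (Y s) s + \<phi>r (Y s) + \<beta> / 2 * (norm (Y s - x))\<^sup>2 + (\<beta> - \<eta>) / 2 * (norm (y - Y s))\<^sup>2
        \<le> fm x y s + \<phi>r y + \<beta> / 2 * (norm (y - x))\<^sup>2"
  shows "integrable \<pi> (\<lambda>s. envr (Y s))"
    and "\<exists>v\<in>limiting_subdiff env x. expectation (\<lambda>s. envr (Y s)) + calA p \<rho> \<tau> \<eta> / (\<beta> - \<eta>) * (norm v)\<^sup>2 / (2 * \<rho>)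
      \<le> envr x + \<rho> / 2 * (calB p \<nu> \<rho> \<tau> \<eta> * error_terms p \<nu> L1 L2 b)"
proof -
  define N where "N = noise p \<nu> \<rho> \<tau> L1 L2 b"
  \<comment> \<open>The value of \<open>F\<close> is a separate argument: the bound is continuous in
    value and point jointly, though not in the point alone.\<close>
  define qq where "qq t y = (2 * (t + \<tau> / p * norm (x - y) powr p - envr x + \<beta> / 2 * (norm (y - x))\<^sup>2) + N) / (\<beta> - \<eta>)" for t y
  have c: "0 < \<beta> - \<eta>" using \<beta> by simp
  have [measurable]: "(\<lambda>s. envr (Y s)) \<in> borel_measurable \<pi>" by measurable
  have step: "0 \<le> qq (fr y + \<phi>r y) y \<and> integrable \<pi> (\<lambda>s. envr (Y s)) \<and>
      expectation (\<lambda>s. envr (Y s)) \<le> fr y + \<phi>r y + \<rho> / p * qq (fr y + \<phi>r y) y powr (p/2) + \<rho> / 2 * qq (fr y + \<phi>r y) y"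
    if yQ: "y \<in> Q" for y
  proof -
    have y: "y \<in> D" using yQ Q by auto
    note sq = expected_sq_dist[OF x Y YD y b \<beta> growth[OF yQ], folded N_def, folded qq_def]
    have q0: "0 \<le> qq (fr y + \<phi>r y) y"
      using sq(2) by (rule order_trans[rotated]) (rule integral_nonneg_AE, simp)
    have pw: "((norm (y - Y s))\<^sup>2) powr (p/2) = norm (y - Y s) powr p" for s
      by (cases "norm (y - Y s) = 0") (auto simp: powr_powr simp flip: powr_numeral)
    have m1: "integrable \<pi> (\<lambda>s. norm (y - Y s) powr p)"
      and m2: "expectation (\<lambda>s. norm (y - Y s) powr p) \<le> qq (fr y + \<phi>r y) y powr (p/2)"
      using powr_moment_le[OF sq(1) _ sq(2), of "p/2"] p by (auto simp: pw)
    define W where "W s = fr y + \<phi>r y + (\<rho> / p * norm (y - Y s) powr p + \<rho> / 2 * (norm (y - Y s))\<^sup>2)" for s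
    have W_int: "integrable \<pi> W"
      unfolding W_def using m1 sq(1) by (intro Bochner_Integration.integrable_add integrable_const Bochner_Integration.integrable_mult_right)
    have le: "envr (Y s) \<le> W s" for s
      using envr_le[OF F_dom[OF y], of "Y s"] by (simp add: W_def prox_kernel_def norm_minus_commute)
    have int: "integrable \<pi> (\<lambda>s. envr (Y s))"
    proof (rule Bochner_Integration.integrable_bound[where f = "\<lambda>s. \<bar>W s\<bar> + \<bar>m\<bar>"])
      show "AE s in \<pi>. norm (envr (Y s)) \<le> norm (\<bar>W s\<bar> + \<bar>m\<bar>)"
      proof (rule AE_I2)
        fix s
        show "norm (envr (Y s)) \<le> norm (\<bar>W s\<bar> + \<bar>m\<bar>)" using le[of s] envr_ge[of "Y s"] by auto
      qed
    qed (use W_int in auto)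
    have "expectation (\<lambda>s. envr (Y s)) \<le> expectation W"
      by (intro Bochner_Integration.integral_mono int W_int le)
    also have "expectation W = fr y + \<phi>r y + (\<rho> / p * expectation (\<lambda>s. norm (y - Y s) powr p)
        + \<rho> / 2 * expectation (\<lambda>s. (norm (y - Y s))\<^sup>2))"
      unfolding W_def using m1 sq(1) by (simp add: prob_space)
    also have "\<dots> \<le> fr y + \<phi>r y + (\<rho> / p * qq (fr y + \<phi>r y) y powr (p/2) + \<rho> / 2 * qq (fr y + \<phi>r y) y)"
      using m2 sq(2) \<rho> p by (intro add_left_mono add_mono mult_left_mono) auto
    finally show ?thesis using q0 int by simp
  qed
  obtain z v where z: "F z + ereal (prox_kernel p \<rho> (norm (x - z))) = env x" and v: "v \<in> limiting_subdiff env x"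
    and vn: "norm v \<le> prox_kernel' p \<rho> (norm (x - z))"
    using limiting_subgradient by blast
  define d where "d = norm (x - z)"
  have "F z < \<infinity>" using z by (cases "F z") (auto simp: env_real)
  hence zD: "z \<in> D" using dom_F by (auto simp: dom_e_def)
  have Fz: "fr z + \<phi>r z = envr x - prox_kernel p \<rho> d"
    using z F_dom[OF zD] by (simp add: env_real d_def)
  obtain q where q: "\<And>n. q n \<in> Q" "q \<longlonglongrightarrow> z" "(\<lambda>n. fr (q n) + \<phi>r (q n)) \<longlonglongrightarrow> fr z + \<phi>r z"
    using Q(2)[OF zD] by blast
  define qn where "qn n = qq (fr (q n) + \<phi>r (q n)) (q n)" for n
  define q0 where "q0 = qq (fr z + \<phi>r z) z"
  have qn0: "0 \<le> qn n" for n using step[OF q(1)[of n]] by (simp add: qn_def)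
  have qlim: "qn \<longlonglongrightarrow> q0"
    unfolding qn_def q0_def qq_def using c p
    by (intro tendsto_divide tendsto_add tendsto_diff tendsto_mult tendsto_const tendsto_powr' tendsto_norm tendsto_power q) auto
  have q0_nn: "0 \<le> q0" using qn0 by (intro LIMSEQ_le_const[OF qlim]) auto
  have lim: "(\<lambda>n. fr (q n) + \<phi>r (q n) + \<rho> / p * qn n powr (p/2) + \<rho> / 2 * qn n)
      \<longlonglongrightarrow> fr z + \<phi>r z + \<rho> / p * q0 powr (p/2) + \<rho> / 2 * q0"
    using p qn0 by (intro tendsto_add tendsto_mult tendsto_const tendsto_powr' qlim q(3)) auto
  have E_le: "expectation (\<lambda>s. envr (Y s)) \<le> fr z + \<phi>r z + \<rho> / p * q0 powr (p/2) + \<rho> / 2 * q0"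
    using step[OF q(1)] by (intro LIMSEQ_le_const[OF lim]) (auto simp: qn_def)
  have "q0 = d\<^sup>2 - (const_A \<rho> \<eta> * d\<^sup>2 + const_B p \<rho> \<tau> * d powr p) / (\<beta> - \<eta>) + N / (\<beta> - \<eta>)"
  proof -
    have zx: "norm (z - x) = d" by (simp add: d_def norm_minus_commute)
    \<comment> \<open>Here \<open>F\<close> at \<open>z\<close> is \<open>envr x\<close> minus the
      kernel; collecting powers of \<open>d\<close> produces \<open>const_A\<close> and
      \<open>const_B\<close>.\<close>
    have "2 * (fr z + \<phi>r z + \<tau> / p * d powr p - envr x + \<beta> / 2 * d\<^sup>2)
        = (\<beta> - \<eta>) * d\<^sup>2 - (const_A \<rho> \<eta> * d\<^sup>2 + const_B p \<rho> \<tau> * d powr p)"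
      unfolding Fz prox_kernel_def const_A_def const_B_def using p by (simp add: field_simps)
    hence "q0 = ((\<beta> - \<eta>) * d\<^sup>2 - (const_A \<rho> \<eta> * d\<^sup>2 + const_B p \<rho> \<tau> * d powr p) + N) / (\<beta> - \<eta>)"
      by (simp only: q0_def qq_def zx d_def[symmetric])
    thus ?thesis using c by (simp add: add_divide_distrib diff_divide_distrib)
  qed
  hence "\<rho> / p * q0 powr (p / 2) + \<rho> / 2 * q0
    \<le> prox_kernel p \<rho> d + \<rho> / 2 * (calB p \<nu> \<rho> \<tau> \<eta> * error_terms p \<nu> L1 L2 b)
      - \<rho> / 2 * (calA p \<rho> \<tau> \<eta> / (\<beta> - \<eta>) * (d powr (p - 1) + d)\<^sup>2)"
    by (intro descent_algebra[OF p \<nu> L \<tau> \<eta> rho b \<beta>(1) _ q0_nn]) (auto simp: d_def N_def)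
  hence main: "expectation (\<lambda>s. envr (Y s)) + \<rho> / 2 * (calA p \<rho> \<tau> \<eta> / (\<beta> - \<eta>) * (d powr (p - 1) + d)\<^sup>2)
      \<le> envr x + \<rho> / 2 * (calB p \<nu> \<rho> \<tau> \<eta> * error_terms p \<nu> L1 L2 b)"
    using E_le Fz by linarith
  have "0 \<le> calA p \<rho> \<tau> \<eta>"
    using rho \<tau> \<eta> p by (auto simp: calA_def const_A_def const_B_def)
  moreover have "(norm v)\<^sup>2 \<le> (\<rho> * (d powr (p - 1) + d))\<^sup>2"
    using vn by (intro power_mono) (auto simp: prox_kernel'_def d_def)
  ultimately have "calA p \<rho> \<tau> \<eta> / (\<beta> - \<eta>) * (norm v)\<^sup>2 / (2 * \<rho>)
      \<le> calA p \<rho> \<tau> \<eta> / (\<beta> - \<eta>) * (\<rho> * (d powr (p - 1) + d))\<^sup>2 / (2 * \<rho>)"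
    using c \<rho> by (intro divide_right_mono mult_left_mono) auto
  also have "\<dots> = \<rho> / 2 * (calA p \<rho> \<tau> \<eta> / (\<beta> - \<eta>) * (d powr (p - 1) + d)\<^sup>2)"
  proof -
    have "a / e * (\<rho> * w)\<^sup>2 / (2 * \<rho>) = \<rho> / 2 * (a / e * w\<^sup>2)" for a e w :: real
      using \<rho> by (simp add: power2_eq_square mult_ac)
    thus ?thesis .
  qed
  finally show "\<exists>v\<in>limiting_subdiff env x. expectation (\<lambda>s. envr (Y s)) + calA p \<rho> \<tau> \<eta> / (\<beta> - \<eta>) * (norm v)\<^sup>2 / (2 * \<rho>)
      \<le> envr x + \<rho> / 2 * (calB p \<nu> \<rho> \<tau> \<eta> * error_terms p \<nu> L1 L2 b)"
    using main by (intro bexI[OF _ v]) linarith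
  show "integrable \<pi> (\<lambda>s. envr (Y s))" using step[OF q(1)] by blast
qed

end

section \<open>Summation along the iterates\<close>

context product_sigma_finite
begin

text \<open>Fubini for the indicator of the exceptional set: a nonnegative iterated integral that is
  zero has almost all of its sections null.\<close>

lemma AE_PiM_insert:
  assumes I: "finite I" "i \<notin> I"
    and Q: "{u \<in> space (Pi\<^sub>M (insert i I) M). Q u} \<in> sets (Pi\<^sub>M (insert i I) M)"
    and AE: "AE u in Pi\<^sub>M (insert i I) M. Q u"
  shows "AE w in Pi\<^sub>M I M. AE s in M i. Q (w(i := s))"
proof -
  interpret I: finite_product_sigma_finite M I by standard (rule I)
  define N where "N = {u \<in> space (Pi\<^sub>M (insert i I) M). \<not> Q u}"
  have N [measurable]: "N \<in> sets (Pi\<^sub>M (insert i I) M)"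
    unfolding N_def using Q by (rule sets.sets_Collect_neg)
  have upd: "w(i := s) \<in> space (Pi\<^sub>M (insert i I) M)" if "w \<in> space (Pi\<^sub>M I M)" "s \<in> space (M i)" for w s
    using that by (auto simp: space_PiM intro!: PiE_fun_upd)
  have "emeasure (Pi\<^sub>M (insert i I) M) N = 0"
    using AE AE_iff_measurable[OF N, of Q] by (simp add: N_def)
  hence "0 = (\<integral>\<^sup>+ u. indicator N u \<partial>Pi\<^sub>M (insert i I) M)" using N by simp
  also have "\<dots> = (\<integral>\<^sup>+ w. (\<integral>\<^sup>+ s. indicator N (w(i := s)) \<partial>M i) \<partial>Pi\<^sub>M I M)"
    by (rule product_nn_integral_insert[OF I]) measurable
  finally have "(\<integral>\<^sup>+ w. (\<integral>\<^sup>+ s. indicator N (w(i := s)) \<partial>M i) \<partial>Pi\<^sub>M I M) = 0" by simp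
  hence "AE w in Pi\<^sub>M I M. (\<integral>\<^sup>+ s. indicator N (w(i := s)) \<partial>M i) = 0"
    by (subst (asm) nn_integral_0_iff_AE) measurable
  thus ?thesis using AE_space
  proof eventually_elim
    case (elim w)
    have [measurable]: "(\<lambda>s. w(i := s)) \<in> M i \<rightarrow>\<^sub>M Pi\<^sub>M (insert i I) M"
      using measurable_component_update[OF elim(2) I(2)] .
    have "AE s in M i. (indicator N (w(i := s)) :: ennreal) = 0"
      using elim(1) by (subst (asm) nn_integral_0_iff_AE) measurable
    thus ?case using AE_space
      by eventually_elim (use upd[OF elim(2)] in \<open>auto simp: N_def indicator_def split: if_splits\<close>)
  qed
qed

end

lemma iid_draws_law:
  assumes "iid_draws P \<pi> \<xi>"
  shows "distr P (Pi\<^sub>M {..<t} (\<lambda>_. \<pi>)) (\<lambda>\<omega>. \<lambda>i\<in>{..<t}. \<xi> i \<omega>) = Pi\<^sub>M {..<t} (\<lambda>_. \<pi>)"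
    and "(\<lambda>\<omega>. \<lambda>i\<in>{..<t}. \<xi> i \<omega>) \<in> P \<rightarrow>\<^sub>M Pi\<^sub>M {..<t} (\<lambda>_. \<pi>)"
proof -
  interpret prob_space P using assms by (simp add: iid_draws_def)
  have indep: "indep_vars (\<lambda>_. \<pi>) \<xi> UNIV" and law: "\<And>t. distr P \<pi> (\<xi> t) = \<pi>"
    using assms by (auto simp: iid_draws_def)
  have \<xi>: "\<xi> i \<in> P \<rightarrow>\<^sub>M \<pi>" for i using indep by (auto simp: indep_vars_def)
  show meas: "(\<lambda>\<omega>. \<lambda>i\<in>{..<t}. \<xi> i \<omega>) \<in> P \<rightarrow>\<^sub>M Pi\<^sub>M {..<t} (\<lambda>_. \<pi>)"
    by (intro measurable_restrict \<xi>)
  show "distr P (Pi\<^sub>M {..<t} (\<lambda>_. \<pi>)) (\<lambda>\<omega>. \<lambda>i\<in>{..<t}. \<xi> i \<omega>) = Pi\<^sub>M {..<t} (\<lambda>_. \<pi>)"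
  \<comment> \<open>The product characterization of independence is applied to a nonempty index set.
    With no draws both sides are the unit mass on the one point of the empty product.\<close>
  proof (cases "t = 0")
    case True
    have "distr P (Pi\<^sub>M {} (\<lambda>_. \<pi>)) (\<lambda>\<omega>. \<lambda>i\<in>{}. \<xi> i \<omega>) = Pi\<^sub>M {} (\<lambda>_. \<pi>)"
    proof (rule measure_eqI)
      fix A assume "A \<in> sets (distr P (Pi\<^sub>M {} (\<lambda>_. \<pi>)) (\<lambda>\<omega>. \<lambda>i\<in>{}. \<xi> i \<omega>))"
      hence A: "A \<in> sets (Pi\<^sub>M {} (\<lambda>_. \<pi>))" by simp
      hence "A = {} \<or> A = {\<lambda>_. undefined}" by (auto simp: sets_PiM_empty)
      moreover have "emeasure (distr P (Pi\<^sub>M {} (\<lambda>_. \<pi>)) (\<lambda>\<omega>. \<lambda>i\<in>{}. \<xi> i \<omega>)) A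
          = emeasure P ((\<lambda>\<omega>. \<lambda>i\<in>{}. \<xi> i \<omega>) -` A \<inter> space P)"
        using meas A True by (intro emeasure_distr) auto
      ultimately show "emeasure (distr P (Pi\<^sub>M {} (\<lambda>_. \<pi>)) (\<lambda>\<omega>. \<lambda>i\<in>{}. \<xi> i \<omega>)) A = emeasure (Pi\<^sub>M {} (\<lambda>_. \<pi>)) A"
        by (auto simp: PiM_empty emeasure_space_1 restrict_def vimage_def)
    qed simp
    thus ?thesis using True by simp
  next
    case False
    have "indep_vars (\<lambda>_. \<pi>) \<xi> {..<t}" using indep by (rule indep_vars_subset) simp
    hence "distr P (Pi\<^sub>M {..<t} (\<lambda>_. \<pi>)) (\<lambda>\<omega>. \<lambda>i\<in>{..<t}. \<xi> i \<omega>) = Pi\<^sub>M {..<t} (\<lambda>i. distr P \<pi> (\<xi> i))"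
      using False \<xi> by (subst (asm) indep_vars_iff_distr_eq_PiM) auto
    thus ?thesis by (simp only: law)
  qed
qed

section \<open>Measurability and convexity of the composite model\<close>

context one_sided_model
begin

lemma D_measurable [measurable]: "D \<in> sets borel"
proof -
  have [measurable]: "\<phi> \<in> borel_measurable borel" using lsc_\<phi> by (rule lower_semicontinuous_borel_measurable)
  have "{y \<in> space borel. \<phi> y < \<infinity>} \<in> sets borel" by measurable
  thus ?thesis by (simp add: dom_e_def)
qed

lemma U_measurable [measurable]: "U \<in> sets borel"
  using U(1) by simp

text \<open>A property holding almost surely on a probability space holds for some draw, and a
  single weakly convex composite has a convex domain.\<close>

lemma convex_D: "convex D"
proof -
  interpret prob_space \<pi> by (rule prob)
  obtain y where "y \<in> D" using proper_\<phi> by (auto simp: proper_def)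
  hence "AE s in \<pi>. weakly_convex \<eta> (\<lambda>y'. ereal (fm y y' s) + \<phi> y')" using U(2) by (intro fm_wc) auto
  then obtain s where "weakly_convex \<eta> (\<lambda>y'. ereal (fm y y' s) + \<phi> y')"
    using eventually_happens'[OF ae_filter_bot] by blast
  then interpret weakly_convex_sum "\<lambda>y'. fm y y' s" \<phi> \<eta> by unfold_locales (auto simp: \<phi>_fin)
  show ?thesis by (rule convex_dom)
qed

text \<open>The model is only measurable on \<open>U\<close>, so it is cut off outside.\<close>

definition "fmU y z s = (if y \<in> U \<and> z \<in> U then fm y z s else 0)"

lemma fmU_measurable:
  assumes [measurable]: "a \<in> N \<rightarrow>\<^sub>M borel" "b \<in> N \<rightarrow>\<^sub>M borel" "c \<in> N \<rightarrow>\<^sub>M \<pi>"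
  shows "(\<lambda>u. fmU (a u) (b u) (c u)) \<in> borel_measurable N"
proof -
  define R where "R = restrict_space N {u. a u \<in> U \<and> b u \<in> U}"
  have sp: "space R \<subseteq> {u. a u \<in> U \<and> b u \<in> U}" by (auto simp: R_def space_restrict_space)
  have "a \<in> R \<rightarrow>\<^sub>M restrict_space borel U" "b \<in> R \<rightarrow>\<^sub>M restrict_space borel U"
    using sp by (auto intro!: measurable_restrict_space2 simp: R_def intro: measurable_restrict_space1 assms)
  moreover have "c \<in> R \<rightarrow>\<^sub>M \<pi>" unfolding R_def by (intro measurable_restrict_space1 assms)
  ultimately have "(\<lambda>u. (a u, b u, c u)) \<in> R \<rightarrow>\<^sub>M restrict_space borel U \<Otimes>\<^sub>M (restrict_space borel U \<Otimes>\<^sub>M \<pi>)"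
    by (intro measurable_Pair)
  from measurable_compose[OF this fm_meas] have "(\<lambda>u. fm (a u) (b u) (c u)) \<in> borel_measurable R" by simp
  moreover have "{u \<in> space N. a u \<in> U \<and> b u \<in> U} \<in> sets N" by measurable
  ultimately show ?thesis
    unfolding fmU_def by (subst measurable_If_restrict_space_iff) (auto simp: R_def)
qed

end

section \<open>Iterates as functions of the past draws\<close>

locale model_run = one_sided_model_moduli +
  fixes P :: "'m measure" and \<xi> :: "nat \<Rightarrow> 'm \<Rightarrow> 'b" and x :: "nat \<Rightarrow> 'm \<Rightarrow> 'a" and x0 :: 'a
    and \<beta> :: "nat \<Rightarrow> real" and T :: nat
  assumes run: "model_based_method P \<pi> \<xi> \<phi> fm \<beta> x0 T x"
    and beta: "\<And>t. rho_tilde p \<rho> \<tau> < \<beta> t"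
begin

sublocale prod: product_sigma_finite "\<lambda>_::nat. \<pi>" by unfold_locales

abbreviation "hist t \<equiv> Pi\<^sub>M {..<t} (\<lambda>_. \<pi>)"
abbreviation "draws t \<omega> \<equiv> \<lambda>i\<in>{..<t}. \<xi> i \<omega>"

lemma run_facts:
  shows iid: "iid_draws P \<pi> \<xi>" and x0: "x0 \<in> D" "\<And>\<omega>. \<omega> \<in> space P \<Longrightarrow> x 0 \<omega> = x0"
    and adapted: "\<And>t. t \<le> Suc T \<Longrightarrow> \<exists>X\<in>borel_measurable (hist t). AE \<omega> in P. x t \<omega> = X (draws t \<omega>)"
    and minimizer: "\<And>t. t \<le> T \<Longrightarrow> AE \<omega> in P. is_arg_min
      (\<lambda>z. \<phi> z + ereal (fm (x t \<omega>) z (\<xi> t \<omega>)) + ereal (\<beta> t / 2 * (norm (z - x t \<omega>))\<^sup>2)) (\<lambda>_. True) (x (Suc t) \<omega>)"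
proof -
  note r = run[unfolded model_based_method_def]
  show "iid_draws P \<pi> \<xi>" "x0 \<in> D" by (insert r, (elim conjE, assumption)+)
  from r have 1: "\<forall>\<omega>\<in>space P. x 0 \<omega> = x0" by (elim conjE)
  from r have 2: "\<forall>t\<le>Suc T. x t \<in> borel_measurable P \<and>
    (\<exists>X\<in>borel_measurable (hist t). AE \<omega> in P. x t \<omega> = X (draws t \<omega>))" by (elim conjE)
  from r have 3: "\<forall>t\<le>T. AE \<omega> in P. is_arg_min
      (\<lambda>z. \<phi> z + ereal (fm (x t \<omega>) z (\<xi> t \<omega>)) + ereal (\<beta> t / 2 * (norm (z - x t \<omega>))\<^sup>2)) (\<lambda>_. True) (x (Suc t) \<omega>)"
    by (elim conjE)
  show "x 0 \<omega> = x0" if "\<omega> \<in> space P" for \<omega> using 1 that by (rule bspec)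
  show "\<exists>X\<in>borel_measurable (hist t). AE \<omega> in P. x t \<omega> = X (draws t \<omega>)" if "t \<le> Suc T" for t
    using 2[rule_format, OF that] by (rule conjunct2)
  show "AE \<omega> in P. is_arg_min
      (\<lambda>z. \<phi> z + ereal (fm (x t \<omega>) z (\<xi> t \<omega>)) + ereal (\<beta> t / 2 * (norm (z - x t \<omega>))\<^sup>2)) (\<lambda>_. True) (x (Suc t) \<omega>)"
    if "t \<le> T" for t using 3[rule_format, OF that] .
qed

lemma law: "distr P (hist t) (draws t) = hist t"
  by (rule iid_draws_law(1)[OF iid])

lemma draws_measurable [measurable]: "draws t \<in> P \<rightarrow>\<^sub>M hist t"
  by (rule iid_draws_law(2)[OF iid])

lemma AE_law:
  assumes "{u \<in> space (hist t). Q u} \<in> sets (hist t)"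
  shows "(AE u in hist t. Q u) \<longleftrightarrow> (AE \<omega> in P. Q (draws t \<omega>))"
  using AE_distr_iff[OF draws_measurable assms] by (simp only: law)

lemma nn_integral_law:
  assumes "g \<in> borel_measurable (hist t)"
  shows "(\<integral>\<^sup>+ u. g u \<partial>hist t) = (\<integral>\<^sup>+ \<omega>. g (draws t \<omega>) \<partial>P)"
  using nn_integral_distr[OF draws_measurable, of g t] assms by (simp only: law)

text \<open>A minimizer has a value no larger than that of the competitor \<open>x0\<close>, which
  is finite.\<close>

lemma iterate_dom: "t \<le> Suc T \<Longrightarrow> AE \<omega> in P. x t \<omega> \<in> D"
proof (cases t)
  case 0
  thus ?thesis using x0 by (intro AE_I2) simp
next
  case (Suc t')
  assume "t \<le> Suc T"
  hence "t' \<le> T" using Suc by simp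
  from minimizer[OF this] show ?thesis
  proof eventually_elim
    case (elim \<omega>)
    define g where "g z = \<phi> z + ereal (fm (x t' \<omega>) z (\<xi> t' \<omega>)) + ereal (\<beta> t' / 2 * (norm (z - x t' \<omega>))\<^sup>2)" for z
    have "\<not> g x0 < g (x (Suc t') \<omega>)" using elim unfolding is_arg_min_def g_def by blast
    moreover have "g x0 < \<infinity>" using x0(1) unfolding g_def by (cases "\<phi> x0") (auto simp: dom_e_def)
    ultimately have "g (x (Suc t') \<omega>) < \<infinity>" by (meson le_less_trans not_le)
    thus "x t \<omega> \<in> D" unfolding g_def Suc by (cases "\<phi> (x (Suc t') \<omega>)") (auto simp: dom_e_def)
  qed
qed

lemma beta_facts: "0 < \<beta> t - rho_tilde p \<rho> \<tau>" "\<eta> < \<beta> t"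
proof -
  show "0 < \<beta> t - rho_tilde p \<rho> \<tau>" using beta[of t] by simp
  have "\<eta> \<le> rho_tilde p \<rho> \<tau>" using rho \<tau> \<eta> by (auto simp: rho_tilde_def)
  thus "\<eta> < \<beta> t" using beta[of t] by simp
qed

text \<open>With one factor map fixed per time, conditioning on the past means fixing the
  coordinates below \<open>t\<close>.\<close>

definition "X t = (SOME X. X \<in> borel_measurable (hist t) \<and> (AE \<omega> in P. x t \<omega> = X (draws t \<omega>)))"

lemma X:
  assumes "t \<le> Suc T"
  shows "X t \<in> borel_measurable (hist t)" "AE \<omega> in P. x t \<omega> = X t (draws t \<omega>)"
proof -
  have "\<exists>X. X \<in> borel_measurable (hist t) \<and> (AE \<omega> in P. x t \<omega> = X (draws t \<omega>))"
    using adapted[OF assms] by blast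
  from someI_ex[OF this] show "X t \<in> borel_measurable (hist t)" "AE \<omega> in P. x t \<omega> = X t (draws t \<omega>)"
    unfolding X_def by auto
qed

text \<open>The minimization property itself is not a measurable condition on the draws; it is
  weakened to countably many comparison points before Fubini's theorem is applied.\<close>

lemma conditional_optimality:
  assumes t: "t \<le> T" and Q: "countable Q" "Q \<subseteq> D"
  shows "AE w in hist t. X t w \<in> D \<and> (AE s in \<pi>. X (Suc t) (w(t := s)) \<in> D) \<and>
    (\<forall>y\<in>Q. AE s in \<pi>. fm (X t w) (X (Suc t) (w(t := s))) s + \<phi>r (X (Suc t) (w(t := s)))
        + \<beta> t / 2 * (norm (X (Suc t) (w(t := s)) - X t w))\<^sup>2
        + (\<beta> t - \<eta>) / 2 * (norm (y - X (Suc t) (w(t := s))))\<^sup>2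
      \<le> fm (X t w) y s + \<phi>r y + \<beta> t / 2 * (norm (y - X t w))\<^sup>2)"
proof -
  have [measurable]: "X t \<in> borel_measurable (hist t)" "X (Suc t) \<in> borel_measurable (hist (Suc t))"
    using X(1) t by auto
  have [measurable]: "\<phi> \<in> borel_measurable borel" using lsc_\<phi> by (rule lower_semicontinuous_borel_measurable)
  \<comment> \<open>These segment points are the only competitors that
    \<open>proximal_growth\<close> asks for.\<close>
  define z where "z n y u = X (Suc t) u + (1 / real (n + 2)) *\<^sub>R (y - X (Suc t) u)" for n :: nat and y u
  define a where "a u = X t (restrict u {..<t})" for u
  have [measurable]: "(\<lambda>u. restrict u {..<t}) \<in> hist (Suc t) \<rightarrow>\<^sub>M hist t"
    by (rule measurable_restrict_subset) auto
  have a_meas [measurable]: "a \<in> borel_measurable (hist (Suc t))" unfolding a_def by measurable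
  have z_meas [measurable]: "z n y \<in> borel_measurable (hist (Suc t))" for n y unfolding z_def by measurable
  have s_meas [measurable]: "(\<lambda>u. u t) \<in> hist (Suc t) \<rightarrow>\<^sub>M \<pi>" by (rule measurable_component_singleton) simp
  define G where "G n y u \<longleftrightarrow> X (Suc t) u \<in> D \<and>
      fmU (a u) (X (Suc t) u) (u t) + \<phi>r (X (Suc t) u) + \<beta> t / 2 * (norm (X (Suc t) u - a u))\<^sup>2
      \<le> fmU (a u) (z n y u) (u t) + \<phi>r (z n y u) + \<beta> t / 2 * (norm (z n y u - a u))\<^sup>2" for n y u
  have value_meas: "(\<lambda>u. fmU (a u) (v u) (u t) + \<phi>r (v u) + \<beta> t / 2 * (norm (v u - a u))\<^sup>2)
      \<in> borel_measurable (hist (Suc t))" if [measurable]: "v \<in> borel_measurable (hist (Suc t))" for v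
  proof (intro borel_measurable_add)
    show "(\<lambda>u. fmU (a u) (v u) (u t)) \<in> borel_measurable (hist (Suc t))"
      by (rule fmU_measurable) measurable
  qed measurable
  have G_meas: "{u \<in> space (hist (Suc t)). G n y u} \<in> sets (hist (Suc t))" for n y
    unfolding G_def
    by (intro sets.sets_Collect_conj borel_measurable_le value_meas z_meas) measurable
  have G_AE: "AE \<omega> in P. G n y (draws (Suc t) \<omega>)" if "y \<in> Q" for n y
  proof -
    have le: "t \<le> Suc T" "Suc t \<le> Suc T" using t by auto
    from X(2)[OF le(1)] X(2)[OF le(2)] iterate_dom[OF le(1)] iterate_dom[OF le(2)] minimizer[OF t]
    show ?thesis
    proof eventually_elim
      case (elim \<omega>)
      define Y where "Y = x (Suc t) \<omega>"
      define v where "v = Y + (1 / real (n + 2)) *\<^sub>R (y - Y)"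
      have res: "restrict (draws (Suc t) \<omega>) {..<t} = draws t \<omega>" by (auto simp: fun_eq_iff)
      have YD: "Y \<in> D" "y \<in> D" using elim that Q by (auto simp: Y_def)
      have "v = (1 - 1 / real (n + 2)) *\<^sub>R Y + (1 / real (n + 2)) *\<^sub>R y"
        by (simp add: v_def algebra_simps)
      also have "\<dots> \<in> D" using YD by (intro convexD[OF convex_D]) auto
      finally have vD: "v \<in> D" .
      define g where "g z = \<phi> z + ereal (fm (x t \<omega>) z (\<xi> t \<omega>)) + ereal (\<beta> t / 2 * (norm (z - x t \<omega>))\<^sup>2)" for z
      have "\<not> g v < g Y" using elim(5) unfolding is_arg_min_def g_def Y_def by blast
      moreover have "g z = ereal (fm (x t \<omega>) z (\<xi> t \<omega>) + \<phi>r z + \<beta> t / 2 * (norm (z - x t \<omega>))\<^sup>2)" if "z \<in> D" for z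
        using that \<phi>_fin[of z] unfolding g_def by (cases "\<phi> z") (auto simp: dom_e_def)
      ultimately have "fm (x t \<omega>) Y (\<xi> t \<omega>) + \<phi>r Y + \<beta> t / 2 * (norm (Y - x t \<omega>))\<^sup>2
          \<le> fm (x t \<omega>) v (\<xi> t \<omega>) + \<phi>r v + \<beta> t / 2 * (norm (v - x t \<omega>))\<^sup>2"
        using YD vD by simp
      moreover have "fm (x t \<omega>) Y (\<xi> t \<omega>) = fmU (x t \<omega>) Y (\<xi> t \<omega>)" "fm (x t \<omega>) v (\<xi> t \<omega>) = fmU (x t \<omega>) v (\<xi> t \<omega>)"
        using U(2) YD vD elim(3) by (auto simp: fmU_def)
      moreover have "a (draws (Suc t) \<omega>) = x t \<omega>" unfolding a_def res using elim(1) by simp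
      moreover have "X (Suc t) (draws (Suc t) \<omega>) = Y" using elim(2) by (simp add: Y_def)
      moreover have "draws (Suc t) \<omega> t = \<xi> t \<omega>" by simp
      ultimately show ?case
        unfolding G_def z_def v_def using YD by (simp only: simp_thms)
    qed
  qed
  have ins: "hist (Suc t) = Pi\<^sub>M (insert t {..<t}) (\<lambda>_. \<pi>)" by (simp add: lessThan_Suc)
  have "AE w in hist t. AE s in \<pi>. G n y (w(t := s))" if "y \<in> Q" for n y
    using G_meas[of n y] G_AE[OF that, of n] unfolding AE_law[OF G_meas, symmetric] ins
    by (intro prod.AE_PiM_insert) auto
  \<comment> \<open>Both \<open>y\<close> and \<open>n\<close> range over countable sets, so one
    null set of histories suffices.\<close>
  hence "AE w in hist t. \<forall>y\<in>Q. \<forall>n. AE s in \<pi>. G n y (w(t := s))"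
    using Q(1) by (simp add: AE_ball_countable AE_all_countable)
  moreover have "AE w in hist t. X t w \<in> D"
  proof (subst AE_law)
    have "t \<le> Suc T" using t by simp
    from X(2)[OF this] iterate_dom[OF this] show "AE \<omega> in P. X t (draws t \<omega>) \<in> D"
      by eventually_elim simp
  qed measurable
  moreover have "AE w in hist t. AE s in \<pi>. X (Suc t) (w(t := s)) \<in> D"
  proof (rule prod.AE_PiM_insert)
    have "Suc t \<le> Suc T" using t by simp
    from X(2)[OF this] iterate_dom[OF this] have "AE \<omega> in P. X (Suc t) (draws (Suc t) \<omega>) \<in> D"
      by eventually_elim simp
    moreover have meas: "{u \<in> space (hist (Suc t)). X (Suc t) u \<in> D} \<in> sets (hist (Suc t))" by measurable
    ultimately show "AE u in Pi\<^sub>M (insert t {..<t}) (\<lambda>_. \<pi>). X (Suc t) u \<in> D"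
      unfolding ins[symmetric] by (subst AE_law)
    show "{u \<in> space (Pi\<^sub>M (insert t {..<t}) (\<lambda>_. \<pi>)). X (Suc t) u \<in> D} \<in> sets (Pi\<^sub>M (insert t {..<t}) (\<lambda>_. \<pi>))"
      using meas unfolding ins .
  qed auto
  ultimately show ?thesis using AE_space
  proof eventually_elim
    case (elim w)
    define Y where "Y s = X (Suc t) (w(t := s))" for s
    \<comment> \<open>A point of the product space is \<open>undefined\<close> off its index set, so
      restricting the extended history returns \<open>w\<close> itself.\<close>
    have res: "a (w(t := s)) = X t w" for s
    proof -
      have "restrict (w(t := s)) {..<t} = w"
        using elim(4) by (auto simp: fun_eq_iff space_PiM PiE_def extensional_def)
      thus ?thesis by (simp add: a_def)
    qed
    have aU: "X t w \<in> U" using elim(2) U by auto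
    have "AE s in \<pi>. fm (X t w) (Y s) s + \<phi>r (Y s) + \<beta> t / 2 * (norm (Y s - X t w))\<^sup>2
        + (\<beta> t - \<eta>) / 2 * (norm (y - Y s))\<^sup>2 \<le> fm (X t w) y s + \<phi>r y + \<beta> t / 2 * (norm (y - X t w))\<^sup>2"
      if y: "y \<in> Q" for y
    proof -
      have "AE s in \<pi>. \<forall>n. G n y (w(t := s))"
        using elim(1) y by (simp add: AE_all_countable)
      with fm_wc[OF aU] show ?thesis
      proof eventually_elim
        case (elim s)
        interpret weakly_convex_sum "\<lambda>y. fm (X t w) y s" \<phi> \<eta>
          by unfold_locales (use elim(1) \<phi>_fin in auto)
        have YD: "Y s \<in> D" "y \<in> D" using elim(2) y Q by (auto simp: G_def Y_def)
        have vD: "Y s + (1 / real (n + 2)) *\<^sub>R (y - Y s) \<in> D" for n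
        proof -
          have "Y s + (1 / real (n + 2)) *\<^sub>R (y - Y s) = (1 - 1 / real (n + 2)) *\<^sub>R Y s + (1 / real (n + 2)) *\<^sub>R y"
            by (simp add: algebra_simps)
          also have "\<dots> \<in> D" using YD by (intro convexD[OF convex_D]) auto
          finally show ?thesis .
        qed
        have eqU: "fmU (X t w) v s = fm (X t w) v s" if "v \<in> D" for v
          using that aU U(2) by (auto simp: fmU_def)
        have "fmU (X t w) (Y s) s + \<phi>r (Y s) + \<beta> t / 2 * (norm (Y s - X t w))\<^sup>2
            \<le> fmU (X t w) (Y s + (1 / real (n + 2)) *\<^sub>R (y - Y s)) s + \<phi>r (Y s + (1 / real (n + 2)) *\<^sub>R (y - Y s))
              + \<beta> t / 2 * (norm (Y s + (1 / real (n + 2)) *\<^sub>R (y - Y s) - X t w))\<^sup>2" for n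
          using elim(2)[rule_format, of n] unfolding G_def z_def res Y_def[symmetric] fun_upd_same by (rule conjunct2)
        thus ?case unfolding eqU[OF YD(1)] eqU[OF vD] by (rule proximal_growth[OF YD])
      qed
    qed
    thus ?case using elim(2,3) by (simp add: Y_def)
  qed
qed

section \<open>Expected decrease and telescoping\<close>

definition "gap z = ennreal (envr z - m)"

definition "err t = \<rho> / 2 * (calB p \<nu> \<rho> \<tau> \<eta> * error_terms p \<nu> L1 L2 (\<beta> t - rho_tilde p \<rho> \<tau>))"

text \<open>A function of the history that involves no choice of a proximal point, which keeps it
  measurable. Subtraction in \<open>ennreal\<close> truncates at zero; \<open>decrease_AE\<close>
  shows that almost everywhere nothing is lost.\<close>

definition "decrease t w = gap (X t w) + ennreal (err t) - (\<integral>\<^sup>+ s. gap (X (Suc t) (w(t := s))) \<partial>\<pi>)"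

lemma gap_measurable [measurable]: "gap \<in> borel_measurable borel"
  unfolding gap_def by measurable

lemma err_nonneg: "0 \<le> err t"
proof -
  have "2 * const_D p \<le> calB p \<nu> \<rho> \<tau> \<eta>" unfolding calB_def by (rule Max_ge) auto
  moreover have "0 \<le> const_D p" by (simp add: const_D_def)
  ultimately have "0 \<le> calB p \<nu> \<rho> \<tau> \<eta>" by linarith
  moreover have "0 \<le> error_terms p \<nu> L1 L2 (\<beta> t - rho_tilde p \<rho> \<tau>)"
    by (auto simp: error_terms_def pow2p_def intro!: add_nonneg_nonneg)
  ultimately show ?thesis using \<rho> by (simp add: err_def)
qed

lemma next_gap_measurable:
  assumes t: "t \<le> T"
  shows "(\<lambda>w. \<integral>\<^sup>+ s. gap (X (Suc t) (w(t := s))) \<partial>\<pi>) \<in> borel_measurable (hist t)"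
proof -
  have ins: "hist (Suc t) = Pi\<^sub>M (insert t {..<t}) (\<lambda>_. \<pi>)" by (simp add: lessThan_Suc)
  have [measurable]: "X (Suc t) \<in> borel_measurable (Pi\<^sub>M (insert t {..<t}) (\<lambda>_. \<pi>))"
    using X(1)[of "Suc t"] t unfolding ins by simp
  show ?thesis by measurable
qed

lemma decrease_measurable:
  assumes t: "t \<le> T"
  shows "decrease t \<in> borel_measurable (hist t)"
proof -
  note next_gap_measurable[OF t, measurable]
  have [measurable]: "X t \<in> borel_measurable (hist t)" using X(1)[of t] t by simp
  show ?thesis unfolding decrease_def by measurable
qed

text \<open>For almost every history \<open>w\<close> this is \<open>one_step\<close> for the draw
  alone. The subgradient found there varies with \<open>w\<close> without any measurability, but it
  only bounds the distance from above.\<close>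

lemma decrease_AE:
  assumes t: "t \<le> T"
  shows "AE w in hist t. (\<integral>\<^sup>+ s. gap (X (Suc t) (w(t := s))) \<partial>\<pi>) + decrease t w = gap (X t w) + ennreal (err t)
    \<and> ennreal (calA p \<rho> \<tau> \<eta> * inverse (\<beta> t - \<eta>)) * (dist_zero (limiting_subdiff env (X t w)))\<^sup>2
      \<le> ennreal (2 * \<rho>) * decrease t w"
proof -
  obtain Q where Q: "countable Q" "Q \<subseteq> D"
    "\<And>y. y \<in> D \<Longrightarrow> \<exists>q. (\<forall>n. q n \<in> Q) \<and> q \<longlonglongrightarrow> y \<and> (\<lambda>n. fr (q n) + \<phi>r (q n)) \<longlonglongrightarrow> fr y + \<phi>r y"
    using dense_sequence by blast
  have ins: "hist (Suc t) = Pi\<^sub>M (insert t {..<t}) (\<lambda>_. \<pi>)" by (simp add: lessThan_Suc)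
  from conditional_optimality[OF t Q(1,2)] AE_space show ?thesis
  proof eventually_elim
    case (elim w)
    define Y where "Y s = X (Suc t) (w(t := s))" for s
    have "(\<lambda>s. w(t := s)) \<in> \<pi> \<rightarrow>\<^sub>M hist (Suc t)"
      unfolding ins using measurable_component_update[OF elim(2), of t] by simp
    moreover have "X (Suc t) \<in> borel_measurable (hist (Suc t))" using X(1)[of "Suc t"] t by simp
    ultimately have Y: "Y \<in> borel_measurable \<pi>" unfolding Y_def by (rule measurable_compose)
    have aD: "X t w \<in> D" and YD: "AE s in \<pi>. Y s \<in> D"
      and growth: "\<And>y. y \<in> Q \<Longrightarrow> AE s in \<pi>. fm (X t w) (Y s) s + \<phi>r (Y s) + \<beta> t / 2 * (norm (Y s - X t w))\<^sup>2
        + (\<beta> t - \<eta>) / 2 * (norm (y - Y s))\<^sup>2 \<le> fm (X t w) y s + \<phi>r y + \<beta> t / 2 * (norm (y - X t w))\<^sup>2"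
      using elim(1) by (auto simp: Y_def)
    have \<beta>: "\<beta> t = (\<beta> t - rho_tilde p \<rho> \<tau>) + rho_tilde p \<rho> \<tau>" by simp
    note step = one_step[OF aD Y YD beta_facts(1) \<beta> beta_facts(2) Q(2,3) growth]
    obtain v where v: "v \<in> limiting_subdiff env (X t w)"
      and le: "expectation (\<lambda>s. envr (Y s)) + calA p \<rho> \<tau> \<eta> / (\<beta> t - \<eta>) * (norm v)\<^sup>2 / (2 * \<rho>) \<le> envr (X t w) + err t"
      using step(2) unfolding err_def by blast
    define e where "e = expectation (\<lambda>s. envr (Y s))"
    define r where "r = envr (X t w) - m + err t - (e - m)"
    define k where "k = calA p \<rho> \<tau> \<eta> * inverse (\<beta> t - \<eta>)"
    have int: "integrable \<pi> (\<lambda>s. envr (Y s) - m)"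
      using step(1) by (intro Bochner_Integration.integrable_diff integrable_const)
    have "(\<integral>\<^sup>+ s. gap (Y s) \<partial>\<pi>) = ennreal (expectation (\<lambda>s. envr (Y s) - m))"
      unfolding gap_def by (rule nn_integral_eq_integral[OF int]) (use envr_ge in auto)
    also have "expectation (\<lambda>s. envr (Y s) - m) = e - m" using step(1) by (simp add: e_def prob_space)
    finally have gapY: "(\<integral>\<^sup>+ s. gap (Y s) \<partial>\<pi>) = ennreal (e - m)" .
    have em: "0 \<le> e - m"
    proof -
      have "expectation (\<lambda>s. m) \<le> e" unfolding e_def
        using step(1) envr_ge by (intro Bochner_Integration.integral_mono) auto
      thus ?thesis by (simp add: prob_space)
    qed
    have am: "0 \<le> envr (X t w) - m" using envr_ge by simp
    have "0 \<le> calA p \<rho> \<tau> \<eta>"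
      using rho \<tau> \<eta> p by (auto simp: calA_def const_A_def const_B_def)
    hence k0: "0 \<le> k" using beta_facts(2)[of t] unfolding k_def by (intro mult_nonneg_nonneg; simp)
    have "calA p \<rho> \<tau> \<eta> / (\<beta> t - \<eta>) = k" unfolding k_def by (rule divide_inverse)
    hence "k * (norm v)\<^sup>2 / (2 * \<rho>) \<le> r" using le unfolding r_def e_def by simp
    hence kv: "k * (norm v)\<^sup>2 \<le> 2 * \<rho> * r" using \<rho> by (simp add: field_simps)
    \<comment> \<open>The decrease is nonnegative because it dominates a squared norm; this makes
      the truncated subtraction exact.\<close>
    have r0: "0 \<le> r"
    proof -
      have "0 \<le> k * (norm v)\<^sup>2" using k0 by simp
      also note kv
      finally show ?thesis using \<rho> by (simp add: zero_le_mult_iff)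
    qed
    have "decrease t w = ennreal (envr (X t w) - m) + ennreal (err t) - ennreal (e - m)"
      unfolding decrease_def Y_def[symmetric] gapY by (simp add: gap_def)
    also have "\<dots> = ennreal r"
      using am err_nonneg[of t] em by (simp add: r_def ennreal_minus flip: ennreal_plus)
    finally have dec: "decrease t w = ennreal r" .
    have "(\<integral>\<^sup>+ s. gap (Y s) \<partial>\<pi>) + decrease t w = gap (X t w) + ennreal (err t)"
      unfolding gapY dec unfolding gap_def using am err_nonneg[of t] em r0
      by (simp add: r_def flip: ennreal_plus)
    moreover have "ennreal k * (dist_zero (limiting_subdiff env (X t w)))\<^sup>2 \<le> ennreal (2 * \<rho>) * decrease t w"
    proof -
      have "dist_zero (limiting_subdiff env (X t w)) \<le> ennreal (norm v)"
        unfolding dist_zero_def using v by (rule INF_lower)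
      hence "(dist_zero (limiting_subdiff env (X t w)))\<^sup>2 \<le> (ennreal (norm v))\<^sup>2" by (rule power_mono) simp
      hence "ennreal k * (dist_zero (limiting_subdiff env (X t w)))\<^sup>2 \<le> ennreal k * (ennreal (norm v))\<^sup>2"
        by (rule mult_left_mono) simp
      also have "\<dots> = ennreal (k * (norm v)\<^sup>2)" using k0 by (simp add: ennreal_mult ennreal_power)
      also have "\<dots> \<le> ennreal (2 * \<rho> * r)" using kv by (rule ennreal_leI)
      also have "\<dots> = ennreal (2 * \<rho>) * decrease t w" unfolding dec using \<rho> r0 by (simp add: ennreal_mult)
      finally show ?thesis .
    qed
    ultimately show ?case by (simp add: Y_def k_def)
  qed
qed

text \<open>Keeping the decreases on the left avoids every subtraction, so the identity holds in
  \<open>ennreal\<close> without prior finiteness of the expected gaps.\<close>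

lemma telescope:
  assumes "n \<le> Suc T"
  shows "(\<integral>\<^sup>+ w. gap (X n w) \<partial>hist n) + (\<Sum>t<n. \<integral>\<^sup>+ w. decrease t w \<partial>hist t) = gap x0 + (\<Sum>t<n. ennreal (err t))"
  using assms
proof (induction n)
  case 0
  have [measurable]: "X 0 \<in> borel_measurable (hist 0)" by (rule X(1)) simp
  interpret P: prob_space P using iid by (simp add: iid_draws_def)
  have "(\<integral>\<^sup>+ w. gap (X 0 w) \<partial>hist 0) = (\<integral>\<^sup>+ \<omega>. gap (X 0 (draws 0 \<omega>)) \<partial>P)"
    by (rule nn_integral_law) measurable
  also have "\<dots> = (\<integral>\<^sup>+ \<omega>. gap x0 \<partial>P)"
  proof (rule nn_integral_cong_AE)
    have "AE \<omega> in P. x 0 \<omega> = X 0 (draws 0 \<omega>)" by (rule X(2)) simp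
    thus "AE \<omega> in P. gap (X 0 (draws 0 \<omega>)) = gap x0"
      using AE_space by eventually_elim (metis x0(2))
  qed
  also have "\<dots> = gap x0" by (simp add: P.emeasure_space_1)
  finally show ?case by simp
next
  case (Suc n)
  hence n: "n \<le> T" by simp
  have ins: "hist (Suc n) = Pi\<^sub>M (insert n {..<n}) (\<lambda>_. \<pi>)" by (simp add: lessThan_Suc)
  have [measurable]: "X (Suc n) \<in> borel_measurable (Pi\<^sub>M (insert n {..<n}) (\<lambda>_. \<pi>))"
    using X(1)[OF Suc.prems] unfolding ins .
  have Xn [measurable]: "X n \<in> borel_measurable (hist n)" using X(1)[of n] n by simp
  interpret Pn: prob_space "hist n" by (rule prob_space_PiM) (rule prob)
  have "(\<integral>\<^sup>+ w. gap (X (Suc n) w) \<partial>hist (Suc n)) = (\<integral>\<^sup>+ w. \<integral>\<^sup>+ s. gap (X (Suc n) (w(n := s))) \<partial>\<pi> \<partial>hist n)"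
    unfolding ins by (rule prod.product_nn_integral_insert) auto
  hence "(\<integral>\<^sup>+ w. gap (X (Suc n) w) \<partial>hist (Suc n)) + (\<integral>\<^sup>+ w. decrease n w \<partial>hist n)
      = (\<integral>\<^sup>+ w. (\<integral>\<^sup>+ s. gap (X (Suc n) (w(n := s))) \<partial>\<pi>) + decrease n w \<partial>hist n)"
    using next_gap_measurable[OF n] decrease_measurable[OF n] by (simp add: nn_integral_add)
  also have "\<dots> = (\<integral>\<^sup>+ w. gap (X n w) + ennreal (err n) \<partial>hist n)"
    by (rule nn_integral_cong_AE) (use decrease_AE[OF n] in eventually_elim, simp)
  also have "\<dots> = (\<integral>\<^sup>+ w. gap (X n w) \<partial>hist n) + ennreal (err n)"
    by (subst nn_integral_add) (auto simp: Pn.emeasure_space_1)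
  finally have step: "(\<integral>\<^sup>+ w. gap (X (Suc n) w) \<partial>hist (Suc n)) + (\<integral>\<^sup>+ w. decrease n w \<partial>hist n)
      = (\<integral>\<^sup>+ w. gap (X n w) \<partial>hist n) + ennreal (err n)" .
  have "(\<integral>\<^sup>+ w. gap (X (Suc n) w) \<partial>hist (Suc n)) + (\<Sum>t<Suc n. \<integral>\<^sup>+ w. decrease t w \<partial>hist t)
      = ((\<integral>\<^sup>+ w. gap (X (Suc n) w) \<partial>hist (Suc n)) + (\<integral>\<^sup>+ w. decrease n w \<partial>hist n)) + (\<Sum>t<n. \<integral>\<^sup>+ w. decrease t w \<partial>hist t)"
    by (simp only: sum.lessThan_Suc add_ac)
  also have "\<dots> = ((\<integral>\<^sup>+ w. gap (X n w) \<partial>hist n) + (\<Sum>t<n. \<integral>\<^sup>+ w. decrease t w \<partial>hist t)) + ennreal (err n)"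
    unfolding step by (simp only: add_ac)
  also have "(\<integral>\<^sup>+ w. gap (X n w) \<partial>hist n) + (\<Sum>t<n. \<integral>\<^sup>+ w. decrease t w \<partial>hist t) = gap x0 + (\<Sum>t<n. ennreal (err t))"
    using Suc by simp
  finally show ?case by (simp add: add.assoc)
qed

lemma complexity_bound:
  "(\<integral>\<^sup>+ \<omega>. (\<Sum>t\<le>T. ennreal (calA p \<rho> \<tau> \<eta> * inverse (\<beta> t - \<eta>)) * (dist_zero (limiting_subdiff env (x t \<omega>)))\<^sup>2) \<partial>P)
    \<le> ennreal (2 * \<rho> * (envr x0 - m + (\<Sum>t\<le>T. err t)))"
proof -
  have "(\<integral>\<^sup>+ \<omega>. (\<Sum>t\<le>T. ennreal (calA p \<rho> \<tau> \<eta> * inverse (\<beta> t - \<eta>)) * (dist_zero (limiting_subdiff env (x t \<omega>)))\<^sup>2) \<partial>P)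
      \<le> (\<integral>\<^sup>+ \<omega>. (\<Sum>t\<le>T. ennreal (2 * \<rho>) * decrease t (draws t \<omega>)) \<partial>P)"
  \<comment> \<open>Monotonicity of the nonnegative integral tolerates a nonmeasurable integrand.
    The sum and the integral are exchanged only after passing to the measurable
    \<open>decrease\<close>.\<close>
  proof (rule nn_integral_mono_AE)
    have "AE \<omega> in P. ennreal (calA p \<rho> \<tau> \<eta> * inverse (\<beta> t - \<eta>)) * (dist_zero (limiting_subdiff env (x t \<omega>)))\<^sup>2
        \<le> ennreal (2 * \<rho>) * decrease t (draws t \<omega>)" if t: "t \<le> T" for t
    proof -
      have "AE w in hist t. ennreal (calA p \<rho> \<tau> \<eta> * inverse (\<beta> t - \<eta>)) * (dist_zero (limiting_subdiff env (X t w)))\<^sup>2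
        \<le> ennreal (2 * \<rho>) * decrease t w"
        using decrease_AE[OF t] by eventually_elim (rule conjunct2)
      hence "AE w in distr P (hist t) (draws t). ennreal (calA p \<rho> \<tau> \<eta> * inverse (\<beta> t - \<eta>)) *
          (dist_zero (limiting_subdiff env (X t w)))\<^sup>2 \<le> ennreal (2 * \<rho>) * decrease t w"
        by (simp only: law)
      from AE_distrD[OF draws_measurable this]
      have "AE \<omega> in P. ennreal (calA p \<rho> \<tau> \<eta> * inverse (\<beta> t - \<eta>)) * (dist_zero (limiting_subdiff env (X t (draws t \<omega>))))\<^sup>2
        \<le> ennreal (2 * \<rho>) * decrease t (draws t \<omega>)" .
      moreover have "AE \<omega> in P. x t \<omega> = X t (draws t \<omega>)" by (rule X(2)) (use t in simp)
      ultimately show ?thesis by eventually_elim simp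
    qed
    hence "AE \<omega> in P. \<forall>t\<in>{..T}. ennreal (calA p \<rho> \<tau> \<eta> * inverse (\<beta> t - \<eta>)) * (dist_zero (limiting_subdiff env (x t \<omega>)))\<^sup>2
        \<le> ennreal (2 * \<rho>) * decrease t (draws t \<omega>)"
      by (subst AE_ball_countable) auto
    thus "AE \<omega> in P. (\<Sum>t\<le>T. ennreal (calA p \<rho> \<tau> \<eta> * inverse (\<beta> t - \<eta>)) * (dist_zero (limiting_subdiff env (x t \<omega>)))\<^sup>2)
        \<le> (\<Sum>t\<le>T. ennreal (2 * \<rho>) * decrease t (draws t \<omega>))"
      by eventually_elim (rule sum_mono, blast)
  qed
  also have "\<dots> = (\<Sum>t\<le>T. \<integral>\<^sup>+ \<omega>. ennreal (2 * \<rho>) * decrease t (draws t \<omega>) \<partial>P)"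
  proof (rule nn_integral_sum)
    fix t assume "t \<in> {..T}"
    hence [measurable]: "decrease t \<in> borel_measurable (hist t)" by (intro decrease_measurable) simp
    show "(\<lambda>\<omega>. ennreal (2 * \<rho>) * decrease t (draws t \<omega>)) \<in> borel_measurable P" by measurable
  qed
  also have "\<dots> = (\<Sum>t\<le>T. ennreal (2 * \<rho>) * (\<integral>\<^sup>+ w. decrease t w \<partial>hist t))"
  proof (rule sum.cong[OF refl])
    fix t assume "t \<in> {..T}"
    hence dm [measurable]: "decrease t \<in> borel_measurable (hist t)" by (intro decrease_measurable) simp
    have "(\<integral>\<^sup>+ \<omega>. ennreal (2 * \<rho>) * decrease t (draws t \<omega>) \<partial>P) = ennreal (2 * \<rho>) * (\<integral>\<^sup>+ \<omega>. decrease t (draws t \<omega>) \<partial>P)"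
      by (rule nn_integral_cmult) measurable
    thus "(\<integral>\<^sup>+ \<omega>. ennreal (2 * \<rho>) * decrease t (draws t \<omega>) \<partial>P) = ennreal (2 * \<rho>) * (\<integral>\<^sup>+ w. decrease t w \<partial>hist t)"
      by (simp only: nn_integral_law[OF dm])
  qed
  also have "\<dots> = ennreal (2 * \<rho>) * (\<Sum>t<Suc T. \<integral>\<^sup>+ w. decrease t w \<partial>hist t)"
    by (simp only: sum_distrib_left lessThan_Suc_atMost)
  \<comment> \<open>The expected gap of the last iterate is nonnegative and is dropped.\<close>
  also have "\<dots> \<le> ennreal (2 * \<rho>) * (gap x0 + (\<Sum>t<Suc T. ennreal (err t)))"
    unfolding telescope[OF order_refl, symmetric] by (intro mult_left_mono) auto
  also have "(\<Sum>t<Suc T. ennreal (err t)) = ennreal (\<Sum>t\<le>T. err t)"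
    unfolding lessThan_Suc_atMost using err_nonneg by (rule sum_ennreal)
  also have "gap x0 + ennreal (\<Sum>t\<le>T. err t) = ennreal (envr x0 - m + (\<Sum>t\<le>T. err t))"
    unfolding gap_def using envr_ge[of x0] err_nonneg by (subst ennreal_plus) (auto intro: sum_nonneg)
  also have "ennreal (2 * \<rho>) * ennreal (envr x0 - m + (\<Sum>t\<le>T. err t)) = ennreal (2 * \<rho> * (envr x0 - m + (\<Sum>t\<le>T. err t)))"
    using \<rho> by (intro ennreal_mult'[symmetric]) simp
  finally show ?thesis .
qed

end

theorem theorem5p1:
  fixes f \<phi> F :: "'a::euclidean_space \<Rightarrow> ereal"
    and U :: "'a set" and fm :: "'a \<Rightarrow> 'a \<Rightarrow> 'w \<Rightarrow> real" and \<pi> :: "'w measure"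
    and P :: "'m measure" and \<xi> :: "nat \<Rightarrow> 'm \<Rightarrow> 'w" and x :: "nat \<Rightarrow> 'm \<Rightarrow> 'a" and x0 :: 'a
    and p \<nu> \<tau> \<eta> L1 L2 \<rho> :: real and \<beta> :: "nat \<Rightarrow> real" and T :: nat
  assumes "proper \<phi>" and "lower_semicontinuous \<phi>"
    and "proper f" and "lower_semicontinuous f"
    and F: "F = (\<lambda>y. f y + \<phi> y)"
    and min_exists: "\<exists>z. is_arg_min F (\<lambda>_. True) z"
    and model: "stochastic_one_sided_model \<pi> f \<phi> U fm p \<nu> \<tau> \<eta> L1 L2"
    and rho: "\<rho> > 2 * (2 * \<tau> + \<eta>)"
    and beta: "\<And>t. \<beta> t > rho_tilde p \<rho> \<tau>"
    and run: "model_based_method P \<pi> \<xi> \<phi> fm \<beta> x0 T x"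
  shows "enn2ereal (\<integral>\<^sup>+ \<omega>. (\<Sum>t\<le>T. ennreal (calA p \<rho> \<tau> \<eta> * inverse (\<beta> t - \<eta>)) *
              (dist_zero (limiting_subdiff (moreau p F (1 / \<rho>)) (x t \<omega>)))\<^sup>2) \<partial>P)
         \<le> ereal (2 * \<rho>) * (moreau p F (1 / \<rho>) x0 - (INF y. F y))
           + ereal (\<rho>\<^sup>2 * calB p \<nu> \<rho> \<tau> \<eta> *
               (\<Sum>t\<le>T. let b = \<beta> t - rho_tilde p \<rho> \<tau> in
                  pow2p p b (- 2) + L1\<^sup>2 * b powr (- 2)
                  + pow2p p b (- p) + L1 powr p * b powr (- p)
                  + L2 powr (2 / (2 - \<nu>)) * b powr (- 2 / (2 - \<nu>))
                  + L2 powr (p / (2 - \<nu>)) * b powr (- p / (2 - \<nu>))))"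
proof -
  note m = model[unfolded stochastic_one_sided_model_def]
  from m have "\<exists>l1 l2. l1 \<in> borel_measurable \<pi> \<and> l2 \<in> borel_measurable \<pi> \<and>
        (\<forall>s\<in>space \<pi>. 0 \<le> l1 s \<and> 0 \<le> l2 s) \<and>
        integrable \<pi> (\<lambda>s. (l1 s)\<^sup>2) \<and> sqrt (\<integral>s. (l1 s)\<^sup>2 \<partial>\<pi>) \<le> L1 \<and>
        integrable \<pi> (\<lambda>s. l2 s powr (\<nu> + 1)) \<and>
        (\<integral>s. l2 s powr (\<nu> + 1) \<partial>\<pi>) powr (1 / (\<nu> + 1)) \<le> L2 \<and>
        (\<forall>x\<in>U. \<forall>y\<in>U. AE s in \<pi>.
           fm x x s - fm x y s \<le> l1 s * norm (x - y) + l2 s * norm (x - y) powr \<nu>)"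
    by (elim conjE)
  then obtain l1 l2 where l: "l1 \<in> borel_measurable \<pi>" "l2 \<in> borel_measurable \<pi>"
    "\<forall>s\<in>space \<pi>. 0 \<le> l1 s \<and> 0 \<le> l2 s"
    "integrable \<pi> (\<lambda>s. (l1 s)\<^sup>2)" "sqrt (\<integral>s. (l1 s)\<^sup>2 \<partial>\<pi>) \<le> L1"
    "integrable \<pi> (\<lambda>s. l2 s powr (\<nu> + 1))" "(\<integral>s. l2 s powr (\<nu> + 1) \<partial>\<pi>) powr (1 / (\<nu> + 1)) \<le> L2"
    "\<forall>x\<in>U. \<forall>y\<in>U. AE s in \<pi>. fm x x s - fm x y s \<le> l1 s * norm (x - y) + l2 s * norm (x - y) powr \<nu>"
    by (elim exE conjE)
  interpret one_sided_model f \<phi> F U fm \<pi> p \<nu> \<tau> \<eta> L1 L2 \<rho>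
    by (rule one_sided_model.intro) fact+
  interpret one_sided_model_moduli f \<phi> F U fm \<pi> p \<nu> \<tau> \<eta> L1 L2 \<rho> l1 l2
    by unfold_locales (use l in \<open>simp_all\<close>)
  interpret model_run f \<phi> F U fm \<pi> p \<nu> \<tau> \<eta> L1 L2 \<rho> l1 l2 P \<xi> x x0 \<beta> T
    by unfold_locales (rule run beta)+
  have nn: "0 \<le> 2 * \<rho> * (envr x0 - m + (\<Sum>t\<le>T. err t))"
    using \<rho> envr_ge[of x0] err_nonneg by (intro mult_nonneg_nonneg add_nonneg_nonneg sum_nonneg) auto
  have "enn2ereal (\<integral>\<^sup>+ \<omega>. (\<Sum>t\<le>T. ennreal (calA p \<rho> \<tau> \<eta> * inverse (\<beta> t - \<eta>)) *
              (dist_zero (limiting_subdiff env (x t \<omega>)))\<^sup>2) \<partial>P)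
      \<le> enn2ereal (ennreal (2 * \<rho> * (envr x0 - m + (\<Sum>t\<le>T. err t))))"
    using complexity_bound by (simp only: less_eq_ennreal.rep_eq)
  also have "\<dots> = ereal (2 * \<rho> * (envr x0 - m + (\<Sum>t\<le>T. err t)))"
    using nn by (rule enn2ereal_ennreal)
  \<comment> \<open>The square of \<rho> is 2\<rho> times the factor \<rho>/2 inside
    \<open>err\<close>.\<close>
  also have "2 * \<rho> * (envr x0 - m + (\<Sum>t\<le>T. err t)) = 2 * \<rho> * (envr x0 - m) + \<rho>\<^sup>2 * calB p \<nu> \<rho> \<tau> \<eta> *
      (\<Sum>t\<le>T. error_terms p \<nu> L1 L2 (\<beta> t - rho_tilde p \<rho> \<tau>))"
    unfolding err_def sum_distrib_left[symmetric] by (simp add: distrib_left power2_eq_square)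
  also have "ereal (2 * \<rho> * (envr x0 - m) + \<rho>\<^sup>2 * calB p \<nu> \<rho> \<tau> \<eta> *
      (\<Sum>t\<le>T. error_terms p \<nu> L1 L2 (\<beta> t - rho_tilde p \<rho> \<tau>)))
    = ereal (2 * \<rho>) * (env x0 - ereal m) + ereal (\<rho>\<^sup>2 * calB p \<nu> \<rho> \<tau> \<eta> *
      (\<Sum>t\<le>T. error_terms p \<nu> L1 L2 (\<beta> t - rho_tilde p \<rho> \<tau>)))"
    by (simp add: env_real)
  also have "ereal m = (INF y. F y)" unfolding m_def by (rule INF_F)
  finally show ?thesis unfolding error_terms_def Let_def .
qed

end
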